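(* Let $\lambda\in\mathbb{R}_+$, let $p\le\nu<n$ be nonnegative integers, and consider the Lure system $$\dot x = Ax+B_u u+B_w w,\quad y=C_y x,\quad z=C_z x,\quad w=-\varphi(z),\qquad (\mathrm{S})$$ with $x\in\mathbb{R}^n$ and $u,y,w,z\in\mathbb{R}$, where $A\in\mathbb{R}^{n\times n}$, $B_u,B_w\in\mathbb{R}^{n\times 1}$, $C_y,C_z\in\mathbb{R}^{1\times n}$, and $\varphi:\mathbb{R}\to\mathbb{R}$ is continuously differentiable with $\varphi(0)=0$. Let $$\dot{\hat x}=\hat A\hat x+\hat B_u\hat u+\hat B_w\hat w,\quad \hat y=\hat C_y\hat x,\quad \hat z=\hat C_z\hat x,\quad \hat w=-\varphi(\hat z),\qquad (\hat{\mathrm{S}})$$ with $\hat x\in\mathbb{R}^\nu$, be a reduced order model of (S) obtained by the dominant/non-dominant splitting construction with rate $\lambda$ and $p$ dominant eigenvalues described in the context. Let $G$, $\hat G$ be the $2\times 2$ transfer functions of the linear parts of (S) and $(\hat{\mathrm S})$, let $\hat G_{zw}(s)=\hat C_z(sI-\hat A)^{-1}\hat B_w$, and let $\tilde G=G-\hat G$. Assume: (A1) the linear dynamics $\dot x=Ax+B_uu+B_ww$, $y=C_yx$, $z=C_zx$ is strictly $p$-dominant with rate $\lambda$; (A2) $\partial\varphi\in[-\mu,\mu]$, with $\mu\in\mathbb{R}_+$, $\mu>0$; (A3) $\|\tilde G\|_{\infty,0}\le\epsilon$, with $0<\epsilon<\mu^{-1}$; (A4) $\|\hat G_{zw}\|_{\infty,p}<\mu^{-1}-\epsilon$,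 where the norms are taken with respect to the rate $\lambda$. Then the system (S) is strictly $p$-dominant with rate $\lambda$.
   Context: $\mathbb{R}_+$ denotes the nonnegative reals. **Dominance.** Consider $\dot x=f(x)+Bu$ with $f:\mathbb{R}^n\to\mathbb{R}^n$ continuously differentiable and Jacobian $\partial f$. The system is $p$-dominant with rate $\lambda\in\mathbb{R}_+$ (for $u=0$) if there exist $\varepsilon\in\mathbb{R}_+$ and a symmetric matrix $P\in\mathbb{R}^{n\times n}$ with inertia $(p,0,n-p)$ (i.e. $p$ negative, no zero, and $n-p$ positive eigenvalues) such that, for all $(x,\delta x)\in\mathbb{R}^n\times\mathbb{R}^n$, with $\dot{\delta x}=\partial f(x)\delta x$, $$\begin{bmatrix}\dot{\delta x}\\ \delta x\end{bmatrix}^{\mathsf T}\begin{bmatrix}0 & P \\ P & 2\lambda P+\varepsilon I\end{bmatrix}\begin{bmatrix}\dot{\delta x}\\ \delta x\end{bmatrix}\le 0 .$$ It is strictly $p$-dominant if this holds with some $\varepsilon>0$. For the linear dynamics, $f(x)=Ax$ (inputs $u,w$ set to zero). For the Lure system (S), $f(x)=Ax-B_w\varphi(C_zx)$ (with $u=0$). **Sector condition.** $\partial\varphi\in[\alpha,\beta]$ means $(\partial\varphi(z)\,\delta z-\alpha\,\delta z)(\partial\varphi(z)\,\delta z-\beta\,\delta z)\le 0$ for all $z,\delta z\in\mathbb{R}$, where $\partial\varphi$ is the derivative of $\varphi$. **Transfer functions.** With $B=[\,B_u\ B_w\,]$ and $C=[\,C_y^{\mathsf T}\ C_z^{\mathsf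 T}\,]^{\mathsf T}$, set $G(s)=C(sI-A)^{-1}B$, with entries $G_{yu},G_{yw},G_{zu},G_{zw}$; similarly $\hat G(s)=\hat C(sI-\hat A)^{-1}\hat B$ with $\hat B=[\,\hat B_u\ \hat B_w\,]$, $\hat C=[\,\hat C_y^{\mathsf T}\ \hat C_z^{\mathsf T}\,]^{\mathsf T}$. **Norm.** For a rational transfer function $H$ with no poles on the line $\mathrm{Re}(s)=-\lambda$ and exactly $q$ poles in the open half-plane $\mathrm{Re}(s)>-\lambda$, $$\|H\|_{\infty,q}=\sup_{\omega\in\mathbb{R}}\sigma_{\max}\big(H(i\omega-\lambda)\big),$$ where $\sigma_{\max}$ is the largest singular value. (Writing $\|H\|_{\infty,q}$ presupposes that $H$ has these pole properties. The norm depends on $\lambda$.) **Construction of the reduced order model.** After a possible linear change of state coordinates in (S), write $$A=\begin{bmatrix}A^+ & 0 \\ 0 & A^-\end{bmatrix},\quad B=\begin{bmatrix}B^+ \\ B^-\end{bmatrix},\quad C=\begin{bmatrix}C^+ & C^-\end{bmatrix},$$ where $A^+\in\mathbb{R}^{p\times p}$ has only dominant eigenvalues ($\mathrm{Re}>-\lambda$) and $A^-\in\mathbb{R}^{(n-p)\times(n-p)}$ has only non-dominant eigenvalues ($\mathrm{Re}<-\lambda$). Replace the non-dominant linear dynamics $(A^-,B^-,C^-)$ by a reduced linear model $(\hat A^-,\hat B^-,\hat C^-)$ of order $\nu-p$, with the same numbers of inputs and outputs, produced by a stability-preserving reduction method, so that all eigenvalues of $\hat A^-$ satisfy $\mathrm{Re}<-\lambda$.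 The reduced order model is defined by $$\hat A=\begin{bmatrix}A^+ & 0 \\ 0 & \hat A^-\end{bmatrix},\quad \hat B=\begin{bmatrix}B^+ \\ \hat B^-\end{bmatrix},\quad \hat C=\begin{bmatrix}C^+ & \hat C^-\end{bmatrix},$$ with the nonlinearity $\varphi$ left unchanged. *)

theory Defs
  imports
    "HOL-Complex_Analysis.Complex_Analysis"
    "Jordan_Normal_Form.Schur_Decomposition"
    "Jordan_Normal_Form.Gauss_Jordan_Elimination"
    "Jordan_Normal_Form.DL_Submatrix"
begin

(* Dimensions are natural numbers (possibly 0 for the reduced model), so vectors and matrices
   are those of Jordan_Normal_Form with explicit carriers.  Constants whose base names also
   occur in HOL-Analysis are written qualified. *)

unbundle no vec_syntax and no inner_syntax

section \<open>Continuously differentiable vector fields\<close>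

definition euclid_norm :: "real Matrix.vec \<Rightarrow> real" where
  "euclid_norm v = sqrt (v \<bullet> v)"

(* J x is the Frechet derivative of f at x, and x |-> J x is continuous; the vectors of
   Jordan_Normal_Form carry no topology, so both are spelled out on the carrier. *)
definition C1_with_jacobian ::
  "nat \<Rightarrow> (real Matrix.vec \<Rightarrow> real Matrix.vec) \<Rightarrow> (real Matrix.vec \<Rightarrow> real Matrix.mat) \<Rightarrow> bool" where
  "C1_with_jacobian n f J \<longleftrightarrow>
     f \<in> carrier_vec n \<rightarrow> carrier_vec n \<and>
     J \<in> carrier_vec n \<rightarrow> carrier_mat n n \<and>
     (\<forall>x\<in>carrier_vec n. \<forall>e>0. \<exists>d>0. \<forall>h\<in>carrier_vec n. euclid_norm h < d \<longrightarrow>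
        euclid_norm (f (x + h) - f x - J x *\<^sub>v h) \<le> e * euclid_norm h) \<and>
     (\<forall>x\<in>carrier_vec n. \<forall>e>0. \<exists>d>0. \<forall>y\<in>carrier_vec n. euclid_norm (y - x) < d \<longrightarrow>
        (\<forall>i<n. \<forall>j<n. \<bar>J y $$ (i, j) - J x $$ (i, j)\<bar> < e))"

section \<open>Dominance\<close>

(* Numbers of negative, zero and positive eigenvalues, counted with algebraic multiplicity.
   Only meaningful for symmetric matrices, all of whose eigenvalues are real. *)
definition inertia :: "real Matrix.mat \<Rightarrow> nat \<times> nat \<times> nat" where
  "inertia P =
     (\<Sum>a | eigenvalue P a \<and> a < 0. Polynomial.order a (char_poly P),
      \<Sum>a | eigenvalue P a \<and> a = 0. Polynomial.order a (char_poly P),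
      \<Sum>a | eigenvalue P a \<and> a > 0. Polynomial.order a (char_poly P))"

definition dominance_matrix :: "nat \<Rightarrow> real \<Rightarrow> real \<Rightarrow> real Matrix.mat \<Rightarrow> real Matrix.mat" where
  "dominance_matrix n lam eps P =
     four_block_mat (0\<^sub>m n n) P P ((2 * lam) \<cdot>\<^sub>m P + eps \<cdot>\<^sub>m 1\<^sub>m n)"

definition dominant_with ::
  "nat \<Rightarrow> (real Matrix.vec \<Rightarrow> real Matrix.vec) \<Rightarrow> nat \<Rightarrow> real \<Rightarrow> real \<Rightarrow> bool" where
  "dominant_with n f p lam eps \<longleftrightarrow>
     (\<exists>J P. C1_with_jacobian n f J \<and>
        P \<in> carrier_mat n n \<and> transpose_mat P = P \<and> inertia P = (p, 0, n - p) \<and>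
        (\<forall>x\<in>carrier_vec n. \<forall>dx\<in>carrier_vec n.
           let v = (J x *\<^sub>v dx) @\<^sub>v dx in v \<bullet> (dominance_matrix n lam eps P *\<^sub>v v) \<le> 0))"

definition dominant ::
  "nat \<Rightarrow> (real Matrix.vec \<Rightarrow> real Matrix.vec) \<Rightarrow> nat \<Rightarrow> real \<Rightarrow> bool" where
  "dominant n f p lam \<longleftrightarrow> (\<exists>eps\<ge>0. dominant_with n f p lam eps)"

definition strictly_dominant ::
  "nat \<Rightarrow> (real Matrix.vec \<Rightarrow> real Matrix.vec) \<Rightarrow> nat \<Rightarrow> real \<Rightarrow> bool" where
  "strictly_dominant n f p lam \<longleftrightarrow> (\<exists>eps>0. dominant_with n f p lam eps)"

section \<open>Lure systems\<close>

definition linear_field :: "real Matrix.mat \<Rightarrow> real Matrix.vec \<Rightarrow> real Matrix.vec" where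
  "linear_field A x = A *\<^sub>v x"

(* Bw is the n x 1 input column and Cz the 1 x n output row. *)
definition lure_field ::
  "real Matrix.mat \<Rightarrow> real Matrix.vec \<Rightarrow> real Matrix.vec \<Rightarrow> (real \<Rightarrow> real) \<Rightarrow>
   real Matrix.vec \<Rightarrow> real Matrix.vec" where
  "lure_field A Bw Cz \<phi> x = A *\<^sub>v x - \<phi> (Cz \<bullet> x) \<cdot>\<^sub>v Bw"

definition deriv_in_sector :: "(real \<Rightarrow> real) \<Rightarrow> real \<Rightarrow> real \<Rightarrow> bool" where
  "deriv_in_sector \<phi> \<alpha> \<beta> \<longleftrightarrow>
     (\<forall>z \<delta>z. (deriv \<phi> z * \<delta>z - \<alpha> * \<delta>z) * (deriv \<phi> z * \<delta>z - \<beta> * \<delta>z) \<le> 0)"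

section \<open>Transfer functions\<close>

abbreviation cmat :: "real Matrix.mat \<Rightarrow> complex Matrix.mat" where
  "cmat \<equiv> map_mat complex_of_real"

(* Rational transfer functions are represented as functions of s; the value at an eigenvalue
   of A is arbitrary. *)
definition transfer ::
  "real Matrix.mat \<Rightarrow> real Matrix.mat \<Rightarrow> real Matrix.mat \<Rightarrow> complex \<Rightarrow> complex Matrix.mat" where
  "transfer A B C s =
     cmat C * the (mat_inverse (s \<cdot>\<^sub>m 1\<^sub>m (dim_row A) - cmat A)) * cmat B"

definition pole_order :: "(complex \<Rightarrow> complex) \<Rightarrow> complex \<Rightarrow> nat" where
  "pole_order h s = (if is_pole h s then nat (- zorder h s) else 0)"

(* Multiplicity of s as a pole of a matrix transfer function in the McMillan sense: the
   multiplicity of s as a root of the least common denominator of all minors of H.  For a 1 x 1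
   H it is the ordinary pole order; it is 0 iff no entry of H has a pole at s. *)
definition pole_mult :: "(complex \<Rightarrow> complex Matrix.mat) \<Rightarrow> complex \<Rightarrow> nat" where
  "pole_mult H s =
     Max {pole_order (\<lambda>t. Determinant.det (submatrix (H t) I J)) s | I J.
            I \<subseteq> {..<dim_row (H s)} \<and> J \<subseteq> {..<dim_col (H s)} \<and> card I = card J}"

definition pole_split :: "real \<Rightarrow> nat \<Rightarrow> (complex \<Rightarrow> complex Matrix.mat) \<Rightarrow> bool" where
  "pole_split lam q H \<longleftrightarrow>
     (\<forall>s. Re s = - lam \<longrightarrow> pole_mult H s = 0) \<and>
     finite {s. Re s > - lam \<and> pole_mult H s \<noteq> 0} \<and>
     (\<Sum>s | Re s > - lam \<and> pole_mult H s \<noteq> 0. pole_mult H s) = q"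

definition singular_values :: "complex Matrix.mat \<Rightarrow> real set" where
  "singular_values M =
     {sqrt x | x. eigenvalue (mat_adjoint M * M) (complex_of_real x)}"

definition sigma_max :: "complex Matrix.mat \<Rightarrow> real" where
  "sigma_max M = Max (singular_values M)"

(* Outside the class of transfer functions on which the norm with index q is defined the value
   is infinity, so any finite upper bound on it entails that the function is in this class. *)
definition hinf_norm :: "real \<Rightarrow> nat \<Rightarrow> (complex \<Rightarrow> complex Matrix.mat) \<Rightarrow> ereal" where
  "hinf_norm lam q H =
     (if pole_split lam q H
      then (SUP \<omega>::real. ereal (sigma_max (H (\<i> * complex_of_real \<omega> - complex_of_real lam))))
      else \<infinity>)"

section \<open>Reduction by dominant/non-dominant splitting\<close>

definition block_diag :: "real Matrix.mat \<Rightarrow> real Matrix.mat \<Rightarrow> real Matrix.mat" where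
  "block_diag A D = four_block_mat A (0\<^sub>m (dim_row A) (dim_col D)) (0\<^sub>m (dim_row D) (dim_col A)) D"

definition beside :: "real Matrix.mat \<Rightarrow> real Matrix.mat \<Rightarrow> real Matrix.mat" where
  "beside C D = four_block_mat C D (0\<^sub>m 0 (dim_col C)) (0\<^sub>m 0 (dim_col D))"

(* T is the change of state coordinates x = T * x', with inverse Ti; m and l are the numbers of
   inputs and outputs. *)
definition splitting_reduction ::
  "real \<Rightarrow> nat \<Rightarrow> nat \<Rightarrow> nat \<Rightarrow> nat \<Rightarrow> nat \<Rightarrow>
   real Matrix.mat \<Rightarrow> real Matrix.mat \<Rightarrow> real Matrix.mat \<Rightarrow>
   real Matrix.mat \<Rightarrow> real Matrix.mat \<Rightarrow> real Matrix.mat \<Rightarrow> bool" where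
  "splitting_reduction lam p n \<nu> m l A B C Ah Bh Ch \<longleftrightarrow>
     (\<exists>T Ti Ap Am Bp Bm Cp Cm Ahm Bhm Chm.
        Ap \<in> carrier_mat p p \<and> Am \<in> carrier_mat (n - p) (n - p) \<and>
        Bp \<in> carrier_mat p m \<and> Bm \<in> carrier_mat (n - p) m \<and>
        Cp \<in> carrier_mat l p \<and> Cm \<in> carrier_mat l (n - p) \<and>
        similar_mat_wit A (block_diag Ap Am) T Ti \<and>
        B = T * (Bp @\<^sub>r Bm) \<and> C = beside Cp Cm * Ti \<and>
        (\<forall>s. eigenvalue (cmat Ap) s \<longrightarrow> Re s > - lam) \<and>
        (\<forall>s. eigenvalue (cmat Am) s \<longrightarrow> Re s < - lam) \<and>
        Ahm \<in> carrier_mat (\<nu> - p) (\<nu> - p) \<and>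
        Bhm \<in> carrier_mat (\<nu> - p) m \<and> Chm \<in> carrier_mat l (\<nu> - p) \<and>
        (\<forall>s. eigenvalue (cmat Ahm) s \<longrightarrow> Re s < - lam) \<and>
        Ah = block_diag Ap Ahm \<and> Bh = Bp @\<^sub>r Bhm \<and> Ch = beside Cp Chm)"

end

(* A strict bounded-real inequality for the transfer function from w to z on the line Re s = - lam
   yields, by the Kalman-Yakubovich-Popov lemma, a symmetric P with
   2 x' P ((A + lam I) x + Bw w) + mu^2 |Cz x|^2 - |w|^2 < 0; the sector condition bounds the last
   two terms, which gives the dominance inequality for every Jacobian of the Lure system.  The gain
   bound itself is the triangle inequality for the reduced model and the error system.

   The KYP lemma is proved by convex duality.  If no P exists, a separation argument produces a
   positive semidefinite Z = [X V; V' z] with M X + Bw V' + (M X + Bw V')' = 0 and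
   mu^2 Cz X Cz' >= z.  Then V = X k, the product of N = M + Bw k' with X is skew, and X splits into
   rank-one parts spanned by eigenvectors of N with imaginary eigenvalues, each of which contradicts
   the gain bound.

   The inertia of P is read off from invariant subspaces: the Lyapunov inequality makes P positive
   (negative) definite on the stable (antistable) subspace of A + lam I, and P itself satisfies such
   an inequality with respect to - P, so a dimension count determines the signs of its eigenvalues. *)
theory Submission
  imports Defs
begin

section \<open>Linear matrix inequalities and density matrices\<close>

text \<open>Bounded-real lemmas are often proved through Riccati equations or Hamiltonian matrices,
  under stability or controllability. Here \<open>A + lam I\<close> may have eigenvalues on both
  sides of the imaginary axis and the pair with Bw need not be controllable. The dual argument uses
  the gain bound only pointwise, on solutions (x, w) of i \<omega> x = (A + lam I) x + Bw w. The
  dual block X may be singular, so N cannot be made skew-Hermitian by conjugating with a square root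
  of X; X is instead deflated along a triangular basis of the adjoint of N. Strictness comes from
  compactness: the normalised dual set is compact, so if it misses its target it has positive
  distance from it. This makes the form uniformly negative, and the resulting
  \<open>\<kappa>\<close> finally serves as the epsilon of strict dominance. The number of negative
  eigenvalues of P equals the number of eigenvalues of A to the right of Re s = - lam, and the
  splitting of A supplies that number.\<close>

text \<open>Matrices are plain functions of their indices here: the product topology on such functions
  makes the set of density matrices compact, whereas the matrices of Jordan_Normal_Form carry no
  topology.\<close>

definition quad_form :: "nat set \<Rightarrow> (nat \<Rightarrow> nat \<Rightarrow> real) \<Rightarrow> (nat \<Rightarrow> real) \<Rightarrow> real" where
  "quad_form I X y = (\<Sum>i\<in>I. \<Sum>j\<in>I. X i j * y i * y j)"

definition entry_pairing :: "nat set \<Rightarrow> (nat \<Rightarrow> nat \<Rightarrow> real) \<Rightarrow> (nat \<Rightarrow> nat \<Rightarrow> real) \<Rightarrow> real" where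
  "entry_pairing I L Z = (\<Sum>i\<in>I. \<Sum>j\<in>I. L i j * Z i j)"

text \<open>Entries off \<open>I\<close> are pinned to 0 because compactness is sought in the
  product over all of nat \<times> nat. The trace condition normalises the dual cone: it excludes 0
  and bounds the set. The name is that of quantum mechanics.\<close>

definition density_matrices :: "nat set \<Rightarrow> (nat \<times> nat \<Rightarrow> real) set" where
  "density_matrices I =
     {Z. (\<forall>i j. Z (i, j) = Z (j, i)) \<and> (\<forall>i j. i \<notin> I \<longrightarrow> Z (i, j) = 0) \<and>
         (\<forall>y. 0 \<le> quad_form I (curry Z) y) \<and> (\<Sum>i\<in>I. Z (i, i)) = 1}"

lemma quad_form_two_points:
  assumes "finite I" "i \<in> I" "j \<in> I" "i \<noteq> j"
  shows "quad_form I X (\<lambda>k. if k = i then s else if k = j then t else 0) =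
    X i i * s * s + X i j * s * t + X j i * t * s + X j j * t * t"
proof -
  let ?y = "\<lambda>k. if k = i then s else if k = j then t else 0"
  have *: "(\<Sum>k\<in>I. f k * ?y k) = f i * s + f j * t" for f :: "nat \<Rightarrow> real"
  proof -
    have "(\<Sum>k\<in>I. f k * ?y k) = (\<Sum>k\<in>{i, j}. f k * ?y k)"
      by (rule sum.mono_neutral_right) (use assms in auto)
    then show ?thesis using assms(4) by auto
  qed
  have "quad_form I X ?y = (\<Sum>k\<in>I. (\<Sum>l\<in>I. X k l * ?y l) * ?y k)"
    unfolding quad_form_def sum_distrib_right by (intro sum.cong refl) (simp only: mult_ac)
  also have "\<dots> = (\<Sum>k\<in>I. (X k i * s + X k j * t) * ?y k)"
    by (simp only: *)
  also have "\<dots> = (X i i * s + X i j * t) * s + (X j i * s + X j j * t) * t"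
    by (rule *)
  finally show ?thesis by (simp add: algebra_simps)
qed

lemma quad_form_one_point:
  assumes "finite I" "i \<in> I"
  shows "quad_form I X (\<lambda>k. if k = i then s else 0) = X i i * s * s"
proof -
  have "quad_form I X (\<lambda>k. if k = i then s else 0) =
      (\<Sum>k\<in>I. if k = i then (\<Sum>l\<in>I. if l = i then X k l * s * s else 0) else 0)"
    unfolding quad_form_def by (auto intro!: sum.cong)
  then show ?thesis using assms by simp
qed

text \<open>Diagonal entries are nonnegative and add up to 1. Testing the form at e_i + e_j and at
  e_i - e_j gives 2 |Z_ij| \<le> Z_ii + Z_jj \<le> 2.\<close>

lemma density_matrices_bounded:
  assumes "finite I" "Z \<in> density_matrices I"
  shows "\<bar>Z (i, j)\<bar> \<le> 1"
proof (cases "i \<in> I \<and> j \<in> I")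
  case False
  then have "Z (i, j) = 0"
    using assms(2) unfolding density_matrices_def by auto
  then show ?thesis by simp
next
  case True
  then have I: "i \<in> I" "j \<in> I" by auto
  have psd: "0 \<le> quad_form I (curry Z) y" for y
    using assms(2) by (auto simp: density_matrices_def)
  have sym: "Z (i, j) = Z (j, i)" for i j
    using assms(2) by (auto simp: density_matrices_def)
  have tr: "(\<Sum>i\<in>I. Z (i, i)) = 1" using assms(2) by (auto simp: density_matrices_def)
  have d: "0 \<le> Z (k, k)" if "k \<in> I" for k
    using psd[of "\<lambda>l. if l = k then 1 else 0"] quad_form_one_point[OF assms(1) that, of "curry Z" 1] by simp
  have le1: "Z (k, k) \<le> 1" if "k \<in> I" for k
    using member_le_sum[of k I "\<lambda>k. Z (k, k)"] d that assms(1) tr by auto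
  show ?thesis
  proof (cases "i = j")
    case True
    then show ?thesis using d[OF I(1)] le1[OF I(1)] by simp
  next
    case False
    have "Z (i, i) + Z (j, j) \<ge> 0 + 2 * Z (i, j)" "Z (i, i) + Z (j, j) \<ge> - 2 * Z (i, j)"
      using psd[of "\<lambda>k. if k = i then 1 else if k = j then 1 else 0"]
        psd[of "\<lambda>k. if k = i then 1 else if k = j then -1 else 0"] sym[of i j]
      by (simp_all only: quad_form_two_points[OF assms(1) I False]) auto
    then show ?thesis using le1[OF I(1)] le1[OF I(2)] by linarith
  qed
qed

lemma continuous_on_entry [continuous_intros]:
  "continuous_on S (\<lambda>Z::nat \<times> nat \<Rightarrow> real. Z q)"
  by (rule continuous_on_subset[OF continuous_on_product_coordinates]) simp

text \<open>By Tychonoff the cube of functions with values in [-1, 1] is compact. Each defining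
  condition is closed because it involves finitely many coordinates, and arbitrarily many closed
  conditions may be intersected.\<close>

lemma compact_density_matrices:
  assumes "finite I"
  shows "compact (density_matrices I)"
proof -
  have box: "compact (PiE UNIV (\<lambda>_. {-1..1}) :: (nat \<times> nat \<Rightarrow> real) set)"
    using compactin_PiE[of "\<lambda>_::nat \<times> nat. euclidean :: real topology" UNIV "\<lambda>_. {-1..1}"]
    by (simp add: euclidean_product_topology)
  have "density_matrices I = PiE UNIV (\<lambda>_. {-1..1}) \<inter>
     ((\<Inter>i. \<Inter>j. {Z. Z (i, j) = Z (j, i)}) \<inter> (\<Inter>i\<in>-I. \<Inter>j. {Z. Z (i, j) = 0}) \<inter>
      (\<Inter>y. {Z. 0 \<le> quad_form I (curry Z) y}) \<inter> {Z. (\<Sum>i\<in>I. Z (i, i)) = 1})"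
    (is "_ = _ \<inter> ?C")
    using density_matrices_bounded[OF assms]
    by (auto simp: density_matrices_def abs_le_iff minus_le_iff)
  moreover have "closed ?C"
    unfolding quad_form_def curry_def
    by (intro closed_Int closed_INT ballI closed_Collect_eq closed_Collect_le continuous_intros)
  ultimately show ?thesis using compact_Int_closed[OF box, of ?C] by simp
qed

lemma convex_combination_density:
  assumes "Z \<in> density_matrices I" "Z' \<in> density_matrices I" "0 \<le> t" "t \<le> (1::real)"
  shows "(\<lambda>q. (1 - t) * Z q + t * Z' q) \<in> density_matrices I"
proof -
  have "quad_form I (curry (\<lambda>q. (1 - t) * Z q + t * Z' q)) y =
      (1 - t) * quad_form I (curry Z) y + t * quad_form I (curry Z') y" for y
    unfolding quad_form_def
    by (simp add: sum_distrib_left sum.distrib algebra_simps sum_subtractf)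
  moreover have "(\<Sum>i\<in>I. (1 - t) * Z (i, i) + t * Z' (i, i)) = 1"
    using assms(1,2) unfolding density_matrices_def
    by (simp add: sum.distrib sum_distrib_left[symmetric])
  ultimately show ?thesis
    using assms unfolding density_matrices_def by auto
qed

lemma rank_one_density:
  assumes "finite I" "(\<Sum>i\<in>I. (y i)\<^sup>2) = 1"
  shows "(\<lambda>(i, j). if i \<in> I \<and> j \<in> I then y i * y j else 0) \<in> density_matrices I"
proof -
  have "quad_form I (curry (\<lambda>(i, j). if i \<in> I \<and> j \<in> I then y i * y j else 0)) z =
      (\<Sum>i\<in>I. y i * z i)\<^sup>2" for z
    unfolding quad_form_def power2_eq_square sum_product
    by (intro sum.cong) auto
  then show ?thesis
    using assms(2) by (auto simp: density_matrices_def power2_eq_square)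
qed

section \<open>Separation by a nearest point\<close>

text \<open>First-order optimality: the squared length along the segment from a to b is |a|^2 + 2 t
  s + t^2 d with s = a . (b - a). Minimality at t = 0 leaves 2 s + t d \<ge> 0 after division by t,
  and t tending to 0 gives s \<ge> 0.\<close>

lemma segment_nearest_origin:
  fixes a b :: "'a \<Rightarrow> real"
  assumes "\<And>t. 0 < t \<Longrightarrow> t \<le> 1 \<Longrightarrow> (\<Sum>i\<in>I. (a i)\<^sup>2) \<le> (\<Sum>i\<in>I. ((1 - t) * a i + t * b i)\<^sup>2)"
  shows "(\<Sum>i\<in>I. (a i)\<^sup>2) \<le> (\<Sum>i\<in>I. a i * b i)"
proof -
  define s d where "s = (\<Sum>i\<in>I. a i * (b i - a i))" and "d = (\<Sum>i\<in>I. (b i - a i)\<^sup>2)"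
  have exp: "(\<Sum>i\<in>I. ((1 - t) * a i + t * b i)\<^sup>2) = (\<Sum>i\<in>I. (a i)\<^sup>2) + 2 * t * s + t\<^sup>2 * d" for t
    unfolding s_def d_def
    by (simp add: sum_distrib_left sum.distrib[symmetric] power2_eq_square algebra_simps)
  have ge: "0 \<le> 2 * s + t * d" if "0 < t" "t \<le> 1" for t
  proof -
    have "0 \<le> t * (2 * s + t * d)" using assms[OF that] exp[of t]
      by (simp add: algebra_simps power2_eq_square)
    then show ?thesis using that by (simp add: zero_le_mult_iff)
  qed
  have "((\<lambda>t. 2 * s + t * d) \<longlongrightarrow> 2 * s + 0 * d) (at_right 0)"
    by (intro tendsto_intros)
  moreover have "eventually (\<lambda>t. 0 \<le> 2 * s + t * d) (at_right (0::real))"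
    unfolding eventually_at_right_field using ge by (intro exI[of _ 1]) auto
  ultimately have "0 \<le> 2 * s + 0 * d"
    by (rule tendsto_lowerbound) simp
  then have "0 \<le> s" by simp
  then show ?thesis unfolding s_def
    by (simp add: algebra_simps power2_eq_square sum_subtractf)
qed

lemma entry_pairing_rank_one:
  "entry_pairing I L (\<lambda>i j. if i \<in> I \<and> j \<in> I then y i * y j else 0) = quad_form I L y"
  unfolding entry_pairing_def quad_form_def by (intro sum.cong) auto

lemma entry_pairing_convex:
  "entry_pairing I L (\<lambda>i j. (1 - t) * Z i j + t * Z' i j) =
    (1 - t) * entry_pairing I L Z + t * entry_pairing I L Z'"
  unfolding entry_pairing_def by (simp add: sum_distrib_left sum.distrib algebra_simps sum_subtractf)

lemma quad_form_scale: "quad_form I X (\<lambda>i. c * y i) = c\<^sup>2 * quad_form I X y"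
  unfolding quad_form_def by (simp add: sum_distrib_left power2_eq_square mult_ac)

lemma quad_form_add_sum:
  "quad_form I (\<lambda>i j. X i j + (\<Sum>a\<in>A. c a * L a i j)) y =
    quad_form I X y + (\<Sum>a\<in>A. c a * quad_form I (L a) y)"
proof -
  have "quad_form I (\<lambda>i j. X i j + (\<Sum>a\<in>A. c a * L a i j)) y =
      quad_form I X y + (\<Sum>i\<in>I. \<Sum>j\<in>I. \<Sum>a\<in>A. c a * (L a i j * y i * y j))"
    unfolding quad_form_def
    by (simp only: distrib_right sum_distrib_right sum.distrib mult.assoc)
  also have "(\<Sum>i\<in>I. \<Sum>j\<in>I. \<Sum>a\<in>A. c a * (L a i j * y i * y j)) =
      (\<Sum>i\<in>I. \<Sum>a\<in>A. \<Sum>j\<in>I. c a * (L a i j * y i * y j))"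
    by (intro sum.cong refl) (rule sum.swap)
  also have "\<dots> = (\<Sum>a\<in>A. \<Sum>i\<in>I. \<Sum>j\<in>I. c a * (L a i j * y i * y j))"
    by (rule sum.swap)
  finally show ?thesis
    unfolding quad_form_def by (simp only: sum_distrib_left)
qed

text \<open>A crude bound by the sum of absolute entries; it tells how large a multiple of a
  definite form absorbs an arbitrary one.\<close>

lemma quad_form_bounded:
  assumes "finite I"
  shows "quad_form I X y \<le> (\<Sum>i\<in>I. \<Sum>j\<in>I. \<bar>X i j\<bar>) * (\<Sum>i\<in>I. (y i)\<^sup>2)"
proof -
  have "X i j * y i * y j \<le> \<bar>X i j\<bar> * (\<Sum>i\<in>I. (y i)\<^sup>2)" if "i \<in> I" "j \<in> I" for i j
  proof -
    have le: "\<bar>y k\<bar> \<le> sqrt (\<Sum>i\<in>I. (y i)\<^sup>2)" if "k \<in> I" for k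
      using member_le_sum[of k I "\<lambda>i. (y i)\<^sup>2"] that assms
      by (intro real_le_rsqrt) (auto simp: power2_abs)
    have "\<bar>y i\<bar> * \<bar>y j\<bar> \<le> sqrt (\<Sum>i\<in>I. (y i)\<^sup>2) * sqrt (\<Sum>i\<in>I. (y i)\<^sup>2)"
      by (intro mult_mono le that) (auto intro: sum_nonneg)
    also have "\<dots> = (\<Sum>i\<in>I. (y i)\<^sup>2)" by (intro real_sqrt_mult_self[THEN trans] abs_of_nonneg sum_nonneg zero_le_power2)
    finally have "\<bar>X i j\<bar> * (\<bar>y i\<bar> * \<bar>y j\<bar>) \<le> \<bar>X i j\<bar> * (\<Sum>i\<in>I. (y i)\<^sup>2)"
      by (intro mult_left_mono) auto
    moreover have "X i j * y i * y j \<le> \<bar>X i j\<bar> * (\<bar>y i\<bar> * \<bar>y j\<bar>)"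
      using abs_ge_self[of "X i j * y i * y j"] by (simp add: abs_mult mult.assoc)
    ultimately show ?thesis by linarith
  qed
  then show ?thesis
    unfolding quad_form_def sum_distrib_right by (intro sum_mono)
qed

text \<open>A point of the compact set of density matrices that minimises the distance of
  \<open>((entry_pairing I (L a) Z)\<^sub>a, entry_pairing I T Z)\<close> to \<open>{0} \<times> [0, \<infinity>)\<close> either lies
  in this set or is the normal of a separating hyperplane.\<close>
lemma lmi_alternative:
  fixes L :: "'a \<Rightarrow> nat \<Rightarrow> nat \<Rightarrow> real"
  assumes fin: "finite I" "finite A" and ne: "I \<noteq> {}"
  obtains
    (dual) Z where "\<And>i j. Z i j = Z j i" "\<And>y. 0 \<le> quad_form I Z y" "(\<Sum>i\<in>I. Z i i) = 1"
      "\<And>a. a \<in> A \<Longrightarrow> entry_pairing I (L a) Z = 0" "0 \<le> entry_pairing I T Z"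
  | (primal) c \<kappa> where "\<kappa> > 0"
      "\<And>y. quad_form I (\<lambda>i j. T i j + (\<Sum>a\<in>A. c a * L a i j)) y \<le> - \<kappa> * (\<Sum>i\<in>I. (y i)\<^sup>2)"
proof -
  \<comment> \<open>\<open>r Z\<close> is the displacement from the target {0} \<times> [0,
    \<infinity>): the component \<open>None\<close> is the negative part of the pairing with
    \<open>T\<close>, the others are the residuals of the equations. \<open>\<Phi>\<close> is its
    squared length.\<close>
  define r where "r Z a = (case a of None \<Rightarrow> min 0 (entry_pairing I T Z) | Some a \<Rightarrow> entry_pairing I (L a) Z)"
    for Z a
  define J where "J = insert None (Some ` A)"
  define \<Phi> where "\<Phi> Z = (\<Sum>a\<in>J. (r (curry Z) a)\<^sup>2)" for Z
  have finJ: "finite J" unfolding J_def using fin by simp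
  have sumJ: "(\<Sum>a\<in>J. g a) = g None + (\<Sum>a\<in>A. g (Some a))" for g :: "'a option \<Rightarrow> real"
    unfolding J_def using fin by (simp add: sum.reindex)
  obtain k where k: "k \<in> I" using ne by auto
  have "(\<lambda>(i, j). if i \<in> I \<and> j \<in> I then (if i = k then 1 else 0) * (if j = k then 1 else 0) else 0)
      \<in> density_matrices I"
    by (rule rank_one_density) (use fin k in \<open>simp_all add: if_distrib[of "\<lambda>x. x\<^sup>2"] cong: if_cong\<close>)
  then have "density_matrices I \<noteq> {}" by auto
  moreover have "continuous_on (density_matrices I) \<Phi>"
    unfolding \<Phi>_def sumJ r_def option.case entry_pairing_def curry_def
    by (intro continuous_intros)
  ultimately obtain Z where Z: "Z \<in> density_matrices I"
    and min: "\<And>Z'. Z' \<in> density_matrices I \<Longrightarrow> \<Phi> Z \<le> \<Phi> Z'"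
    using continuous_attains_inf[OF compact_density_matrices[OF fin(1)]] by metis
  show thesis
  proof (cases "\<Phi> Z = 0")
    case True
    then have 0: "r (curry Z) a = 0" if "a \<in> J" for a
      using that finJ unfolding \<Phi>_def by (subst (asm) sum_nonneg_eq_0_iff) auto
    show thesis
    proof (rule dual[of "curry Z"])
      show "0 \<le> entry_pairing I T (curry Z)"
        using 0[of None] unfolding r_def J_def by (auto simp: min_def split: if_splits)
      show "entry_pairing I (L a) (curry Z) = 0" if "a \<in> A" for a
        using 0[of "Some a"] that unfolding r_def J_def by auto
    qed (use Z in \<open>auto simp: density_matrices_def\<close>)
  next
    case False
    then have pos: "0 < \<Phi> Z" unfolding \<Phi>_def by (simp add: less_le sum_nonneg)
    define g where "g = r (curry Z) None"
    define f where "f a = entry_pairing I (L a) (curry Z)" for a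
    have g: "g \<le> 0" unfolding g_def r_def by auto
    have unit: "\<Phi> Z \<le> g * quad_form I T y + (\<Sum>a\<in>A. f a * quad_form I (L a) y)"
      if y: "(\<Sum>i\<in>I. (y i)\<^sup>2) = 1" for y
    proof -
      define Y where "Y = (\<lambda>(i, j). if i \<in> I \<and> j \<in> I then y i * y j else 0)"
      have Y: "Y \<in> density_matrices I" unfolding Y_def by (rule rank_one_density[OF fin(1) y])
      have cY: "curry Y = (\<lambda>i j. if i \<in> I \<and> j \<in> I then y i * y j else 0)"
        unfolding Y_def curry_def by auto
      define b where "b a = (case a of None \<Rightarrow> quad_form I T y | Some a \<Rightarrow> quad_form I (L a) y)" for a
      have "(\<Sum>a\<in>J. (r (curry Z) a)\<^sup>2) \<le> (\<Sum>a\<in>J. r (curry Z) a * b a)"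
      proof (rule segment_nearest_origin)
        fix t :: real
        assume t: "0 < t" "t \<le> 1"
        let ?C = "\<lambda>q. (1 - t) * Z q + t * Y q"
        have pair: "entry_pairing I M (curry ?C) =
            (1 - t) * entry_pairing I M (curry Z) + t * quad_form I M y" for M
        proof -
          have "curry ?C = (\<lambda>i j. (1 - t) * curry Z i j + t * curry Y i j)"
            by (intro ext) simp
          then show ?thesis by (simp only: entry_pairing_convex cY entry_pairing_rank_one)
        qed
        have "(r (curry ?C) a)\<^sup>2 \<le> ((1 - t) * r (curry Z) a + t * b a)\<^sup>2" for a
        proof (cases a)
          case None
          \<comment> \<open>Truncation at 0 is not linear. Replacing the pairing of Z by its
            negative part only lowers the mixture, and \<open>min 0\<close> is monotone, so the
            truncated mixture is in absolute value at most the mixture of \<open>r\<close> with the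
            untruncated \<open>b\<close>. An inequality is all that the segment argument
            requires.\<close>
          have "(1 - t) * entry_pairing I T (curry Z) \<ge> (1 - t) * min 0 (entry_pairing I T (curry Z))"
            using t by (intro mult_left_mono) auto
          then have "min 0 ((1 - t) * entry_pairing I T (curry Z) + t * quad_form I T y) \<ge>
              min 0 ((1 - t) * min 0 (entry_pairing I T (curry Z)) + t * quad_form I T y)"
            by (auto simp: min_def)
          then have "\<bar>min 0 ((1 - t) * entry_pairing I T (curry Z) + t * quad_form I T y)\<bar> \<le>
              \<bar>(1 - t) * min 0 (entry_pairing I T (curry Z)) + t * quad_form I T y\<bar>"
            by (auto simp: min_def split: if_splits)
          then show ?thesis
            using None by (simp only: r_def b_def pair option.case abs_le_square_iff)
        next
          case (Some a')
          then show ?thesis by (simp add: r_def b_def pair)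
        qed
        then have "\<Phi> ?C \<le> (\<Sum>a\<in>J. ((1 - t) * r (curry Z) a + t * b a)\<^sup>2)"
          unfolding \<Phi>_def by (intro sum_mono)
        then show "(\<Sum>a\<in>J. (r (curry Z) a)\<^sup>2) \<le> (\<Sum>a\<in>J. ((1 - t) * r (curry Z) a + t * b a)\<^sup>2)"
          using min[OF convex_combination_density[OF Z Y, of t]] t unfolding \<Phi>_def by simp
      qed
      then show ?thesis
        unfolding \<Phi>_def[symmetric] sumJ[of "\<lambda>a. r (curry Z) a * b a"]
        by (simp add: b_def g_def f_def r_def)
    qed
    \<comment> \<open>Both sides are homogeneous of degree two, so the bound on the unit sphere
      scales to every y.\<close>
    have all: "\<Phi> Z * (\<Sum>i\<in>I. (y i)\<^sup>2) \<le> g * quad_form I T y + (\<Sum>a\<in>A. f a * quad_form I (L a) y)"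
      (is "_ * ?s \<le> _") for y
    proof (cases "?s = 0")
      case True
      then have "y i = 0" if "i \<in> I" for i
        using that fin by (subst (asm) sum_nonneg_eq_0_iff) auto
      then have "quad_form I X y = 0" for X unfolding quad_form_def by simp
      then show ?thesis using True by simp
    next
      case False
      then have s: "?s > 0" by (simp add: less_le sum_nonneg)
      define c where "c = 1 / sqrt ?s"
      have c2: "c\<^sup>2 = 1 / ?s" unfolding c_def using s by (simp add: power_divide)
      have "(\<Sum>i\<in>I. (c * y i)\<^sup>2) = 1"
        unfolding power_mult_distrib sum_distrib_left[symmetric] c2
        using nonzero_eq_divide_eq[OF False, of 1 1] by (metis False divide_self mult_1 times_divide_eq_left)
      from unit[OF this]
      have "\<Phi> Z \<le> c\<^sup>2 * (g * quad_form I T y + (\<Sum>a\<in>A. f a * quad_form I (L a) y))"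
        by (simp add: quad_form_scale distrib_left sum_distrib_left mult_ac)
      then show ?thesis using s by (simp add: c2 field_simps)
    qed
    show thesis
    \<comment> \<open>\<open>g\<close> is the weight of \<open>T\<close> in the separating normal.
      If it is negative, division by g gives the multipliers. If it is 0, the combination of the
      \<open>L a\<close> is already definite, and the multiple (m + 1) / \<Phi> Z of it outweighs
      \<open>T\<close>, which is at most m times the squared norm, by exactly one squared
      norm.\<close>
    proof (cases "g = 0")
      case True
      define m where "m = (\<Sum>i\<in>I. \<Sum>j\<in>I. \<bar>T i j\<bar>)"
      have m: "0 \<le> m" unfolding m_def by (intro sum_nonneg) auto
      show thesis
      proof (rule primal[of 1 "\<lambda>a. - ((m + 1) / \<Phi> Z) * f a"])
        fix y :: "nat \<Rightarrow> real"
        define s where "s = (\<Sum>i\<in>I. (y i)\<^sup>2)"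
        define q where "q = (\<Sum>a\<in>A. f a * quad_form I (L a) y)"
        have 1: "quad_form I T y \<le> m * s"
          unfolding m_def s_def by (rule quad_form_bounded[OF fin(1)])
        have "\<Phi> Z * s \<le> q" using all[of y] True unfolding s_def q_def by simp
        then have "(m + 1) / \<Phi> Z * (\<Phi> Z * s) \<le> (m + 1) / \<Phi> Z * q"
          using m pos by (intro mult_left_mono) auto
        then have 2: "(m + 1) * s \<le> (m + 1) / \<Phi> Z * q" using pos by simp
        have "(\<Sum>a\<in>A. - ((m + 1) / \<Phi> Z) * f a * quad_form I (L a) y) = - ((m + 1) / \<Phi> Z * q)"
          unfolding q_def by (simp add: sum_distrib_left sum_negf mult.assoc)
        then show "quad_form I (\<lambda>i j. T i j + (\<Sum>a\<in>A. - ((m + 1) / \<Phi> Z) * f a * L a i j)) y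
            \<le> - 1 * (\<Sum>i\<in>I. (y i)\<^sup>2)"
          using 1 2 by (subst quad_form_add_sum) (simp add: s_def[symmetric] algebra_simps)
      qed simp
    next
      case False
      then have g: "g < 0" using g by simp
      show thesis
      proof (rule primal[of "\<Phi> Z / - g" "\<lambda>a. f a / g"])
        show "\<Phi> Z / - g > 0" using pos g by (intro divide_pos_pos) auto
        fix y :: "nat \<Rightarrow> real"
        define s where "s = (\<Sum>i\<in>I. (y i)\<^sup>2)"
        define q where "q = (\<Sum>a\<in>A. f a * quad_form I (L a) y)"
        have q: "(\<Sum>a\<in>A. f a / g * quad_form I (L a) y) = q / g"
          unfolding q_def by (simp add: sum_divide_distrib)
        have "\<Phi> Z * s \<le> g * quad_form I T y + q" using all[of y] unfolding s_def q_def .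
        then have "quad_form I T y + q / g \<le> - (\<Phi> Z / - g) * s"
          using divide_right_mono_neg[of "\<Phi> Z * s" "g * quad_form I T y + q" g] g
          by (simp add: add_divide_distrib)
        then show "quad_form I (\<lambda>i j. T i j + (\<Sum>a\<in>A. f a / g * L a i j)) y
            \<le> - (\<Phi> Z / - g) * (\<Sum>i\<in>I. (y i)\<^sup>2)"
          by (subst quad_form_add_sum) (simp only: q s_def[symmetric])
      qed
    qed
  qed
qed

section \<open>Schur complements of positive semidefinite forms\<close>

lemma quad_form_insert:
  assumes "finite I" "m \<notin> I"
  shows "quad_form (insert m I) X y =
    X m m * y m * y m + (\<Sum>j\<in>I. X m j * y j) * y m + (\<Sum>i\<in>I. X i m * y i) * y m + quad_form I X y"
  unfolding quad_form_def using assms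
  by (simp add: sum.distrib sum_distrib_left sum_distrib_right mult_ac)

lemma quad_form_cong:
  assumes "\<And>i. i \<in> I \<Longrightarrow> y i = z i"
  shows "quad_form I X y = quad_form I X z"
  unfolding quad_form_def using assms by (auto intro!: sum.cong)

text \<open>When the pivot X_ii is zero the form is affine in s along s e_i + e_j, and an affine
  function that stays nonnegative is constant. The value of s used at the end would make it -
  1.\<close>

lemma psd_zero_pivot:
  assumes "finite I" "i \<in> I" "j \<in> I" and sym: "X i j = X j i"
    and psd: "\<And>y. 0 \<le> quad_form I X y" and 0: "X i i = 0"
  shows "X i j = 0"
proof (cases "i = j")
  case False
  have ge: "0 \<le> 2 * s * X i j + X j j" for s
    using psd[of "\<lambda>k. if k = i then s else if k = j then 1 else 0"]
    by (simp add: quad_form_two_points[OF assms(1-3) False] 0 sym)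
  show ?thesis
    using ge[of "(- X j j - 1) / (2 * X i j)"] by (cases "X i j = 0") (auto simp: field_simps)
qed (use 0 in simp)

text \<open>The inserted coordinate is the stationary point of the form in direction m, so
  completing the square leaves the Schur complement. Nonnegativity on \<open>insert m I\<close>
  therefore passes to the complement on \<open>I\<close>.\<close>

lemma quad_form_schur_complement:
  assumes "finite I" "m \<notin> I" and sym: "\<And>i j. X i j = X j i" and "X m m \<noteq> 0"
  shows "quad_form I (\<lambda>i j. X i j - X i m * X m j / X m m) y =
    quad_form (insert m I) X (y(m := - (\<Sum>j\<in>I. X m j * y j) / X m m))"
proof -
  define a where "a = X m m"
  define s where "s = (\<Sum>j\<in>I. X m j * y j)"
  have a: "a \<noteq> 0" using assms(4) unfolding a_def .
  have s': "(\<Sum>j\<in>I. X j m * y j) = s" unfolding s_def using sym by metis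
  have ss: "(\<Sum>i\<in>I. \<Sum>j\<in>I. X i m * X m j * y i * y j) = s * s"
  proof -
    have "s * s = (\<Sum>i\<in>I. \<Sum>j\<in>I. (X i m * y i) * (X m j * y j))"
      unfolding sum_product[symmetric] s' s_def[symmetric] ..
    then show ?thesis by (simp add: mult_ac)
  qed
  have "quad_form I (\<lambda>i j. X i j - X i m * X m j / a) y =
      quad_form I X y - (\<Sum>i\<in>I. \<Sum>j\<in>I. X i m * X m j * y i * y j) / a"
    unfolding quad_form_def
    by (simp add: sum_subtractf sum_divide_distrib left_diff_distrib)
  also have "\<dots> = quad_form I X y - s * s / a" by (simp only: ss)
  also have "\<dots> = quad_form (insert m I) X (y(m := - s / a))"
  proof -
    have 1: "(\<Sum>j\<in>I. X m j * (y(m := - s / a)) j) = s"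
      unfolding s_def using assms(2) by (intro sum.cong) auto
    have 2: "(\<Sum>j\<in>I. X j m * (y(m := - s / a)) j) = s"
      unfolding s'[symmetric] using assms(2) by (intro sum.cong) auto
    have 3: "quad_form I X (y(m := - s / a)) = quad_form I X y"
      using assms(2) by (intro quad_form_cong) auto
    show ?thesis
      unfolding quad_form_insert[OF assms(1,2)] 1 2 3 a_def[symmetric]
      using a by (simp add: field_simps)
  qed
  finally show ?thesis unfolding a_def s_def .
qed

text \<open>Gaussian elimination that also copes with a singular block. A zero pivot has a zero row,
  so its unknown is arbitrary. Otherwise the Schur complement with respect to m, in which w stays as
  the border, is solved, and the unknown m is recovered by back substitution. The solution k becomes
  the feedback gain of the dual argument.\<close>

lemma psd_column_in_range:
  assumes "finite I" "w \<notin> I" and "\<And>i j. X i j = X j i"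
    and "\<And>y. 0 \<le> quad_form (insert w I) X y"
  shows "\<exists>k. \<forall>i\<in>I. (\<Sum>j\<in>I. X i j * k j) = X i w"
  using assms
proof (induction I arbitrary: X rule: finite_induct)
  case empty
  then show ?case by simp
next
  case (insert m I)
  have fin: "finite (insert w I)" using insert.hyps by simp
  have mw: "m \<notin> insert w I" using insert by auto
  have wI: "w \<notin> I" using insert by auto
  have sym: "X i j = X j i" for i j by fact
  have psd: "0 \<le> quad_form (insert m (insert w I)) X y" for y
    using insert.prems(3)[of y] by (simp add: insert_commute)
  have psd': "0 \<le> quad_form (insert w I) X y" for y
  proof -
    have z: "(\<Sum>j\<in>insert w I. f j * (y(m := 0)) j) = (\<Sum>j\<in>insert w I. f j * y j)" for f
      using mw by (intro sum.cong) auto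
    have "quad_form (insert m (insert w I)) X (y(m := 0)) = quad_form (insert w I) X (y(m := 0))"
      by (simp add: quad_form_insert[OF fin mw])
    also have "\<dots> = quad_form (insert w I) X y"
      using mw by (intro quad_form_cong) auto
    finally show ?thesis using psd by metis
  qed
  show ?case
  proof (cases "X m m = 0")
    case True
    have 0: "X m j = 0" if "j \<in> insert m (insert w I)" for j
      by (rule psd_zero_pivot[of "insert m (insert w I)"])
        (use fin that sym psd True in auto)
    obtain k where k: "\<forall>i\<in>I. (\<Sum>j\<in>I. X i j * k j) = X i w"
      using insert.IH[OF wI sym psd'] by blast
    have "(\<Sum>j\<in>insert m I. X i j * k j) = X i w" if "i \<in> insert m I" for i
    proof (cases "i = m")
      case True
      then show ?thesis using 0 by (auto intro!: sum.neutral)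
    next
      case False
      then have "X i m = 0" using 0[of i] that sym[of i m] by auto
      then show ?thesis using k that False insert.hyps by simp
    qed
    then show ?thesis by blast
  next
    case False
    define Y where "Y i j = X i j - X i m * X m j / X m m" for i j
    have "0 \<le> quad_form (insert w I) Y y" for y
      unfolding Y_def quad_form_schur_complement[of "insert w I" m X, OF fin mw sym False] by (rule psd)
    moreover have "Y i j = Y j i" for i j unfolding Y_def using sym[of i j] sym[of i m] sym[of j m] by simp
    ultimately obtain k where k: "\<forall>i\<in>I. (\<Sum>j\<in>I. Y i j * k j) = Y i w"
      using insert.IH[OF wI] by blast
    define c where "c = (X m w - (\<Sum>j\<in>I. X m j * k j)) / X m m"
    have sumk: "(\<Sum>j\<in>I. X i j * (k(m := c)) j) = (\<Sum>j\<in>I. X i j * k j)" for i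
      using insert.hyps by (intro sum.cong) auto
    have "(\<Sum>j\<in>insert m I. X i j * (k(m := c)) j) = X i w" if i: "i \<in> insert m I" for i
    proof (cases "i = m")
      case True
      have "X m m * c + (\<Sum>j\<in>I. X m j * k j) = X m w"
        unfolding c_def using False by simp
      then show ?thesis using insert.hyps True by (simp add: sumk del: fun_upd_apply) simp
    next
      case i': False
      have "(\<Sum>j\<in>I. Y i j * k j) = (\<Sum>j\<in>I. X i j * k j) - X i m * (\<Sum>j\<in>I. X m j * k j) / X m m"
        unfolding Y_def
        by (simp add: left_diff_distrib sum_subtractf sum_divide_distrib sum_distrib_left mult.assoc)
      then have "(\<Sum>j\<in>I. X i j * k j) = X i m * (\<Sum>j\<in>I. X m j * k j) / X m m + Y i w"
        using k i i' by auto
      then have "(\<Sum>j\<in>I. X i j * k j) + X i m * c = X i w"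
        unfolding c_def Y_def using False by (simp add: field_simps)
      then show ?thesis using insert.hyps
        by (simp add: sumk del: fun_upd_apply) (simp add: add.commute)
    qed
    then show ?thesis by blast
  qed
qed

section \<open>Decomposition of a skew product along a triangular basis\<close>

definition mat_app :: "nat \<Rightarrow> (nat \<Rightarrow> nat \<Rightarrow> complex) \<Rightarrow> (nat \<Rightarrow> complex) \<Rightarrow> nat \<Rightarrow> complex" where
  "mat_app n X u i = (\<Sum>j<n. X i j * u j)"

definition cinner :: "nat \<Rightarrow> (nat \<Rightarrow> complex) \<Rightarrow> (nat \<Rightarrow> complex) \<Rightarrow> complex" where
  "cinner n u v = (\<Sum>i<n. u i * cnj (v i))"

lemma mat_app_diff_scale:
  "mat_app n X (\<lambda>i. u i - a * v i) = (\<lambda>i. mat_app n X u i - a * mat_app n X v i)"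
  unfolding mat_app_def by (intro ext) (simp add: right_diff_distrib sum_subtractf sum_distrib_left mult_ac)

lemma cinner_cong:
  "(\<And>i. i < n \<Longrightarrow> u i = u' i) \<Longrightarrow> (\<And>i. i < n \<Longrightarrow> v i = v' i) \<Longrightarrow> cinner n u v = cinner n u' v'"
  unfolding cinner_def by (intro sum.cong) auto

lemma cinner_diff_scale_left:
  "cinner n (\<lambda>i. u i - a * v i) w = cinner n u w - a * cinner n v w"
  unfolding cinner_def by (simp add: left_diff_distrib sum_subtractf sum_distrib_left mult.assoc)

lemma cinner_diff_scale_right:
  "cinner n w (\<lambda>i. u i - a * v i) = cinner n w u - cnj a * cinner n w v"
  unfolding cinner_def by (simp add: right_diff_distrib sum_subtractf sum_distrib_left mult_ac)

lemma cinner_scale_left: "cinner n (\<lambda>i. a * v i) w = a * cinner n v w"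
  unfolding cinner_def by (simp add: sum_distrib_left mult_ac)

lemma cinner_scale_right: "cinner n w (\<lambda>i. a * v i) = cnj a * cinner n w v"
  unfolding cinner_def by (simp add: sum_distrib_left mult_ac)

lemma cnj_cinner: "cnj (cinner n u v) = cinner n v u"
  unfolding cinner_def by (simp add: mult.commute)

lemma cinner_self: "cinner n u u = complex_of_real (\<Sum>i<n. (cmod (u i))\<^sup>2)"
  unfolding cinner_def by (simp add: complex_norm_square[symmetric])

lemma cinner_self_eq_0: "cinner n u u = 0 \<Longrightarrow> i < n \<Longrightarrow> u i = 0"
  unfolding cinner_self of_real_eq_0_iff by (subst (asm) sum_nonneg_eq_0_iff) auto

lemma cmod_squared: "z * cnj z = complex_of_real ((cmod z)\<^sup>2)"
  by (rule complex_norm_square[symmetric])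

text \<open>Replacing p by p - t X p turns the form into - 2 t |X p|^2 + t^2 q, which is negative
  for small t > 0 unless X p = 0.\<close>

lemma psd_isotropic:
  assumes herm: "\<And>u v. cinner n (mat_app n X u) v = cinner n u (mat_app n X v)"
    and psd: "\<And>u. 0 \<le> Re (cinner n (mat_app n X u) u)"
    and 0: "Re (cinner n (mat_app n X p) p) = 0" and i: "i < n"
  shows "mat_app n X p i = 0"
proof -
  let ?x = "mat_app n X p"
  define s q where "s = Re (cinner n ?x ?x)" and "q = Re (cinner n (mat_app n X ?x) ?x)"
  have ge: "0 \<le> - 2 * t * s + t\<^sup>2 * q" for t :: real
  proof -
    let ?a = "complex_of_real t"
    have c: "cinner n (mat_app n X ?x) p = cinner n ?x ?x"
      by (simp add: herm)
    have "cinner n (mat_app n X (\<lambda>i. p i - ?a * ?x i)) (\<lambda>i. p i - ?a * ?x i) =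
        cinner n ?x p - 2 * ?a * cinner n ?x ?x + ?a\<^sup>2 * cinner n (mat_app n X ?x) ?x"
      by (simp add: mat_app_diff_scale cinner_diff_scale_left cinner_diff_scale_right c power2_eq_square algebra_simps)
    then have "Re (cinner n (mat_app n X (\<lambda>i. p i - ?a * ?x i)) (\<lambda>i. p i - ?a * ?x i)) = - 2 * t * s + t\<^sup>2 * q"
      using 0 by (simp add: s_def q_def power2_eq_square flip: of_real_mult)
    then show ?thesis using psd by metis
  qed
  have "s = 0"
  proof (rule ccontr)
    assume "s \<noteq> 0"
    moreover have "0 \<le> s" unfolding s_def cinner_self by (auto intro: sum_nonneg)
    ultimately have s: "s > 0" by simp
    have q: "0 \<le> q" unfolding q_def by (rule psd)
    \<comment> \<open>This choice keeps t q at most s, hence below 2 s; the summand 1 covers q =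
      0.\<close>
    define t where "t = s / (q + 1)"
    have "t > 0" unfolding t_def using s q by simp
    moreover have "0 \<le> t * (- 2 * s + t * q)" using ge[of t] by (simp add: power2_eq_square algebra_simps)
    ultimately have "2 * s \<le> t * q" by (simp add: zero_le_mult_iff)
    also have "t * q \<le> s" unfolding t_def using s q by (simp add: field_simps)
    finally show False using s by simp
  qed
  then have "cinner n ?x ?x = 0" unfolding s_def cinner_self by simp
  then show ?thesis using i by (rule cinner_self_eq_0)
qed

text \<open>A triangular basis \<open>p\<close> for the adjoint \<open>N'\<close> is used to split off one vector of \<open>X\<close> at a time:
  if \<open>X\<close> annihilates the first \<open>j\<close> basis vectors then \<open>X (p j)\<close> is an eigenvector of \<open>N\<close>, its
  eigenvalue is imaginary because \<open>N X\<close> is skew, and subtracting the corresponding rank-one part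
  from \<open>X\<close> preserves all hypotheses.\<close>
lemma skew_psd_form_compare:
  assumes adj: "\<And>u v. cinner n (mat_app n N' u) v = cinner n u (mat_app n N v)"
    and tri: "\<And>i j. i < n \<Longrightarrow> j < n \<Longrightarrow> mat_app n N' (p j) i = (\<Sum>l\<le>j. B l j * p l i)"
    and gen: "\<And>u. \<exists>a. \<forall>i<n. u i = (\<Sum>l<n. a l * p l i)"
    and freq: "\<And>x \<omega>. \<lbrakk>\<exists>i<n. x i \<noteq> 0; \<And>i. i < n \<Longrightarrow> mat_app n N x i = \<i> * complex_of_real \<omega> * x i\<rbrakk>
      \<Longrightarrow> cmod (cinner n c x) < cmod (cinner n k x)"
    and herm: "\<And>u v. cinner n (mat_app n X u) v = cinner n u (mat_app n X v)"
    and psd: "\<And>u. 0 \<le> Re (cinner n (mat_app n X u) u)"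
    and skew: "\<And>u i. i < n \<Longrightarrow> mat_app n N (mat_app n X u) i = - mat_app n X (mat_app n N' u) i"
  shows "Re (cinner n (mat_app n X c) c) < Re (cinner n (mat_app n X k) k) \<or>
    (\<forall>u. \<forall>i<n. mat_app n X u i = 0)"
proof -
  \<comment> \<open>Generalised over X for the induction: \<open>d\<close> bounds the number of
    basis vectors that X is not yet known to annihilate. At d = 0 all are annihilated and X is zero,
    which is the source of the second alternative.\<close>
  have "Re (cinner n (mat_app n X c) c) < Re (cinner n (mat_app n X k) k) \<or>
      (\<forall>u. \<forall>i<n. mat_app n X u i = 0)"
    if "d \<le> n" "\<And>j i. j < n - d \<Longrightarrow> i < n \<Longrightarrow> mat_app n X (p j) i = 0" for d
    using that herm psd skew
  proof (induction d arbitrary: X)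
    case 0
    have "mat_app n X u i = 0" if "i < n" for u i
    proof -
      obtain a where a: "\<forall>i<n. u i = (\<Sum>l<n. a l * p l i)" using gen by blast
      have "mat_app n X u i = (\<Sum>j<n. \<Sum>l<n. a l * (X i j * p l j))"
        unfolding mat_app_def using a by (intro sum.cong refl) (simp add: sum_distrib_left mult_ac)
      also have "\<dots> = (\<Sum>l<n. a l * mat_app n X (p l) i)"
        unfolding mat_app_def sum_distrib_left by (rule sum.swap)
      also have "\<dots> = 0" using 0(2) that by (intro sum.neutral) auto
      finally show ?thesis .
    qed
    then show ?case by blast
  next
    case (Suc d)
    define j where "j = n - Suc d"
    have j: "j < n" "n - d = Suc j" using Suc.prems(1) unfolding j_def by auto
    have zero: "mat_app n X (p l) i = 0" if "l < j" "i < n" for l i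
      using Suc.prems(2) that unfolding j_def by auto
    have herm: "cinner n (mat_app n X u) v = cinner n u (mat_app n X v)" for u v by fact
    have psd: "0 \<le> Re (cinner n (mat_app n X u) u)" for u by fact
    have skew: "mat_app n N (mat_app n X u) i = - mat_app n X (mat_app n N' u) i" if "i < n" for u i
      using Suc.prems(5) that .
    define x where "x = mat_app n X (p j)"
    define h where "h = Re (cinner n x (p j))"
    have hc: "cinner n x (p j) = complex_of_real h"
    proof -
      have "cnj (cinner n x (p j)) = cinner n x (p j)"
        unfolding x_def cnj_cinner by (rule herm[symmetric])
      then show ?thesis unfolding h_def by (simp add: complex_eq_iff)
    qed
    have hc': "cinner n (p j) x = complex_of_real h"
      using arg_cong[OF hc, of cnj] by (simp add: cnj_cinner)
    show ?case
    proof (cases "\<forall>i<n. x i = 0")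
      case True
      have "mat_app n X (p l) i = 0" if "l < n - d" "i < n" for l i
        using that zero True j unfolding x_def by (cases "l = j") auto
      then show ?thesis using Suc.IH[of X] Suc.prems by auto
    next
      case False
      have h: "h > 0"
      proof -
        have "h \<noteq> 0" using psd_isotropic[OF herm psd] False unfolding h_def x_def by blast
        then show ?thesis using psd[of "p j"] unfolding h_def x_def by simp
      qed
      define r where "r = B j j"
      \<comment> \<open>X annihilates p_l for l < j, so only the diagonal term of the triangular
        expansion of N' p_j survives.\<close>
      have XN': "mat_app n X (mat_app n N' (p j)) i = r * x i" if i: "i < n" for i
      proof -
        have "mat_app n X (mat_app n N' (p j)) i = (\<Sum>m<n. X i m * (\<Sum>l\<le>j. B l j * p l m))"
          unfolding mat_app_def[of n X] using tri j by (intro sum.cong refl) auto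
        also have "\<dots> = (\<Sum>m<n. \<Sum>l\<le>j. B l j * (X i m * p l m))"
          by (simp add: sum_distrib_left mult_ac)
        also have "\<dots> = (\<Sum>l\<le>j. B l j * mat_app n X (p l) i)"
          unfolding mat_app_def sum_distrib_left by (rule sum.swap)
        also have "\<dots> = (\<Sum>l\<in>{j}. B l j * mat_app n X (p l) i)"
          using zero i by (intro sum.mono_neutral_right) auto
        finally show ?thesis unfolding r_def x_def by simp
      qed
      have Nx: "mat_app n N x i = - r * x i" if "i < n" for i
        using skew[OF that, of "p j"] XN'[OF that] unfolding x_def by simp
      have N'x: "cinner n (mat_app n N' u) x = - cnj r * cinner n u x" for u
      proof -
        have "cinner n (mat_app n N' u) x = cinner n u (\<lambda>i. - r * x i)"
          unfolding adj using Nx by (intro cinner_cong) auto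
        then show ?thesis by (simp only: cinner_scale_right) simp
      qed
      \<comment> \<open>The number <X N' p_j, p_j> is computed twice: directly it is r h, and with X
        and then N' moved across it is - cnj r h. As h > 0, r is imaginary.\<close>
      have "r * complex_of_real h = cinner n (mat_app n X (mat_app n N' (p j))) (p j)"
        unfolding hc[symmetric] cinner_scale_left[symmetric] using XN' by (intro cinner_cong) auto
      also have "\<dots> = cinner n (mat_app n N' (p j)) x" unfolding herm x_def ..
      also have "\<dots> = - cnj r * complex_of_real h" unfolding N'x hc' ..
      finally have r: "cnj r = - r" using h by (auto simp: complex_eq_iff)
      then have r': "- r = \<i> * complex_of_real (- Im r)" by (auto simp: complex_eq_iff)
      have less: "cmod (cinner n c x) < cmod (cinner n k x)"
        using freq[of x "- Im r"] False Nx unfolding r' by auto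
      \<comment> \<open>Deflation by x x*/h with x = X p_j; dividing by h = <x, p_j> is what makes
        X' annihilate p_j.\<close>
      define X' where "X' i l = X i l - x i * cnj (x l) / h" for i l
      have X': "mat_app n X' u = (\<lambda>i. mat_app n X u i - cinner n u x / h * x i)" for u
      proof
        fix i
        have "(\<Sum>l<n. x i * cnj (x l) / h * u l) = cinner n u x / h * x i"
          unfolding cinner_def sum_divide_distrib sum_distrib_right by (intro sum.cong) auto
        then show "mat_app n X' u i = mat_app n X u i - cinner n u x / h * x i"
          unfolding X'_def mat_app_def by (simp only: left_diff_distrib sum_subtractf)
      qed
      have form: "cinner n (mat_app n X' u) u = cinner n (mat_app n X u) u - complex_of_real ((cmod (cinner n u x))\<^sup>2 / h)" for u
        unfolding X' cinner_diff_scale_left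
        using cmod_squared[of "cinner n u x"] by (simp add: cnj_cinner)
      have IH: "Re (cinner n (mat_app n X' c) c) < Re (cinner n (mat_app n X' k) k) \<or>
          (\<forall>u. \<forall>i<n. mat_app n X' u i = 0)"
      proof (rule Suc.IH)
        show "d \<le> n" using Suc.prems(1) by simp
        show "mat_app n X' (p l) i = 0" if "l < n - d" "i < n" for l i
        proof (cases "l = j")
          case True
          then show ?thesis using h hc' unfolding X' x_def by simp
        next
          case False
          then have l: "l < j" using that j by simp
          have "cinner n (p l) x = cinner n (mat_app n X (p l)) (p j)" unfolding x_def by (rule herm[symmetric])
          also have "\<dots> = 0" unfolding cinner_def using zero[OF l] by simp
          finally show ?thesis unfolding X' using zero[OF l that(2)] by simp
        qed
        show "cinner n (mat_app n X' u) v = cinner n u (mat_app n X' v)" for u v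
          unfolding X' cinner_diff_scale_left cinner_diff_scale_right herm[of u v]
          by (simp add: cnj_cinner)
        show "0 \<le> Re (cinner n (mat_app n X' u) u)" for u
        proof -
          \<comment> \<open>Completing the square: the form of X' at u is the form of X at u - a
            p_j.\<close>
          define a where "a = cinner n u x / h"
          have ux: "cinner n u x = a * h" unfolding a_def using h by simp
          have xu: "cinner n x u = cnj a * h" using arg_cong[OF ux, of cnj] by (simp add: cnj_cinner)
          have Xup: "cinner n (mat_app n X u) (p j) = a * h"
            unfolding herm using ux unfolding x_def .
          have "cinner n (mat_app n X (\<lambda>i. u i - a * p j i)) (\<lambda>i. u i - a * p j i) =
              cinner n (mat_app n X u) u - a * cnj a * h"
            unfolding mat_app_diff_scale x_def[symmetric] cinner_diff_scale_left cinner_diff_scale_right hc xu Xup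
            by (simp add: algebra_simps)
          also have "\<dots> = cinner n (mat_app n X' u) u"
            unfolding X' cinner_diff_scale_left a_def[symmetric] xu by simp
          finally show ?thesis using psd by metis
        qed
        \<comment> \<open>The rank-one correction is skew on its own: N x = - r x, the adjoint
          relation gives - cnj r, and the two agree because r is imaginary.\<close>
        show "mat_app n N (mat_app n X' u) i = - mat_app n X' (mat_app n N' u) i" if "i < n" for u i
          unfolding X' mat_app_diff_scale N'x r using skew[OF that] Nx[OF that] by simp
      qed
      then have "Re (cinner n (mat_app n X' c) c) \<le> Re (cinner n (mat_app n X' k) k)"
      proof
        assume 0: "\<forall>u. \<forall>i<n. mat_app n X' u i = 0"
        have "cinner n (mat_app n X' v) v = 0" for v unfolding cinner_def using 0 by simp
        then show ?thesis by simp
      qed simp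
      \<comment> \<open>The rank-one part contributes a strict gap because x is an eigenvector of N
        with imaginary eigenvalue; the remainder X' only has to contribute \<le>.\<close>
      moreover have "(cmod (cinner n c x))\<^sup>2 / h < (cmod (cinner n k x))\<^sup>2 / h"
        using less h by (intro divide_strict_right_mono power_strict_mono) auto
      ultimately show ?thesis unfolding form by simp
    qed
  qed
  from this[of n] show ?thesis by simp
qed

section \<open>The strict KYP lemma\<close>

text \<open>Schur's theorem in index notation: \<open>p j\<close> is the j-th column of the
  transformation and \<open>q\<close> its inverse. The order of the eigenvalues \<open>es\<close> is
  prescribed, so the leading columns can be made to span the invariant subspace of any chosen part
  of the spectrum.\<close>

lemma triangular_basis:
  fixes A :: "complex mat"
  assumes A: "A \<in> carrier_mat n n" and es: "char_poly A = (\<Prod>e\<leftarrow>es. [:- e, 1:])"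
  obtains p q B where
    "\<And>i j. i < n \<Longrightarrow> j < n \<Longrightarrow> (\<Sum>k<n. A $$ (i, k) * p j k) = (\<Sum>l\<le>j. B l j * p l i)"
    "\<And>j. j < n \<Longrightarrow> B j j = es ! j"
    "\<And>i j. j < i \<Longrightarrow> i < n \<Longrightarrow> B i j = 0"
    "\<And>l j. l < n \<Longrightarrow> j < n \<Longrightarrow> (\<Sum>i<n. q l i * p j i) = (if l = j then 1 else 0)"
    "\<And>i k. i < n \<Longrightarrow> k < n \<Longrightarrow> (\<Sum>l<n. p l i * q l k) = (if i = k then 1 else 0)"
proof -
  obtain B P Q where BPQ: "schur_decomposition A es = (B, P, Q)" by (metis prod_cases3)
  from schur_decomposition[OF A es BPQ] have sim: "similar_mat_wit A B P Q"
    and ut: "upper_triangular B" and d: "diag_mat B = es" by auto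
  note w = similar_mat_witD2[OF A sim]
  have "A * P = P * B * (Q * P)" using w by (simp add: assoc_mult_mat[of _ n n _ n _ n])
  then have AP: "A * P = P * B" using w by simp
  note [simp] = w(4-7) w(4-7)[THEN carrier_matD(1)] w(4-7)[THEN carrier_matD(2)]
  show thesis
  proof (rule that[of "\<lambda>j k. P $$ (k, j)" "\<lambda>l j. B $$ (l, j)" "\<lambda>l i. Q $$ (l, i)"])
    fix i j assume ij: "i < n" "j < n"
    have "(\<Sum>k<n. A $$ (i, k) * P $$ (k, j)) = (A * P) $$ (i, j)"
      using ij by (simp add: scalar_prod_def lessThan_atLeast0)
    also have "\<dots> = (\<Sum>l<n. B $$ (l, j) * P $$ (i, l))"
      unfolding AP using ij by (simp add: scalar_prod_def lessThan_atLeast0 mult.commute)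
    also have "\<dots> = (\<Sum>l\<le>j. B $$ (l, j) * P $$ (i, l))"
      using ij upper_triangularD[OF ut] by (intro sum.mono_neutral_right) auto
    finally show "(\<Sum>k<n. A $$ (i, k) * P $$ (k, j)) = (\<Sum>l\<le>j. B $$ (l, j) * P $$ (i, l))" .
    show "(\<Sum>k<n. Q $$ (i, k) * P $$ (k, j)) = (if i = j then 1 else 0)"
      using arg_cong[OF w(2), of "\<lambda>X. X $$ (i, j)"] ij
      by (simp add: scalar_prod_def lessThan_atLeast0)
    show "(\<Sum>l<n. P $$ (i, l) * Q $$ (l, j)) = (if i = j then 1 else 0)"
      using arg_cong[OF w(1), of "\<lambda>X. X $$ (i, j)"] ij
      by (simp add: scalar_prod_def lessThan_atLeast0)
  next
    show "B $$ (j, j) = es ! j" if "j < n" for j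
      using that unfolding d[symmetric] diag_mat_def by simp
    show "B $$ (i, j) = 0" if "j < i" "i < n" for i j
      using that upper_triangularD[OF ut] by simp
  qed
qed

lemma basis_expansion:
  fixes p q :: "nat \<Rightarrow> nat \<Rightarrow> complex"
  assumes "\<And>i k. i < n \<Longrightarrow> k < n \<Longrightarrow> (\<Sum>l<n. p l i * q l k) = (if i = k then 1 else 0)" and "i < n"
  shows "u i = (\<Sum>l<n. (\<Sum>k<n. q l k * u k) * p l i)"
proof -
  have "(\<Sum>l<n. (\<Sum>k<n. q l k * u k) * p l i) = (\<Sum>l<n. \<Sum>k<n. p l i * q l k * u k)"
    by (simp add: sum_distrib_left sum_distrib_right mult_ac)
  also have "\<dots> = (\<Sum>k<n. (\<Sum>l<n. p l i * q l k) * u k)"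
    unfolding sum_distrib_right by (rule sum.swap)
  also have "\<dots> = (\<Sum>k<n. (if i = k then u k else 0))"
    using assms by (intro sum.cong) auto
  finally show ?thesis using assms(2) by simp
qed

text \<open>For real X the products of a real with an imaginary part are purely imaginary, so
  positivity on real vectors extends to complex ones.\<close>

lemma Re_cinner_real_form:
  "Re (cinner n (mat_app n (\<lambda>i j. complex_of_real (X i j)) u) u) =
    quad_form {..<n} X (\<lambda>i. Re (u i)) + quad_form {..<n} X (\<lambda>i. Im (u i))"
proof -
  have "Re (cinner n (mat_app n (\<lambda>i j. complex_of_real (X i j)) u) u) =
      (\<Sum>i<n. \<Sum>j<n. X i j * Re (u i) * Re (u j) + X i j * Im (u i) * Im (u j))"
    unfolding cinner_def mat_app_def sum_distrib_right Re_sum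
    by (intro sum.cong refl) (simp add: algebra_simps)
  then show ?thesis unfolding quad_form_def by (simp add: sum.distrib)
qed

lemma mat_app_adjoint:
  "cinner n (mat_app n (\<lambda>i j. cnj (N j i)) u) v = cinner n u (mat_app n N v)"
proof -
  have "cinner n (mat_app n (\<lambda>i j. cnj (N j i)) u) v = (\<Sum>i<n. \<Sum>j<n. u j * (cnj (N j i) * cnj (v i)))"
    unfolding cinner_def mat_app_def by (simp add: sum_distrib_left sum_distrib_right mult_ac)
  also have "\<dots> = (\<Sum>j<n. \<Sum>i<n. u j * (cnj (N j i) * cnj (v i)))" by (rule sum.swap)
  also have "\<dots> = cinner n u (mat_app n N v)"
    unfolding cinner_def mat_app_def by (simp add: sum_distrib_left)
  finally show ?thesis .
qed

lemma mat_app_assoc: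
  "mat_app n N (mat_app n X u) i = (\<Sum>l<n. (\<Sum>j<n. N i j * X j l) * u l)"
proof -
  have "mat_app n N (mat_app n X u) i = (\<Sum>j<n. \<Sum>l<n. N i j * X j l * u l)"
    unfolding mat_app_def by (simp add: sum_distrib_left mult.assoc)
  also have "\<dots> = (\<Sum>l<n. \<Sum>j<n. N i j * X j l * u l)" by (rule sum.swap)
  finally show ?thesis by (simp add: sum_distrib_right)
qed

text \<open>Index n is the input coordinate, so Z consists of the block X over {..<n}, the border V
  and the corner z. With V = X k one has k'Xk \<le> z \<le> c'Xc, which the comparison of the two
  forms permits only for X = 0. Then z \<le> 0 and the trace cannot be 1. An eigenvector x of N = M
  + b k' solves the frequency equation with input w = k'x.\<close>

lemma dual_infeasible:
  fixes M Z :: "nat \<Rightarrow> nat \<Rightarrow> real" and b c :: "nat \<Rightarrow> real"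
  assumes freq: "\<And>(x :: nat \<Rightarrow> complex) w \<omega>. \<lbrakk>(\<exists>i<n. x i \<noteq> 0) \<or> w \<noteq> 0;
      \<And>i. i < n \<Longrightarrow> \<i> * complex_of_real \<omega> * x i = (\<Sum>j<n. complex_of_real (M i j) * x j) + complex_of_real (b i) * w\<rbrakk>
      \<Longrightarrow> cmod (\<Sum>i<n. complex_of_real (c i) * x i) < cmod w"
    and sym: "\<And>i j. Z i j = Z j i"
    and psd: "\<And>y. 0 \<le> quad_form {..n} Z y" and tr: "(\<Sum>i\<le>n. Z i i) = 1"
    and lyap: "\<And>a d. a < n \<Longrightarrow> d < n \<Longrightarrow>
      (\<Sum>j<n. M d j * Z a j) + b d * Z a n + ((\<Sum>j<n. M a j * Z d j) + b a * Z d n) = 0"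
    and T: "Z n n \<le> quad_form {..<n} Z c"
  shows False
proof -
  have ins: "{..n} = insert n {..<n}" by auto
  have n: "n \<notin> {..<n}" "finite {..<n}" by auto
  obtain k where k: "\<And>i. i < n \<Longrightarrow> (\<Sum>j<n. Z i j * k j) = Z i n"
    using psd_column_in_range[of "{..<n}" n Z, OF n(2,1) sym] psd unfolding ins by auto
  have psd': "0 \<le> quad_form {..<n} Z y" for y
  proof -
    have "quad_form {..n} Z (y(n := 0)) = quad_form {..<n} Z (y(n := 0))"
      unfolding ins by (simp add: quad_form_insert[OF n(2,1)])
    also have "\<dots> = quad_form {..<n} Z y" by (intro quad_form_cong) auto
    finally show ?thesis using psd by metis
  qed
  have kk: "quad_form {..<n} Z k \<le> Z n n"
  proof -
    \<comment> \<open>Testing Z at (- k, 1) gives z - k'Xk \<ge> 0.\<close>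
    define y where "y = (\<lambda>i. if i = n then 1 else - k i)"
    have 1: "(\<Sum>i<n. Z i n * y i) = - quad_form {..<n} Z k"
    proof -
      have "(\<Sum>i<n. Z i n * y i) = - (\<Sum>i<n. Z i n * k i)"
        unfolding y_def by (simp add: sum_negf)
      also have "(\<Sum>i<n. Z i n * k i) = (\<Sum>i<n. (\<Sum>j<n. Z i j * k j) * k i)"
        using k by (intro sum.cong) auto
      also have "\<dots> = quad_form {..<n} Z k"
        unfolding quad_form_def sum_distrib_right by (intro sum.cong refl) (simp only: mult_ac)
      finally show ?thesis .
    qed
    have 2: "(\<Sum>i<n. Z n i * y i) = - quad_form {..<n} Z k" by (simp only: sym[of n] 1)
    have 3: "quad_form {..<n} Z y = quad_form {..<n} Z (\<lambda>i. - 1 * k i)"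
      unfolding y_def by (intro quad_form_cong) auto
    have "0 \<le> Z n n * y n * y n - quad_form {..<n} Z k * y n - quad_form {..<n} Z k * y n + quad_form {..<n} Z y"
      using psd[of y] unfolding ins quad_form_insert[OF n(2,1)] 1 2 by simp
    then show ?thesis unfolding 3 quad_form_scale by (simp add: y_def)
  qed
  define N where "N i j = M i j + b i * k j" for i j
  have NZ: "(\<Sum>j<n. N d j * Z j a) = - (\<Sum>j<n. Z d j * N a j)" if "a < n" "d < n" for a d
  proof -
    have "(\<Sum>j<n. N d j * Z a j) = (\<Sum>j<n. M d j * Z a j) + b d * Z a n" if "a < n" for a d
      unfolding k[OF that, symmetric] N_def
      by (simp add: distrib_right sum.distrib sum_distrib_left mult.assoc mult.commute[of "Z a _"])
    then have "(\<Sum>j<n. N d j * Z a j) + (\<Sum>j<n. N a j * Z d j) = 0"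
      using lyap[OF that] that by simp
    then show ?thesis using sym by (simp add: mult.commute add_eq_0_iff)
  qed
  define cX where "cX i j = complex_of_real (Z i j)" for i j
  define cN where "cN i j = complex_of_real (N i j)" for i j
  define cN' where "cN' i j = cnj (cN j i)" for i j
  define cc where "cc i = complex_of_real (c i)" for i
  define ck where "ck i = complex_of_real (k i)" for i
  let ?A = "mat n n (\<lambda>(i, j). cN' i j)"
  obtain es where es: "char_poly ?A = (\<Prod>e\<leftarrow>es. [:- e, 1:])"
    using char_poly_factorized[of ?A n] by auto
  obtain p q B where pqB:
    "\<And>i j. i < n \<Longrightarrow> j < n \<Longrightarrow> (\<Sum>k<n. ?A $$ (i, k) * p j k) = (\<Sum>l\<le>j. B l j * p l i)"
    "\<And>j. j < n \<Longrightarrow> B j j = es ! j"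
    "\<And>i j. j < i \<Longrightarrow> i < n \<Longrightarrow> B i j = 0"
    "\<And>l j. l < n \<Longrightarrow> j < n \<Longrightarrow> (\<Sum>i<n. q l i * p j i) = (if l = j then 1 else 0)"
    "\<And>i k. i < n \<Longrightarrow> k < n \<Longrightarrow> (\<Sum>l<n. p l i * q l k) = (if i = k then 1 else 0)"
    by (rule triangular_basis[OF mat_carrier es]) (rule that)
  have "Re (cinner n (mat_app n cX cc) cc) < Re (cinner n (mat_app n cX ck) ck) \<or>
      (\<forall>u. \<forall>i<n. mat_app n cX u i = 0)"
  proof (rule skew_psd_form_compare)
    show "cinner n (mat_app n cN' u) v = cinner n u (mat_app n cN v)" for u v
      unfolding cN'_def by (rule mat_app_adjoint)
    show "mat_app n cN' (p j) i = (\<Sum>l\<le>j. B l j * p l i)" if "i < n" "j < n" for i j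
      using pqB(1)[OF that] that unfolding mat_app_def by simp
    show "\<exists>a. \<forall>i<n. u i = (\<Sum>l<n. a l * p l i)" for u
      by (intro exI[of _ "\<lambda>l. \<Sum>k<n. q l k * u k"] allI impI basis_expansion pqB(5))
    show "cinner n (mat_app n cX u) v = cinner n u (mat_app n cX v)" for u v
      using mat_app_adjoint[of n cX u v] sym unfolding cX_def by simp
    show "0 \<le> Re (cinner n (mat_app n cX u) u)" for u
      unfolding cX_def Re_cinner_real_form using psd' by (simp add: add_nonneg_nonneg)
    show "mat_app n cN (mat_app n cX u) i = - mat_app n cX (mat_app n cN' u) i" if i: "i < n" for u i
    proof -
      have "(\<Sum>j<n. cN i j * cX j l) = - (\<Sum>j<n. cX i j * cN' j l)" if "l < n" for l
        using NZ[OF that i] unfolding cN_def cX_def cN'_def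
        by (simp flip: of_real_mult of_real_sum of_real_minus)
      then show ?thesis unfolding mat_app_assoc by (simp add: sum_negf)
    qed
    fix x :: "nat \<Rightarrow> complex" and \<omega>
    assume nz: "\<exists>i<n. x i \<noteq> 0" and ev: "\<And>i. i < n \<Longrightarrow> mat_app n cN x i = \<i> * complex_of_real \<omega> * x i"
    have "cmod (\<Sum>i<n. complex_of_real (c i) * x i) < cmod (\<Sum>j<n. complex_of_real (k j) * x j)"
    proof (rule freq)
      show "(\<exists>i<n. x i \<noteq> 0) \<or> (\<Sum>j<n. complex_of_real (k j) * x j) \<noteq> 0" using nz by blast
      show "\<i> * complex_of_real \<omega> * x i = (\<Sum>j<n. complex_of_real (M i j) * x j) +
          complex_of_real (b i) * (\<Sum>j<n. complex_of_real (k j) * x j)" if "i < n" for i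
        unfolding ev[OF that, symmetric] mat_app_def cN_def N_def
        by (simp add: distrib_right sum.distrib sum_distrib_left mult.assoc)
    qed
    moreover have "cmod (cinner n (\<lambda>i. complex_of_real (e i)) x) = cmod (\<Sum>i<n. complex_of_real (e i) * x i)" for e
    proof -
      have "cinner n (\<lambda>i. complex_of_real (e i)) x = cnj (\<Sum>i<n. complex_of_real (e i) * x i)"
        unfolding cinner_def by simp
      then show ?thesis by (simp only: complex_mod_cnj)
    qed
    ultimately show "cmod (cinner n cc x) < cmod (cinner n ck x)"
      unfolding cc_def ck_def by simp
  qed
  moreover have "Re (cinner n (mat_app n cX (\<lambda>i. complex_of_real (e i))) (\<lambda>i. complex_of_real (e i))) = quad_form {..<n} Z e" for e
    unfolding cX_def Re_cinner_real_form by (simp add: quad_form_def)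
  ultimately have "\<forall>u. \<forall>i<n. mat_app n cX u i = 0"
    using kk T unfolding cc_def ck_def by auto
  then have *: "mat_app n cX (\<lambda>l. if l = j then 1 else 0) i = 0" if "i < n" for i j using that by blast
  have Z0: "Z i j = 0" if "i < n" "j < n" for i j
  proof -
    have "(\<Sum>l<n. cX i l * (if l = j then 1 else 0)) = (\<Sum>l<n. if l = j then cX i l else 0)"
      by (intro sum.cong) auto
    then show ?thesis using * that unfolding mat_app_def by (simp add: cX_def)
  qed
  then have "Z n n \<le> 0" using T unfolding quad_form_def by simp
  then show False using tr Z0 unfolding ins by simp
qed

text \<open>The frequency hypothesis ranges over solutions of the state equation and not over values
  of a transfer function. Its instances with w = 0 already exclude imaginary eigenvalues of M, so
  the argument never inverts i \<omega> - M.\<close>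

theorem strict_kyp:
  fixes M :: "nat \<Rightarrow> nat \<Rightarrow> real" and b c :: "nat \<Rightarrow> real"
  assumes freq: "\<And>(x :: nat \<Rightarrow> complex) w \<omega>. \<lbrakk>(\<exists>i<n. x i \<noteq> 0) \<or> w \<noteq> 0;
      \<And>i. i < n \<Longrightarrow> \<i> * complex_of_real \<omega> * x i = (\<Sum>j<n. complex_of_real (M i j) * x j) + complex_of_real (b i) * w\<rbrakk>
      \<Longrightarrow> cmod (\<Sum>i<n. complex_of_real (c i) * x i) < cmod w"
  obtains P :: "nat \<Rightarrow> nat \<Rightarrow> real" and \<kappa> where "\<kappa> > 0" "\<And>i j. P i j = P j i"
    "\<And>x w. 2 * (\<Sum>i<n. \<Sum>j<n. P i j * x i * ((\<Sum>l<n. M j l * x l) + b j * w)) + (\<Sum>i<n. c i * x i)\<^sup>2 - w\<^sup>2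
      \<le> - \<kappa> * ((\<Sum>i<n. (x i)\<^sup>2) + w\<^sup>2)"
proof -
  have ins: "{..n} = insert n {..<n}" by auto
  have n: "n \<notin> {..<n}" "finite {..<n}" by auto
  have ins2: "(\<Sum>i\<le>n. f i) = f n + (\<Sum>i<n. f i)" for f :: "nat \<Rightarrow> real"
    unfolding ins by simp
  \<comment> \<open>\<open>F\<close> is the row-wise matrix [M b]. \<open>L (a, d)\<close> is the
    coefficient of the (a, d) entry of P: at y = (x, w) its form is x_a v_d + x_d v_a with v = M x +
    b w. \<open>T\<close> is the form (c'x)^2 - w^2.\<close>
  define F where "F a j = (if j < n then M a j else b a)" for a j
  define L where "L q i j = (if i = fst q then F (snd q) j else 0) + (if i = snd q then F (fst q) j else 0)"
    for q :: "nat \<times> nat" and i j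
  define T where "T i j = (if i < n \<and> j < n then c i * c j else if i = n \<and> j = n then - 1 else 0)" for i j
  have sumF: "(\<Sum>j\<le>n. F a j * y j) = (\<Sum>j<n. M a j * y j) + b a * y n" for a y
    unfolding ins2 F_def by simp
  have sumL: "(\<Sum>i\<le>n. \<Sum>j\<le>n. L (a, d) i j * Y i j) =
      (\<Sum>j\<le>n. F d j * Y a j) + (\<Sum>j\<le>n. F a j * Y d j)" if "a < n" "d < n" for a d Y
  proof -
    have "(\<Sum>i\<le>n. \<Sum>j\<le>n. L (a, d) i j * Y i j) =
        (\<Sum>i\<le>n. (if i = a then (\<Sum>j\<le>n. F d j * Y a j) else 0) + (if i = d then (\<Sum>j\<le>n. F a j * Y d j) else 0))"
      unfolding L_def by (intro sum.cong refl) (auto simp: distrib_right sum.distrib)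
    then show ?thesis using that by (simp add: sum.distrib)
  qed
  show thesis
  proof (rule lmi_alternative[of "{..n}" "{..<n} \<times> {..<n}" L T])
    show "finite {..n}" "finite ({..<n} \<times> {..<n})" "{..n} \<noteq> {}" by auto
  next
    fix Z
    assume Z: "\<And>i j. Z i j = Z j i" "\<And>y. 0 \<le> quad_form {..n} Z y" "(\<Sum>i\<le>n. Z i i) = 1"
      "\<And>a. a \<in> {..<n} \<times> {..<n} \<Longrightarrow> entry_pairing {..n} (L a) Z = 0" "0 \<le> entry_pairing {..n} T Z"
    have False
    proof (rule dual_infeasible[where M = M and b = b and c = c and Z = Z and n = n])
      show "(\<Sum>j<n. M d j * Z a j) + b d * Z a n + ((\<Sum>j<n. M a j * Z d j) + b a * Z d n) = 0"
        if "a < n" "d < n" for a d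
        using Z(4)[of "(a, d)"] that unfolding entry_pairing_def sumL[OF that] sumF by simp
      have "entry_pairing {..n} T Z = - Z n n + quad_form {..<n} Z c"
        unfolding entry_pairing_def quad_form_def ins2 T_def by (simp add: mult_ac)
      then show "Z n n \<le> quad_form {..<n} Z c" using Z(5) by simp
    qed (fact freq Z(1) Z(2) Z(3))+
    then show thesis ..
  next
    fix e \<kappa>
    assume \<kappa>: "0 < (\<kappa>::real)" and e: "\<And>y. quad_form {..n} (\<lambda>i j. T i j + (\<Sum>a\<in>{..<n} \<times> {..<n}. e a * L a i j)) y
      \<le> - \<kappa> * (\<Sum>i\<le>n. (y i)\<^sup>2)"
    \<comment> \<open>There is a multiplier for every ordered pair, and only their symmetric part
      enters; the factor 1/2 matches the 2 in front of the Lyapunov term.\<close>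
    define P where "P i j = (e (i, j) + e (j, i)) / 2" for i j
    show thesis
    proof (rule that[OF \<kappa>])
      show "P i j = P j i" for i j unfolding P_def by simp
      fix x :: "nat \<Rightarrow> real" and w :: real
      define y where "y i = (if i = n then w else x i)" for i
      define v where "v a = (\<Sum>l<n. M a l * x l) + b a * w" for a
      have Fv: "(\<Sum>j\<le>n. F a j * y j) = v a" for a
      proof -
        have "(\<Sum>j<n. M a j * y j) = (\<Sum>j<n. M a j * x j)" unfolding y_def by (intro sum.cong) auto
        then show ?thesis unfolding sumF v_def by (simp add: y_def)
      qed
      have qL: "quad_form {..n} (L (a, d)) y = x a * v d + x d * v a" if "a < n" "d < n" for a d
      proof -
        have "quad_form {..n} (L (a, d)) y = (\<Sum>j\<le>n. F d j * (y a * y j)) + (\<Sum>j\<le>n. F a j * (y d * y j))"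
          unfolding quad_form_def sumL[OF that, of "\<lambda>i j. y i * y j", symmetric] by (simp only: mult.assoc)
        also have "\<dots> = y a * (\<Sum>j\<le>n. F d j * y j) + y d * (\<Sum>j\<le>n. F a j * y j)"
          unfolding sum_distrib_left by (simp only: mult.left_commute)
        finally show ?thesis using that unfolding Fv by (simp add: y_def)
      qed
      have qT: "quad_form {..n} T y = (\<Sum>i<n. c i * x i)\<^sup>2 - w\<^sup>2"
        unfolding quad_form_def ins2 T_def y_def power2_eq_square sum_product
        by (simp add: mult_ac)
      have "(\<Sum>a\<in>{..<n} \<times> {..<n}. e a * quad_form {..n} (L a) y) =
          (\<Sum>i<n. \<Sum>j<n. e (i, j) * (x i * v j + x j * v i))"
        unfolding sum.cartesian_product by (intro sum.cong refl) (auto simp: qL)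
      also have "\<dots> = (\<Sum>i<n. \<Sum>j<n. e (i, j) * x i * v j) + (\<Sum>i<n. \<Sum>j<n. e (i, j) * x j * v i)"
        by (simp add: distrib_left sum.distrib mult.assoc)
      also have "(\<Sum>i<n. \<Sum>j<n. e (i, j) * x j * v i) = (\<Sum>i<n. \<Sum>j<n. e (j, i) * x i * v j)"
        by (rule sum.swap)
      also have "(\<Sum>i<n. \<Sum>j<n. e (i, j) * x i * v j) + (\<Sum>i<n. \<Sum>j<n. e (j, i) * x i * v j) =
          2 * (\<Sum>i<n. \<Sum>j<n. P i j * x i * v j)"
        unfolding P_def sum_distrib_left sum.distrib[symmetric]
        by (intro sum.cong refl) (simp add: algebra_simps)
      finally have q: "quad_form {..n} (\<lambda>i j. T i j + (\<Sum>a\<in>{..<n} \<times> {..<n}. e a * L a i j)) y =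
          (\<Sum>i<n. c i * x i)\<^sup>2 - w\<^sup>2 + 2 * (\<Sum>i<n. \<Sum>j<n. P i j * x i * v j)"
        by (subst quad_form_add_sum) (simp only: qT)
      have "(\<Sum>i\<le>n. (y i)\<^sup>2) = (\<Sum>i<n. (x i)\<^sup>2) + w\<^sup>2"
        unfolding ins2 y_def by simp
      then have "2 * (\<Sum>i<n. \<Sum>j<n. P i j * x i * v j) + (\<Sum>i<n. c i * x i)\<^sup>2 - w\<^sup>2
          \<le> - \<kappa> * ((\<Sum>i<n. (x i)\<^sup>2) + w\<^sup>2)"
        using e[of y] unfolding q by simp
      then show "2 * (\<Sum>i<n. \<Sum>j<n. P i j * x i * ((\<Sum>l<n. M j l * x l) + b j * w)) + (\<Sum>i<n. c i * x i)\<^sup>2 - w\<^sup>2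
          \<le> - \<kappa> * ((\<Sum>i<n. (x i)\<^sup>2) + w\<^sup>2)"
        unfolding v_def .
    qed
  qed
qed

section \<open>Lyapunov inequalities and inertia\<close>

text \<open>Conjugates the first argument, as in y* H z, whereas \<open>cinner\<close> conjugates
  the second. The index set is arbitrary because the induction on triangular matrices removes the
  least index at each step.\<close>

definition hform :: "nat set \<Rightarrow> (nat \<Rightarrow> nat \<Rightarrow> complex) \<Rightarrow> (nat \<Rightarrow> complex) \<Rightarrow> (nat \<Rightarrow> complex) \<Rightarrow> complex" where
  "hform I H y z = (\<Sum>i\<in>I. \<Sum>k\<in>I. cnj (y i) * H i k * z k)"

lemma hform_cong:
  "(\<And>i. i \<in> I \<Longrightarrow> y i = y' i) \<Longrightarrow> (\<And>i. i \<in> I \<Longrightarrow> z i = z' i) \<Longrightarrow> hform I H y z = hform I H y' z'"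
  unfolding hform_def by (auto intro!: sum.cong)

lemma hform_columns:
  "hform I H y z = (\<Sum>k\<in>I. (\<Sum>i\<in>I. cnj (y i) * H i k) * z k)"
  unfolding hform_def sum_distrib_right by (rule sum.swap)

lemma hform_zero: "(\<And>i. i \<in> I \<Longrightarrow> y i = 0) \<Longrightarrow> hform I H y z = 0"
  unfolding hform_def by simp

text \<open>With this coordinate the row vector y* H vanishes at m, so the value of z at m drops
  out. The complement can thus be tested with a z computed on the larger index set.\<close>

lemma hform_insert_schur:
  assumes "finite I" "m \<notin> I" and h: "H m m = complex_of_real h" "h \<noteq> 0"
    and herm: "\<And>i j. H i j = cnj (H j i)"
  shows "hform (insert m I) H (y(m := - (\<Sum>j\<in>I. H m j * y j) / h)) z =
    hform I (\<lambda>i j. H i j - H i m * H m j / h) y z"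
proof -
  define s where "s = (\<Sum>j\<in>I. H m j * y j)"
  let ?y = "y(m := - s / h)"
  have cs: "cnj s = (\<Sum>i\<in>I. cnj (y i) * H i m)"
    unfolding s_def cnj_sum complex_cnj_mult herm[of _ m, symmetric] by (simp only: mult.commute)
  have y: "(\<Sum>i\<in>I. cnj (?y i) * H i k) = (\<Sum>i\<in>I. cnj (y i) * H i k)" for k
    using assms(2) by (intro sum.cong) auto
  have m: "(\<Sum>i\<in>insert m I. cnj (?y i) * H i m) = 0"
    unfolding sum.insert[OF assms(1,2)] y cs[symmetric] using h by simp
  have k: "(\<Sum>i\<in>insert m I. cnj (?y i) * H i k) = (\<Sum>i\<in>I. cnj (y i) * (H i k - H i m * H m k / h))" for k
  proof -
    have "(\<Sum>i\<in>I. cnj (y i) * (H i k - H i m * H m k / h)) = (\<Sum>i\<in>I. cnj (y i) * H i k) - cnj s * H m k / h"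
      unfolding cs by (simp add: right_diff_distrib sum_subtractf sum_distrib_right sum_divide_distrib mult.assoc)
    then show ?thesis
      unfolding sum.insert[OF assms(1,2)] y by simp
  qed
  show ?thesis
    unfolding hform_columns s_def[symmetric] k sum.insert[OF assms(1,2)]
    by (simp only: k[of m, symmetric] m mult_zero_left add_0)
qed

text \<open>Since m is the least index, e_m is an eigenvector of B; the inequality at e_m reads h Re
  B_mm < 0 and yields the pivot h > 0. The rows of B over \<open>I\<close> ignore coordinate m, so
  the Schur complement of H inherits the inequality, and completing the square carries its
  positivity back to H.\<close>

lemma triangular_lyapunov:
  assumes "finite I" and herm: "\<And>i j. H i j = cnj (H j i)"
    and tri: "\<And>i j. i \<in> I \<Longrightarrow> j \<in> I \<Longrightarrow> j < i \<Longrightarrow> B i j = 0"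
    and diag: "\<And>j. j \<in> I \<Longrightarrow> Re (B j j) < 0"
    and lyap: "\<And>y. \<exists>i\<in>I. y i \<noteq> 0 \<Longrightarrow> Re (hform I H y (\<lambda>k. \<Sum>j\<in>I. B k j * y j)) < 0"
    and y: "\<exists>i\<in>I. y i \<noteq> 0"
  shows "0 < Re (hform I H y y)"
  using assms
proof (induction I arbitrary: H y rule: finite_linorder_min_induct)
  case empty
  from empty.prems(5) show ?case by simp
next
  case (insert m I)
  have mI: "m \<notin> I" using insert.hyps(2) by auto
  note fin = insert.hyps(1)
  have herm: "H i j = cnj (H j i)" for i j by fact
  have Bm: "B k m = 0" if "k \<in> I" for k using insert.prems(2)[of k m] insert.hyps(2) that by auto
  define h where "h = Re (H m m)"
  have h: "H m m = complex_of_real h" 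
    using arg_cong[OF herm[of m m], of Im] unfolding h_def by (simp add: complex_eq_iff)
  have hpos: "h > 0"
  proof -
    let ?e = "\<lambda>i. if i = m then 1 else (0::complex)"
    have "(\<Sum>j\<in>insert m I. B k j * ?e j) = B k m" for k
    proof -
      have "(\<Sum>j\<in>insert m I. B k j * ?e j) = (\<Sum>j\<in>insert m I. if j = m then B k j else 0)"
        by (intro sum.cong) auto
      then show ?thesis using fin by simp
    qed
    then have "hform (insert m I) H ?e (\<lambda>k. \<Sum>j\<in>insert m I. B k j * ?e j) = hform (insert m I) H ?e (\<lambda>k. B k m)"
      by simp
    also have "\<dots> = H m m * B m m"
    proof -
      have *: "(\<Sum>i\<in>insert m I. cnj (?e i) * H i k) = H m k" for k
      proof -
        have "(\<Sum>i\<in>insert m I. cnj (?e i) * H i k) = (\<Sum>i\<in>insert m I. if i = m then H i k else 0)"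
          by (intro sum.cong) auto
        then show ?thesis using fin by simp
      qed
      show ?thesis unfolding hform_columns * using fin mI Bm by simp
    qed
    finally have e: "hform (insert m I) H ?e (\<lambda>k. \<Sum>j\<in>insert m I. B k j * ?e j) = H m m * B m m" .
    have "\<exists>i\<in>insert m I. ?e i \<noteq> 0" by simp
    from insert.prems(4)[OF this] have "Re (H m m * B m m) < 0" unfolding e .
    then have "h * Re (B m m) < 0" unfolding h by simp
    then show ?thesis using insert.prems(3)[of m] by (auto simp: mult_less_0_iff)
  qed
  define H' where "H' i j = H i j - H i m * H m j / h" for i j
  have herm': "H' i j = cnj (H' j i)" for i j
    unfolding H'_def complex_cnj_diff complex_cnj_divide complex_cnj_mult herm[symmetric] by simp
  have IH: "0 < Re (hform I H' y y)" if "\<exists>i\<in>I. y i \<noteq> 0" for y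
  proof (rule insert.IH[OF herm'])
    show "\<exists>i\<in>I. y i \<noteq> 0" by fact
    show "B i j = 0" if "i \<in> I" "j \<in> I" "j < i" for i j using that insert.prems(2) by auto
    show "Re (B j j) < 0" if "j \<in> I" for j using that insert.prems(3) by auto
    fix y :: "nat \<Rightarrow> complex"
    assume nz: "\<exists>i\<in>I. y i \<noteq> 0"
    let ?y = "y(m := - (\<Sum>j\<in>I. H m j * y j) / h)"
    have "(\<Sum>j\<in>insert m I. B k j * ?y j) = (\<Sum>j\<in>I. B k j * y j)" if "k \<in> I" for k
    proof -
      have "(\<Sum>j\<in>I. B k j * ?y j) = (\<Sum>j\<in>I. B k j * y j)" using mI by (intro sum.cong) auto
      then show ?thesis using fin mI Bm[OF that] by simp
    qed
    then have "hform I H' y (\<lambda>k. \<Sum>j\<in>I. B k j * y j) = hform I H' y (\<lambda>k. \<Sum>j\<in>insert m I. B k j * ?y j)"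
      by (intro hform_cong) auto
    also have "\<dots> = hform (insert m I) H ?y (\<lambda>k. \<Sum>j\<in>insert m I. B k j * ?y j)"
      unfolding H'_def using hpos by (intro hform_insert_schur[symmetric] fin mI h herm) simp
    finally have *: "hform I H' y (\<lambda>k. \<Sum>j\<in>I. B k j * y j) =
      hform (insert m I) H ?y (\<lambda>k. \<Sum>j\<in>insert m I. B k j * ?y j)" .
    show "Re (hform I H' y (\<lambda>k. \<Sum>j\<in>I. B k j * y j)) < 0"
    proof -
      obtain i where "i \<in> I" "y i \<noteq> 0" using nz by blast
      then have "\<exists>i\<in>insert m I. ?y i \<noteq> 0" using mI by (intro bexI[of _ i]) auto
      from insert.prems(4)[OF this] show ?thesis
        by (simp only: *)
    qed
  qed
  define s where "s = (\<Sum>j\<in>I. H m j * y j)"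
  have cs: "cnj s = (\<Sum>i\<in>I. cnj (y i) * H i m)"
    unfolding s_def cnj_sum complex_cnj_mult herm[of _ m, symmetric] by (simp only: mult.commute)
  have "hform I H' y y = hform I H y y - cnj s * s / h"
  proof -
    have "cnj s * s / h = (\<Sum>i\<in>I. \<Sum>k\<in>I. cnj (y i) * (H i m * H m k / h) * y k)"
    proof -
      have "cnj s * s / h = (\<Sum>i\<in>I. cnj (y i) * H i m) * (\<Sum>k\<in>I. H m k * y k) / h"
        unfolding cs[symmetric] s_def[symmetric] ..
      then show ?thesis
        unfolding sum_product sum_divide_distrib by (simp add: mult.assoc)
    qed
    then show ?thesis unfolding hform_def H'_def
      by (simp only: right_diff_distrib left_diff_distrib sum_subtractf)
  qed
  then have Hy: "hform I H y y = hform I H' y y + cnj s * s / h" by simp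
  have "(\<Sum>k\<in>I. cnj (y m) * H m k * y k) = cnj (y m) * s"
    unfolding s_def sum_distrib_left by (simp only: mult.assoc)
  moreover have "(\<Sum>i\<in>I. cnj (y i) * H i m * y m) = cnj s * y m"
    unfolding cs sum_distrib_right ..
  ultimately have "hform (insert m I) H y y = cnj (y m) * h * y m + cnj (y m) * s + cnj s * y m + hform I H y y"
    unfolding hform_def sum.insert[OF fin mI] by (simp only: sum.distrib h add.assoc)
  moreover have "complex_of_real h \<noteq> 0" using hpos by simp
  ultimately have eq: "hform (insert m I) H y y = h * ((y m + s / h) * cnj (y m + s / h)) + hform I H' y y"
    unfolding Hy by (simp add: field_simps)
  then have Re: "Re (hform (insert m I) H y y) = h * (cmod (y m + s / h))\<^sup>2 + Re (hform I H' y y)"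
    unfolding cmod_squared by (simp flip: of_real_mult)
  show ?case
  proof (cases "\<exists>i\<in>I. y i \<noteq> 0")
    case True
    then show ?thesis unfolding Re using IH[OF True] hpos by (simp add: add_nonneg_pos)
  next
    case False
    then have "s = 0" "hform I H' y y = 0" "y m \<noteq> 0"
      using insert.prems(5) unfolding s_def by (auto intro: hform_zero)
    then show ?thesis unfolding Re using hpos by simp
  qed
qed

text \<open>The Gram matrix of the family u represents the form on its span; the swaps only reorder
  the four sums.\<close>

lemma hform_combination:
  "hform {..<n} P (\<lambda>i. \<Sum>j\<in>J. y j * u j i) (\<lambda>i. \<Sum>j\<in>J. z j * u j i) =
    hform J (\<lambda>i j. hform {..<n} P (u i) (u j)) y z"
proof -
  have "hform J (\<lambda>i j. hform {..<n} P (u i) (u j)) y z =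
      (\<Sum>i\<in>J. \<Sum>j\<in>J. \<Sum>k<n. \<Sum>l<n. cnj (y i) * cnj (u i k) * P k l * (z j * u j l))"
    unfolding hform_def sum_distrib_left sum_distrib_right
    by (intro sum.cong refl) (simp only: mult_ac)
  also have "\<dots> = (\<Sum>i\<in>J. \<Sum>k<n. \<Sum>j\<in>J. \<Sum>l<n. cnj (y i) * cnj (u i k) * P k l * (z j * u j l))"
    by (rule sum.cong[OF refl], rule sum.swap)
  also have "\<dots> = (\<Sum>k<n. \<Sum>i\<in>J. \<Sum>j\<in>J. \<Sum>l<n. cnj (y i) * cnj (u i k) * P k l * (z j * u j l))"
    by (rule sum.swap)
  also have "\<dots> = (\<Sum>k<n. \<Sum>i\<in>J. \<Sum>l<n. \<Sum>j\<in>J. cnj (y i) * cnj (u i k) * P k l * (z j * u j l))"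
    by (rule sum.cong[OF refl], rule sum.cong[OF refl], rule sum.swap)
  also have "\<dots> = (\<Sum>k<n. \<Sum>l<n. \<Sum>i\<in>J. \<Sum>j\<in>J. cnj (y i) * cnj (u i k) * P k l * (z j * u j l))"
    by (rule sum.cong[OF refl], rule sum.swap)
  also have "\<dots> = (\<Sum>k<n. \<Sum>l<n. cnj (\<Sum>j\<in>J. y j * u j k) * P k l * (\<Sum>j\<in>J. z j * u j l))"
    
    unfolding cnj_sum complex_cnj_mult by (simp only: sum_product[symmetric] sum_distrib_right[symmetric])
  finally show ?thesis unfolding hform_def by simp
qed

lemma hform_scale: "hform I (\<lambda>i j. a * H i j) y (\<lambda>k. b * z k) = a * b * hform I H y z"
  unfolding hform_def sum_distrib_left by (intro sum.cong refl) simp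

text \<open>\<open>\<tau>\<close> is the sign of the Lyapunov inequality, \<open>\<sigma>\<close>
  the sign of definiteness on the span of the Schur vectors belonging to \<open>es1\<close>. Keeping
  both as parameters serves four uses: \<tau> = 1 with A and \<tau> = - 1 with P as its own system
  matrix, each for \<sigma> = 1 and \<sigma> = - 1.\<close>

lemma definite_subspace:
  fixes A :: "complex mat" and P :: "nat \<Rightarrow> nat \<Rightarrow> complex" and \<sigma> \<tau> lam :: real
  assumes A: "A \<in> carrier_mat n n" and cp: "char_poly A = (\<Prod>e\<leftarrow>es1 @ es2. [:- e, 1:])"
    and herm: "\<And>i j. P i j = cnj (P j i)" and \<sigma>: "\<sigma> \<noteq> 0"
    and es1: "\<And>e. e \<in> set es1 \<Longrightarrow> \<tau> * \<sigma> * (Re e + lam) < 0"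
    and lyap: "\<And>x :: nat \<Rightarrow> complex. \<exists>i<n. x i \<noteq> 0 \<Longrightarrow>
      \<tau> * Re (hform {..<n} P x (\<lambda>i. (\<Sum>k<n. A $$ (i, k) * x k) + lam * x i)) < 0"
  obtains u where "\<And>y. \<exists>j<length es1. y j \<noteq> 0 \<Longrightarrow>
      0 < \<sigma> * Re (hform {..<n} P (\<lambda>i. \<Sum>j<length es1. y j * u j i) (\<lambda>i. \<Sum>j<length es1. y j * u j i))"
proof -
  obtain p B q where pqB:
    "\<And>i j. i < n \<Longrightarrow> j < n \<Longrightarrow> (\<Sum>k<n. A $$ (i, k) * p j k) = (\<Sum>l\<le>j. B l j * p l i)"
    "\<And>j. j < n \<Longrightarrow> B j j = (es1 @ es2) ! j"
    "\<And>i j. j < i \<Longrightarrow> i < n \<Longrightarrow> B i j = 0"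
    "\<And>l j. l < n \<Longrightarrow> j < n \<Longrightarrow> (\<Sum>i<n. q l i * p j i) = (if l = j then 1 else 0)"
    "\<And>i k. i < n \<Longrightarrow> k < n \<Longrightarrow> (\<Sum>l<n. p l i * q l k) = (if i = k then 1 else 0)"
    by (rule triangular_basis[OF A cp]) (rule that)
  have an: "length es1 \<le> n"
  proof -
    have "degree (char_poly A) = n" using degree_monic_char_poly[OF A] by simp
    moreover have "degree (\<Prod>e\<leftarrow>es1 @ es2. [:- e, 1:]) = length (es1 @ es2)"
      using degree_linear_factors[of uminus "es1 @ es2"] .
    ultimately show ?thesis unfolding cp by simp
  qed
  define J where "J = {..<length es1}"
  define H where "H i j = \<sigma> * hform {..<n} P (p i) (p j)" for i j
  \<comment> \<open>The factor \<tau> \<sigma> makes the shifted triangular block stable, and with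
    the factor \<sigma> in \<open>H\<close> the Lyapunov form becomes \<sigma>^2 times the given
    one. Every choice of signs is thus reduced to the positive definite case.\<close>
  define B' where "B' i j = \<tau> * \<sigma> * (B i j + (if i = j then lam else 0))" for i j
  have pos: "0 < \<sigma> * Re (hform {..<n} P (\<lambda>i. \<Sum>j\<in>J. y j * p j i) (\<lambda>i. \<Sum>j\<in>J. y j * p j i))"
    if nz: "\<exists>j\<in>J. y j \<noteq> 0" for y
  proof -
    have "0 < Re (hform J H y y)"
    proof (rule triangular_lyapunov)
      show "finite J" unfolding J_def by simp
      show "H i j = cnj (H j i)" for i j
      proof -
        have "cnj (hform {..<n} P (p j) (p i)) = hform {..<n} P (p i) (p j)"
          unfolding hform_def cnj_sum complex_cnj_mult complex_cnj_cnj herm[symmetric]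
          by (subst sum.swap) (simp add: mult_ac)
        then show ?thesis unfolding H_def by simp
      qed
      show "B' i j = 0" if "i \<in> J" "j \<in> J" "j < i" for i j
        using that an pqB(3) unfolding J_def B'_def by auto
      show "Re (B' j j) < 0" if "j \<in> J" for j
      proof -
        have "B j j = es1 ! j" using pqB(2)[of j] that an unfolding J_def by (simp add: nth_append)
        then show ?thesis using es1[of "es1 ! j"] that unfolding B'_def J_def by simp
      qed
      show "\<exists>i\<in>J. y i \<noteq> 0" by fact
      fix y :: "nat \<Rightarrow> complex"
      assume nz: "\<exists>i\<in>J. y i \<noteq> 0"
      define x where "x = (\<lambda>i. \<Sum>j\<in>J. y j * p j i)"
      define b where "b k = (\<Sum>j\<in>J. (B k j + (if k = j then lam else 0)) * y j)" for k
      have B'y: "(\<Sum>j\<in>J. B' k j * y j) = \<tau> * \<sigma> * b k" for k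
        unfolding B'_def b_def by (simp add: sum_distrib_left mult.assoc)
      have xnz: "\<exists>i<n. x i \<noteq> 0"
      proof (rule ccontr)
        assume "\<not> ?thesis"
        then have x0: "x i = 0" if "i < n" for i using that by blast
        obtain l where l: "l \<in> J" "y l \<noteq> 0" using nz by blast
        \<comment> \<open>The dual basis q extracts the coefficient y_l, so a vanishing combination
          has vanishing coefficients.\<close>
        have "0 = (\<Sum>i<n. q l i * x i)" using x0 by simp
        also have "\<dots> = (\<Sum>i<n. \<Sum>j\<in>J. y j * (q l i * p j i))"
          unfolding x_def by (simp add: sum_distrib_left mult_ac)
        also have "\<dots> = (\<Sum>j\<in>J. y j * (\<Sum>i<n. q l i * p j i))"
          by (subst sum.swap) (simp add: sum_distrib_left)
        also have "\<dots> = (\<Sum>j\<in>J. if l = j then y j else 0)"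
          using l an unfolding J_def by (intro sum.cong refl) (auto simp: pqB(4))
        also have "\<dots> = y l" using l unfolding J_def by simp
        finally show False using l by simp
      qed
      have Ax: "(\<Sum>k<n. A $$ (i, k) * x k) + lam * x i = (\<Sum>k\<in>J. b k * p k i)" if i: "i < n" for i
      proof -
        have "(\<Sum>k<n. A $$ (i, k) * x k) = (\<Sum>k<n. \<Sum>j\<in>J. y j * (A $$ (i, k) * p j k))"
          unfolding x_def by (simp add: sum_distrib_left mult_ac)
        also have "\<dots> = (\<Sum>j\<in>J. y j * (\<Sum>k<n. A $$ (i, k) * p j k))"
          by (subst sum.swap) (simp add: sum_distrib_left)
        also have "\<dots> = (\<Sum>j\<in>J. y j * (\<Sum>l\<in>J. B l j * p l i))"
        proof (intro sum.cong refl)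
          fix j assume j: "j \<in> J"
          \<comment> \<open>Invariance of the span: \<open>B l j\<close> is zero for l > j, so the
            sum over l \<le> j may be extended to all of \<open>J\<close>.\<close>
          have "(\<Sum>k<n. A $$ (i, k) * p j k) = (\<Sum>l\<le>j. B l j * p l i)"
            using j an i unfolding J_def by (intro pqB(1)) auto
          also have "\<dots> = (\<Sum>l\<in>J. B l j * p l i)"
            using j an pqB(3) unfolding J_def by (intro sum.mono_neutral_left) auto
          finally show "y j * (\<Sum>k<n. A $$ (i, k) * p j k) = y j * (\<Sum>l\<in>J. B l j * p l i)" by simp
        qed
        also have "\<dots> = (\<Sum>l\<in>J. \<Sum>j\<in>J. B l j * y j * p l i)"
          unfolding sum_distrib_left by (subst sum.swap) (simp add: mult_ac)
        finally have 1: "(\<Sum>k<n. A $$ (i, k) * x k) = (\<Sum>l\<in>J. (\<Sum>j\<in>J. B l j * y j) * p l i)"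
          by (simp add: sum_distrib_right)
        have "(\<Sum>j\<in>J. (if l = j then lam else 0) * y j) = lam * y l" if "l \<in> J" for l
        proof -
          have "(\<Sum>j\<in>J. (if l = j then lam else 0) * y j) = (\<Sum>j\<in>J. if l = j then lam * y j else 0)"
            by (intro sum.cong) auto
          then show ?thesis using that unfolding J_def by simp
        qed
        then have "b l = (\<Sum>j\<in>J. B l j * y j) + lam * y l" if "l \<in> J" for l
          unfolding b_def using that by (simp add: distrib_right sum.distrib)
        then have "(\<Sum>k\<in>J. b k * p k i) = (\<Sum>l\<in>J. (\<Sum>j\<in>J. B l j * y j) * p l i + lam * (y l * p l i))"
          by (intro sum.cong refl) (simp add: distrib_right)
        then show ?thesis unfolding 1 by (simp add: x_def sum.distrib sum_distrib_left)
      qed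
      have "hform J H y (\<lambda>k. \<Sum>j\<in>J. B' k j * y j) = complex_of_real (\<sigma> * (\<tau> * \<sigma>)) * hform {..<n} P x (\<lambda>i. \<Sum>k\<in>J. b k * p k i)"
        unfolding B'y H_def x_def hform_combination
        using hform_scale[of J "complex_of_real \<sigma>" "\<lambda>i j. hform {..<n} P (p i) (p j)" y "\<tau> * \<sigma>" b] by simp
      also have "hform {..<n} P x (\<lambda>i. \<Sum>k\<in>J. b k * p k i) =
          hform {..<n} P x (\<lambda>i. (\<Sum>k<n. A $$ (i, k) * x k) + lam * x i)"
        using Ax by (intro hform_cong) auto
      finally have "Re (hform J H y (\<lambda>k. \<Sum>j\<in>J. B' k j * y j)) =
          \<sigma>\<^sup>2 * (\<tau> * Re (hform {..<n} P x (\<lambda>i. (\<Sum>k<n. A $$ (i, k) * x k) + lam * x i)))"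
        by (simp add: power2_eq_square)
      also have "\<dots> < 0" using lyap[OF xnz] \<sigma> by (simp add: mult_less_0_iff)
      finally show "Re (hform J H y (\<lambda>k. \<Sum>j\<in>J. B' k j * y j)) < 0" .
    qed
    also have "hform J H y y = \<sigma> * hform {..<n} P (\<lambda>i. \<Sum>j\<in>J. y j * p j i) (\<lambda>i. \<Sum>j\<in>J. y j * p j i)"
      unfolding hform_combination H_def
      using hform_scale[of J "complex_of_real \<sigma>" "\<lambda>i j. hform {..<n} P (p i) (p j)" y 1 y] by simp
    finally show ?thesis by simp
  qed
  show thesis using that[of p] pos unfolding J_def by auto
qed

section \<open>Dimension count for definite subspaces\<close>

text \<open>The vectors are the columns of a square matrix of size m = a + b whose rows from n on
  are zero. Row n exists because n < m, so the matrix is singular. The sign in the second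
  coefficients moves that family to the other side.\<close>

lemma dependent_combination:
  fixes u w :: "nat \<Rightarrow> nat \<Rightarrow> complex"
  assumes "n < a + b"
  obtains y z where "(\<exists>j<a. y j \<noteq> 0) \<or> (\<exists>j<b. z j \<noteq> 0)"
    "\<And>i. i < n \<Longrightarrow> (\<Sum>j<a. y j * u j i) = (\<Sum>j<b. z j * w j i)"
proof -
  define m where "m = a + b"
  define A where "A = mat m m (\<lambda>(i, j). if i < n then (if j < a then u j i else w (j - a) i) else 0)"
  have A: "A \<in> carrier_mat m m" unfolding A_def by simp
  have "transpose_mat A *\<^sub>v unit_vec m n = 0\<^sub>v m"
  proof
    fix i assume "i < dim_vec (0\<^sub>v m :: complex vec)"
    then have i: "i < m" by simp
    have "row (transpose_mat A) i \<bullet> unit_vec m n = A $$ (n, i)"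
      using i A assms unfolding m_def[symmetric] by (simp add: scalar_prod_right_unit)
    then show "(transpose_mat A *\<^sub>v unit_vec m n) $ i = 0\<^sub>v m $ i"
      using i A assms unfolding m_def[symmetric] by (simp add: A_def)
  qed (use A in simp)
  moreover have "unit_vec m n \<noteq> (0\<^sub>v m :: complex vec)"
    using assms unfolding m_def[symmetric] by (metis index_unit_vec(1) index_zero_vec(1) zero_neq_one)
  ultimately have "Determinant.det (transpose_mat A) = 0"
    using A by (subst det_0_iff_vec_prod_zero[of _ m]) (auto intro!: exI[of _ "unit_vec m n"])
  then have "Determinant.det A = 0" using det_transpose[OF A] by simp
  then obtain v where v: "v \<in> carrier_vec m" "v \<noteq> 0\<^sub>v m" "A *\<^sub>v v = 0\<^sub>v m"
    using det_0_iff_vec_prod_zero[OF A] by blast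
  show thesis
  proof (rule that[of "\<lambda>j. v $ j" "\<lambda>j. - v $ (a + j)"])
    obtain k where k: "k < m" "v $ k \<noteq> 0"
    proof (rule ccontr)
      assume "\<not> thesis"
      then have "v = 0\<^sub>v m" using v(1) that by (intro eq_vecI) auto
      then show False using v(2) by simp
    qed
    show "(\<exists>j<a. v $ j \<noteq> 0) \<or> (\<exists>j<b. - v $ (a + j) \<noteq> 0)"
    proof (cases "k < a")
      case False
      then have "k - a < b" "v $ (a + (k - a)) \<noteq> 0" using k unfolding m_def by auto
      then show ?thesis by auto
    qed (use k in auto)
    fix i assume i: "i < n"
    then have im: "i < m" using assms unfolding m_def by simp
    have "0 = (A *\<^sub>v v) $ i" using v(3) im by simp
    also have "\<dots> = (\<Sum>j<m. A $$ (i, j) * v $ j)"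
      using im A v(1) by (simp add: scalar_prod_def lessThan_atLeast0)
    also have "\<dots> = (\<Sum>j<m. (if j < a then u j i else w (j - a) i) * v $ j)"
      using im i by (intro sum.cong) (auto simp: A_def)
    also have "\<dots> = (\<Sum>j<a. u j i * v $ j) + (\<Sum>j<b. w j i * v $ (a + j))"
    proof -
      have "{..<m} = {..<a} \<union> (\<lambda>j. a + j) ` {..<b}"
        
        unfolding m_def by (auto simp: image_iff) (metis add_less_cancel_left le_add_diff_inverse lessThan_iff not_le)
      moreover have "(\<Sum>j\<in>(\<lambda>j. a + j) ` {..<b}. (if j < a then u j i else w (j - a) i) * v $ j) =
          (\<Sum>j<b. w j i * v $ (a + j))"
        by (subst sum.reindex) auto
      ultimately show ?thesis by (simp only:) (subst sum.union_disjoint, auto)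
    qed
    finally show "(\<Sum>j<a. v $ j * u j i) = (\<Sum>j<b. - v $ (a + j) * w j i)"
      by (simp add: sum_negf mult.commute eq_neg_iff_add_eq_0)
  qed
qed

text \<open>The argument of Sylvester's law of inertia: if a + b exceeded n, the two spans would
  share a vector with not all coefficients zero, and the form there would be both \<ge> 0 and \<le>
  0, strictly so on a side with a nonzero coefficient.\<close>

lemma definite_subspaces_disjoint:
  assumes pos: "\<And>y. \<exists>j<a. y j \<noteq> 0 \<Longrightarrow>
      0 < Re (hform {..<n} P (\<lambda>i. \<Sum>j<a. y j * u j i) (\<lambda>i. \<Sum>j<a. y j * u j i))"
    and neg: "\<And>y. \<exists>j<b. y j \<noteq> 0 \<Longrightarrow>
      Re (hform {..<n} P (\<lambda>i. \<Sum>j<b. y j * w j i) (\<lambda>i. \<Sum>j<b. y j * w j i)) < 0"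
  shows "a + b \<le> n"
proof (rule ccontr)
  assume "\<not> ?thesis"
  then obtain y z where nz: "(\<exists>j<a. y j \<noteq> 0) \<or> (\<exists>j<b. z j \<noteq> 0)"
    and eq: "\<And>i. i < n \<Longrightarrow> (\<Sum>j<a. y j * u j i) = (\<Sum>j<b. z j * w j i)"
    using dependent_combination[of n a b u w] by (metis not_le)
  define q where "q = Re (hform {..<n} P (\<lambda>i. \<Sum>j<a. y j * u j i) (\<lambda>i. \<Sum>j<a. y j * u j i))"
  have q: "q = Re (hform {..<n} P (\<lambda>i. \<Sum>j<b. z j * w j i) (\<lambda>i. \<Sum>j<b. z j * w j i))"
    unfolding q_def using eq by (intro arg_cong[of _ _ Re] hform_cong) auto
  have "0 \<le> q"
  proof (cases "\<exists>j<a. y j \<noteq> 0")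
    case True
    then show ?thesis using pos[of y] unfolding q_def by simp
  next
    case False
    then show ?thesis unfolding q_def by (subst hform_zero) auto
  qed
  moreover have "q \<le> 0"
  proof (cases "\<exists>j<b. z j \<noteq> 0")
    case True
    then show ?thesis using neg[of z] unfolding q by simp
  next
    case False
    then show ?thesis unfolding q by (subst hform_zero) auto
  qed
  ultimately show False using nz pos[of y] neg[of z] unfolding q_def[symmetric] q[symmetric] by auto
qed

lemma hform_hermitian:
  assumes herm: "\<And>i j. H i j = cnj (H j i)"
  shows "hform I H x z = (\<Sum>k\<in>I. cnj (\<Sum>i\<in>I. H k i * x i) * z k)"
proof -
  have "(\<Sum>i\<in>I. cnj (x i) * H i k) = cnj (\<Sum>i\<in>I. H k i * x i)" for k
    unfolding cnj_sum complex_cnj_mult herm[of _ k, symmetric] by (simp only: mult.commute)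
  then show ?thesis unfolding hform_columns by simp
qed

section \<open>Eigenvalue counts and inertia\<close>

lemma order_linear_factors:
  fixes rs :: "'a :: idom list"
  shows "Polynomial.order a (\<Prod>r\<leftarrow>rs. [:- r, 1:]) = count_list rs a"
proof (induction rs)
  case (Cons r rs)
  have "(\<Prod>r\<leftarrow>rs. [:- r, 1:]) \<noteq> 0" by (auto simp: prod_list_zero_iff)
  then have "Polynomial.order a (\<Prod>r\<leftarrow>r # rs. [:- r, 1:]) =
      Polynomial.order a [:- r, 1:] + Polynomial.order a (\<Prod>r\<leftarrow>rs. [:- r, 1:])"
    by (simp only: list.map prod_list.Cons) (rule order_mult, simp del: mult_pCons_left)
  moreover have "Polynomial.order a [:- r, 1:] = (if a = r then 1 else 0)"
    using order_linear_power[of a "- r" 1] by auto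
  ultimately show ?case using Cons by simp
qed simp

text \<open>Turns the sums of root orders over distinct eigenvalues, as in \<open>inertia\<close>,
  into lengths of sublists of one list of all roots.\<close>

lemma sum_order_roots:
  fixes rs :: "real list" and P :: "real mat"
  assumes P: "P \<in> carrier_mat n n" and cp: "char_poly P = (\<Prod>r\<leftarrow>rs. [:- r, 1:])"
  shows "(\<Sum>a | eigenvalue P a \<and> Q a. Polynomial.order a (char_poly P)) = length (filter Q rs)"
proof -
  have ev: "eigenvalue P a \<longleftrightarrow> a \<in> set rs" for a
    unfolding eigenvalue_root_char_poly[OF P] cp poly_prod_list by (auto simp: prod_list_zero_iff)
  have "(\<Sum>a | eigenvalue P a \<and> Q a. Polynomial.order a (char_poly P)) = (\<Sum>a\<in>set (filter Q rs). count_list (filter Q rs) a)"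
    unfolding cp order_linear_factors ev
    by (intro sum.cong) (auto simp: count_list_eq_length_filter intro!: arg_cong[of _ _ length] filter_cong)
  then show ?thesis using sum_count_set[of "filter Q rs" "set (filter Q rs)"] by simp
qed

lemma linear_factors_mset:
  fixes es :: "'a :: comm_ring_1 list"
  assumes "mset es = mset es'"
  shows "(\<Prod>e\<leftarrow>es. [:- e, 1:]) = (\<Prod>e\<leftarrow>es'. [:- e, 1:])"
  using arg_cong[OF assms, of "\<lambda>M. prod_mset (image_mset (\<lambda>e. [:- e, 1:]) M)"]
  by (simp flip: mset_map add: prod_mset_prod_list)

text \<open>P is negative on the span belonging to \<open>es1\<close> and positive on the one
  belonging to \<open>es2\<close>. Pairing each with the eigenvectors of P of the opposite sign
  gives |dp| + |es1| \<le> n and |es2| + |dn| \<le> n. Both pairs of lists have total length n, so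
  equality holds.\<close>

lemma inertia_lyapunov:
  fixes P :: "nat \<Rightarrow> nat \<Rightarrow> real" and A :: "complex mat"
  assumes sym: "\<And>i j. P i j = P j i"
    and A: "A \<in> carrier_mat n n" and cp: "char_poly A = (\<Prod>e\<leftarrow>es1 @ es2. [:- e, 1:])"
    and es1: "\<And>e. e \<in> set es1 \<Longrightarrow> - lam < Re e" and es2: "\<And>e. e \<in> set es2 \<Longrightarrow> Re e < - lam"
    and lyap: "\<And>x :: nat \<Rightarrow> complex. \<exists>i<n. x i \<noteq> 0 \<Longrightarrow>
      Re (hform {..<n} (\<lambda>i j. complex_of_real (P i j)) x (\<lambda>i. (\<Sum>k<n. A $$ (i, k) * x k) + lam * x i)) < 0"
  shows "inertia (mat n n (\<lambda>(i, j). P i j)) = (length es1, 0, n - length es1)"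
proof -
  define H where "H i j = complex_of_real (P i j)" for i j
  define Pm where "Pm = mat n n (\<lambda>(i, j). P i j)"
  have Pm: "Pm \<in> carrier_mat n n" "cmat Pm \<in> carrier_mat n n" unfolding Pm_def by auto
  have herm: "H i j = cnj (H j i)" for i j unfolding H_def using sym by simp
  have HP: "cmat Pm $$ (i, j) = H i j" if "i < n" "j < n" for i j
    using that unfolding Pm_def H_def by simp
  have lyap: "Re (hform {..<n} H x (\<lambda>i. (\<Sum>k<n. A $$ (i, k) * x k) + lam * x i)) < 0"
    if "\<exists>i<n. x i \<noteq> 0" for x :: "nat \<Rightarrow> complex"
    using lyap[OF that] unfolding H_def .
  \<comment> \<open>In the Lyapunov form x occurs on the left only through P x, so a kernel vector
    of P would make the form 0 and violate strictness.\<close>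
  have inj: "\<exists>k<n. (\<Sum>i<n. H k i * x i) \<noteq> 0" if "\<exists>i<n. x i \<noteq> 0" for x :: "nat \<Rightarrow> complex"
  proof (rule ccontr)
    assume "\<not> ?thesis"
    then have "hform {..<n} H x z = 0" for z
      unfolding hform_hermitian[of H, OF herm] by simp
    then show False using lyap[OF that] by simp
  qed
  have norm_pos: "0 < Re (\<Sum>k<n. cnj (y k) * y k)" if "\<exists>k<n. y k \<noteq> 0" for y :: "nat \<Rightarrow> complex"
  proof -
    from that obtain k where k: "k < n" "y k \<noteq> 0" by blast
    have "Re (\<Sum>k<n. cnj (y k) * y k) = (\<Sum>k<n. (cmod (y k))\<^sup>2)"
    proof -
      have "(\<Sum>k<n. cnj (y k) * y k) = complex_of_real (\<Sum>k<n. (cmod (y k))\<^sup>2)"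
        unfolding of_real_sum complex_norm_square by (intro sum.cong refl mult.commute)
      then show ?thesis by simp
    qed
    moreover have "0 < (cmod (y k))\<^sup>2" using k by simp
    moreover have "(cmod (y k))\<^sup>2 \<le> (\<Sum>k<n. (cmod (y k))\<^sup>2)"
      using k by (intro member_le_sum) auto
    ultimately show ?thesis by linarith
  qed
  obtain ds where ds: "char_poly (cmat Pm) = (\<Prod>d\<leftarrow>ds. [:- d, 1:])" "length ds = n"
    using char_poly_factorized[OF Pm(2)] by blast
  have real: "Im d = 0" "d \<noteq> 0" if "d \<in> set ds" for d
  proof -
    have "poly (char_poly (cmat Pm)) d = 0"
      unfolding ds poly_prod_list using that by (auto simp: prod_list_zero_iff intro!: bexI[of _ d])
    then obtain v where v: "v \<in> carrier_vec n" "v \<noteq> 0\<^sub>v n" "cmat Pm *\<^sub>v v = d \<cdot>\<^sub>v v"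
      using Pm unfolding eigenvalue_root_char_poly[OF Pm(2), symmetric] eigenvalue_def eigenvector_def by auto
    define x where "x i = v $ i" for i
    have nz: "\<exists>i<n. x i \<noteq> 0"
    proof (rule ccontr)
      assume "\<not> ?thesis"
      then have "v = 0\<^sub>v n" using v(1) unfolding x_def by (intro eq_vecI) auto
      then show False using v(2) by simp
    qed
    have Hx: "(\<Sum>i<n. H k i * x i) = d * x k" if k: "k < n" for k
    proof -
      have "(cmat Pm *\<^sub>v v) $ k = (\<Sum>i<n. cmat Pm $$ (k, i) * v $ i)"
        using k Pm v(1) by (simp add: scalar_prod_def lessThan_atLeast0)
      also have "\<dots> = (\<Sum>i<n. H k i * x i)" using k unfolding x_def by (intro sum.cong) (auto simp: HP)
      finally show ?thesis using v k unfolding x_def by simp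
    qed
    show "d \<noteq> 0" using inj[OF nz] Hx by auto
    define N where "N = (\<Sum>k<n. cnj (x k) * x k)"
    have N: "cnj N = N" unfolding N_def by (simp add: mult.commute)
    have "hform {..<n} H x x = cnj d * N"
      unfolding hform_hermitian[of H, OF herm] N_def sum_distrib_left using Hx by (intro sum.cong) auto
    moreover have "hform {..<n} H x x = d * N"
      unfolding hform_def N_def sum_distrib_left
      by (intro sum.cong refl) (use Hx in \<open>auto simp: mult.assoc sum_distrib_left[symmetric]\<close>)
    moreover have "N \<noteq> 0" using norm_pos[OF nz] unfolding N_def[symmetric] by auto
    ultimately have "cnj d = d" by simp
    then show "Im d = 0" by (simp add: complex_eq_iff)
  qed
  define dn where "dn = filter (\<lambda>d. Re d < 0) ds"
  define dp where "dp = filter (\<lambda>d. \<not> Re d < 0) ds"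
  have dp0: "Re d > 0" if "d \<in> set dp" for d
    using real[of d] that unfolding dp_def by (auto simp: complex_eq_iff)
  have mset: "mset ds = mset (dn @ dp)" "mset ds = mset (dp @ dn)"
    unfolding dn_def dp_def by (simp_all add: union_commute)
  \<comment> \<open>P as its own system matrix: x* P (P x) = |P x|^2 > 0, a Lyapunov inequality of
    the opposite sign at rate 0.\<close>
  have Psq: "- 1 * Re (hform {..<n} H x (\<lambda>i. (\<Sum>k<n. cmat Pm $$ (i, k) * x k) + complex_of_real 0 * x i)) < 0"
    if "\<exists>i<n. x i \<noteq> 0" for x :: "nat \<Rightarrow> complex"
  proof -
    have "hform {..<n} H x (\<lambda>i. (\<Sum>k<n. cmat Pm $$ (i, k) * x k) + complex_of_real 0 * x i) =
        hform {..<n} H x (\<lambda>i. \<Sum>k<n. H i k * x k)"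
      by (intro hform_cong) (auto simp: HP)
    also have "\<dots> = (\<Sum>k<n. cnj (\<Sum>i<n. H k i * x i) * (\<Sum>i<n. H k i * x i))"
      by (rule hform_hermitian[of H, OF herm])
    finally show ?thesis using norm_pos[OF inj[OF that]] by simp
  qed
  have cp': "char_poly A = (\<Prod>e\<leftarrow>es2 @ es1. [:- e, 1:])"
    unfolding cp by (rule linear_factors_mset) simp
  have len: "length es1 + length es2 = n"
  proof -
    have "degree (char_poly A) = n" using degree_monic_char_poly[OF A] by simp
    moreover have "degree (\<Prod>e\<leftarrow>es1 @ es2. [:- e, 1:]) = length (es1 @ es2)"
      using degree_linear_factors[of uminus "es1 @ es2"] .
    ultimately show ?thesis unfolding cp by simp
  qed
  have lyap1: "1 * Re (hform {..<n} H x (\<lambda>i. (\<Sum>k<n. A $$ (i, k) * x k) + lam * x i)) < 0"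
    if "\<exists>i<n. x i \<noteq> 0" for x :: "nat \<Rightarrow> complex"
    using lyap[OF that] by simp
  have dn0: "Re d < 0" if "d \<in> set dn" for d
    using that unfolding dn_def by simp
  have sub: "\<exists>u. \<forall>y. (\<exists>j<length l1. y j \<noteq> 0) \<longrightarrow>
      0 < \<sigma> * Re (hform {..<n} H (\<lambda>i. \<Sum>j<length l1. y j * u j i) (\<lambda>i. \<Sum>j<length l1. y j * u j i))"
    if "C \<in> carrier_mat n n" "char_poly C = (\<Prod>e\<leftarrow>l1 @ l2. [:- e, 1:])" "\<sigma> \<noteq> 0"
      "\<And>e. e \<in> set l1 \<Longrightarrow> \<tau> * \<sigma> * (Re e + \<rho>) < 0"
      "\<And>x :: nat \<Rightarrow> complex. \<exists>i<n. x i \<noteq> 0 \<Longrightarrow>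
        \<tau> * Re (hform {..<n} H x (\<lambda>i. (\<Sum>k<n. C $$ (i, k) * x k) + \<rho> * x i)) < 0"
    for C l1 l2 and \<sigma> \<tau> \<rho> :: real
    by (rule definite_subspace[where P = H, OF that(1,2) herm that(3-5)]) blast+
  obtain u1 where u1: "\<And>y. \<exists>j<length es2. y j \<noteq> 0 \<Longrightarrow>
      0 < (1) * Re (hform {..<n} H (\<lambda>i. \<Sum>j<length es2. y j * u1 j i) (\<lambda>i. \<Sum>j<length es2. y j * u1 j i))"
  proof -
    have "1 * (1) * (Re e + lam) < 0" if "e \<in> set es2" for e
      using es2[OF that] by simp
    from sub[OF A cp' _ this lyap1] show thesis using that by auto
  qed
  obtain u2 where u2: "\<And>y. \<exists>j<length es1. y j \<noteq> 0 \<Longrightarrow>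
      0 < (- 1) * Re (hform {..<n} H (\<lambda>i. \<Sum>j<length es1. y j * u2 j i) (\<lambda>i. \<Sum>j<length es1. y j * u2 j i))"
  proof -
    have "1 * (- 1) * (Re e + lam) < 0" if "e \<in> set es1" for e
      using es1[OF that] by simp
    from sub[OF A cp _ this lyap1] show thesis using that by auto
  qed
  obtain u3 where u3: "\<And>y. \<exists>j<length dp. y j \<noteq> 0 \<Longrightarrow>
      0 < (1) * Re (hform {..<n} H (\<lambda>i. \<Sum>j<length dp. y j * u3 j i) (\<lambda>i. \<Sum>j<length dp. y j * u3 j i))"
  proof -
    have "(- 1) * (1) * (Re e + 0) < 0" if "e \<in> set dp" for e
      using dp0[OF that] by simp
    from sub[OF Pm(2) ds(1)[unfolded linear_factors_mset[OF mset(2)]] _ this Psq] show thesis using that by auto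
  qed
  obtain u4 where u4: "\<And>y. \<exists>j<length dn. y j \<noteq> 0 \<Longrightarrow>
      0 < (- 1) * Re (hform {..<n} H (\<lambda>i. \<Sum>j<length dn. y j * u4 j i) (\<lambda>i. \<Sum>j<length dn. y j * u4 j i))"
  proof -
    have "(- 1) * (- 1) * (Re e + 0) < 0" if "e \<in> set dn" for e
      using dn0[OF that] by simp
    from sub[OF Pm(2) ds(1)[unfolded linear_factors_mset[OF mset(1)]] _ this Psq] show thesis using that by auto
  qed
  have "length dp + length es1 \<le> n"
    by (rule definite_subspaces_disjoint[of "length dp" n H u3 "length es1" u2]) (use u2 u3 in auto)
  moreover have "length es2 + length dn \<le> n"
    by (rule definite_subspaces_disjoint[of "length es2" n H u1 "length dn" u4]) (use u1 u4 in auto)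
  moreover have "length dn + length dp = n"
    using ds(2) sum_length_filter_compl[of "\<lambda>d. Re d < 0" ds] unfolding dn_def dp_def by simp
  ultimately have lens: "length dn = length es1" "length dp = n - length es1" using len by auto
  \<comment> \<open>All complex roots are real, so the factorisation descends to the real
    characteristic polynomial, which is the one that \<open>inertia\<close> refers to.\<close>
  define rs where "rs = map Re ds"
  have dsrs: "ds = map complex_of_real rs"
    unfolding rs_def using real(1) by (auto simp: complex_eq_iff intro!: map_idI[symmetric])
  have "map_poly complex_of_real (char_poly Pm) = map_poly complex_of_real (\<Prod>r\<leftarrow>rs. [:- r, 1:])"
  proof -
    interpret map_poly_inj_comm_ring_hom complex_of_real ..
    have "map_poly complex_of_real (\<Prod>r\<leftarrow>rs. [:- r, 1:]) = (\<Prod>d\<leftarrow>ds. [:- d, 1:])"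
      unfolding dsrs by (simp add: hom_prod_list o_def)
    then show ?thesis using ds(1) unfolding of_real_hom.char_poly_hom[OF Pm(1)] by simp
  qed
  then have cpP: "char_poly Pm = (\<Prod>r\<leftarrow>rs. [:- r, 1:])"
    by (simp add: poly_eq_iff coeff_map_poly)
  have "length (filter (\<lambda>a. a < 0) rs) = length dn"
    unfolding rs_def dn_def by (simp add: filter_map o_def)
  moreover have "filter (\<lambda>a. a = 0) rs = []"
    using real unfolding rs_def by (auto simp: filter_empty_conv complex_eq_iff)
  moreover have "length (filter (\<lambda>a. a > 0) rs) = length dp"
  proof -
    have "filter (\<lambda>d. Re d > 0) ds = dp"
      unfolding dp_def using dp0 unfolding dp_def by (intro filter_cong) auto
    then show ?thesis unfolding rs_def by (simp add: filter_map o_def)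
  qed
  ultimately show ?thesis
    unfolding inertia_def Pm_def[symmetric] sum_order_roots[OF Pm(1) cpP] lens by simp
qed

section \<open>Gains of transfer functions\<close>

text \<open>\<open>Max\<close> carries information only on a finite set; finiteness comes from the
  roots of the characteristic polynomial of M*M. Any exhibited eigenvalue then bounds
  \<open>sigma_max\<close> from below.\<close>

lemma sigma_max_ge:
  assumes M: "M \<in> carrier_mat r c" and ev: "eigenvalue (mat_adjoint M * M) (complex_of_real x)"
  shows "sqrt x \<le> sigma_max M"
proof -
  have K: "mat_adjoint M * M \<in> carrier_mat c c"
    using M unfolding mat_adjoint_def by auto
  have "finite {z. eigenvalue (mat_adjoint M * M) z}"
    unfolding eigenvalue_root_char_poly[OF K]
    using degree_monic_char_poly[OF K] by (intro poly_roots_finite) auto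
  then have "finite ((\<lambda>z. sqrt (Re z)) ` {z. eigenvalue (mat_adjoint M * M) z})" by simp
  moreover have "singular_values M \<subseteq> (\<lambda>z. sqrt (Re z)) ` {z. eigenvalue (mat_adjoint M * M) z}"
    unfolding singular_values_def by (force simp: image_iff)
  ultimately have "finite (singular_values M)" by (rule finite_subset[rotated])
  then show ?thesis
    unfolding sigma_max_def using ev by (intro Max_ge) (auto simp: singular_values_def)
qed

lemma mat_adjoint_index:
  "M \<in> carrier_mat r c \<Longrightarrow> i < c \<Longrightarrow> j < r \<Longrightarrow> mat_adjoint M $$ (i, j) = cnj (M $$ (j, i))"
  unfolding mat_adjoint_def by (auto simp: mat_of_rows_index)

lemma sigma_max_1:
  assumes M: "M \<in> carrier_mat 1 1"
  shows "cmod (M $$ (0, 0)) \<le> sigma_max M"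
proof -
  define K where "K = mat_adjoint M * M"
  have MA: "mat_adjoint M \<in> carrier_mat 1 1" using M unfolding mat_adjoint_def by auto
  have K: "K \<in> carrier_mat 1 1" unfolding K_def using M MA by auto
  have K00: "K $$ (0, 0) = complex_of_real ((cmod (M $$ (0, 0)))\<^sup>2)"
    unfolding K_def complex_norm_square using M MA
    by (simp add: scalar_prod_def mat_adjoint_index[OF M] mult.commute)
  have "eigenvector K (vec 1 (\<lambda>_. 1)) (complex_of_real ((cmod (M $$ (0, 0)))\<^sup>2))"
    unfolding eigenvector_def
  proof (intro conjI)
    show "vec 1 (\<lambda>_. 1) \<noteq> (0\<^sub>v (dim_row K) :: complex Matrix.vec)"
    proof
      assume "vec 1 (\<lambda>_. 1) = (0\<^sub>v (dim_row K) :: complex Matrix.vec)"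
      from arg_cong[OF this, of "\<lambda>v :: complex Matrix.vec. v $ 0"] K show False by simp
    qed
  qed (use K K00 in \<open>auto intro!: eq_vecI simp: scalar_prod_def\<close>)
  then have "eigenvalue (mat_adjoint M * M) (complex_of_real ((cmod (M $$ (0, 0)))\<^sup>2))"
    unfolding K_def eigenvalue_def by blast
  from sigma_max_ge[OF M this] show ?thesis by simp
qed

text \<open>\<open>sigma_max\<close> is defined by eigenvalues and not as an operator norm, so an
  explicit eigenpair of M*M is used. With diagonal a, d and off-diagonal entry b, the larger root x
  of the characteristic polynomial is at least d, and d \<ge> |M_11|^2 with indices counted from
  0.\<close>

lemma sigma_max_2:
  assumes M: "M \<in> carrier_mat 2 2"
  shows "cmod (M $$ (1, 1)) \<le> sigma_max M"
proof -
  define K where "K = mat_adjoint M * M"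
  have MA: "mat_adjoint M \<in> carrier_mat 2 2" using M unfolding mat_adjoint_def by auto
  have K: "K \<in> carrier_mat 2 2" unfolding K_def using M MA by auto
  have Kij: "K $$ (i, j) = cnj (M $$ (0, i)) * M $$ (0, j) + cnj (M $$ (1, i)) * M $$ (1, j)" if "i < 2" "j < 2" for i j
    unfolding K_def using that M MA by (simp add: scalar_prod_def mat_adjoint_index[OF M] numeral_2_eq_2)
  define a where "a = (cmod (M $$ (0, 0)))\<^sup>2 + (cmod (M $$ (1, 0)))\<^sup>2"
  define d where "d = (cmod (M $$ (0, 1)))\<^sup>2 + (cmod (M $$ (1, 1)))\<^sup>2"
  define b where "b = K $$ (0, 1)"
  have K00: "K $$ (0, 0) = complex_of_real a" and K11: "K $$ (1, 1) = complex_of_real d"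
    unfolding a_def d_def of_real_add complex_norm_square by (simp_all add: Kij mult.commute)
  have K10: "K $$ (1, 0) = cnj b" unfolding b_def by (simp add: Kij mult.commute)
  define s where "s = sqrt (((a - d) / 2)\<^sup>2 + (cmod b)\<^sup>2)"
  define x where "x = (a + d) / 2 + s"
  have s2: "s\<^sup>2 = ((a - d) / 2)\<^sup>2 + (cmod b)\<^sup>2" unfolding s_def by simp
  have s: "\<bar>(a - d) / 2\<bar> \<le> s" unfolding s_def by (rule real_le_rsqrt) (simp only: power2_abs le_add_same_cancel1 zero_le_power2)
  have xd: "d \<le> x" using s unfolding x_def by (auto simp: abs_le_iff field_simps)
  have "(x - a) * (x - d) = (cmod b)\<^sup>2"
    using s2 unfolding x_def by (simp add: power2_eq_square field_simps)
  then have quad: "complex_of_real (x - a) * complex_of_real (x - d) = b * cnj b"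
    unfolding complex_norm_square[symmetric] of_real_mult[symmetric] by simp
  have mv: "(K *\<^sub>v v) $ i = K $$ (i, 0) * v $ 0 + K $$ (i, 1) * v $ 1" if "i < 2" "v \<in> carrier_vec 2" for i and v :: "complex Matrix.vec"
    using that K by (simp add: scalar_prod_def numeral_2_eq_2)
  have ev: "eigenvalue K (complex_of_real x)"
    if v: "v \<in> carrier_vec 2" "v $ 0 \<noteq> 0 \<or> v $ 1 \<noteq> 0"
      "complex_of_real a * v $ 0 + b * v $ 1 = complex_of_real x * v $ 0"
      "cnj b * v $ 0 + complex_of_real d * v $ 1 = complex_of_real x * v $ 1" for v :: "complex Matrix.vec"
    unfolding eigenvalue_def eigenvector_def
  proof (intro exI[of _ v] conjI)
    show "v \<in> carrier_vec (dim_row K)" using v K by simp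
    show "v \<noteq> 0\<^sub>v (dim_row K)" using v(2) K by auto
    show "K *\<^sub>v v = complex_of_real x \<cdot>\<^sub>v v"
    proof
      fix i assume "i < dim_vec (complex_of_real x \<cdot>\<^sub>v v)"
      then have i: "i < 2" using v by simp
      then have "i = 0 \<or> i = 1" by auto
      then show "(K *\<^sub>v v) $ i = (complex_of_real x \<cdot>\<^sub>v v) $ i"
        using mv[OF i v(1)] v K00 K11 K10 by (auto simp: b_def)
    qed (use v K in simp)
  qed
  have "eigenvalue K (complex_of_real x)"
  \<comment> \<open>The vector (b, x - a) satisfies the first row identically and the second by (x -
    a)(x - d) = |b|^2. For b = 0 it may vanish, but then the matrix is diagonal and a unit vector
    serves.\<close>
  proof (cases "b = 0")
    case False
    show ?thesis
      by (rule ev[of "vec 2 (\<lambda>i. if i = 0 then b else complex_of_real (x - a))"])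
        (use False quad in \<open>auto simp: algebra_simps\<close>)
  next
    case True
    then have "x = a \<or> x = d" using quad by auto
    then show ?thesis
    proof
      assume "x = a"
      then show ?thesis by (intro ev[of "vec 2 (\<lambda>i. if i = 0 then 1 else 0)"]) (use True in auto)
    next
      assume "x = d"
      then show ?thesis by (intro ev[of "vec 2 (\<lambda>i. if i = 0 then 0 else 1)"]) (use True in auto)
    qed
  qed
  from sigma_max_ge[OF M this[unfolded K_def]] have "sqrt x \<le> sigma_max M" .
  moreover have "cmod (M $$ (1, 1)) \<le> sqrt x"
    using xd zero_le_power2[of "cmod (M $$ (0, 1))"] unfolding d_def by (intro real_le_rsqrt) linarith
  ultimately show ?thesis by linarith
qed

lemma hinf_norm_le_sigma_max:
  assumes "hinf_norm lam q H \<le> ereal r"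
  shows "sigma_max (H (\<i> * complex_of_real \<omega> - complex_of_real lam)) \<le> r"
proof -
  have "pole_split lam q H" using assms unfolding hinf_norm_def by (auto split: if_splits)
  then have "(SUP \<omega>::real. ereal (sigma_max (H (\<i> * complex_of_real \<omega> - complex_of_real lam)))) \<le> ereal r"
    using assms unfolding hinf_norm_def by simp
  then have "ereal (sigma_max (H (\<i> * complex_of_real \<omega> - complex_of_real lam))) \<le> ereal r"
    by (rule order_trans[OF SUP_upper[OF UNIV_I]])
  then show ?thesis by simp
qed

lemma hinf_norm_less_sigma_max:
  assumes "hinf_norm lam q H < ereal r"
  shows "sigma_max (H (\<i> * complex_of_real \<omega> - complex_of_real lam)) < r"
proof -
  have "pole_split lam q H" using assms unfolding hinf_norm_def by (auto split: if_splits)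
  then have "(SUP \<omega>::real. ereal (sigma_max (H (\<i> * complex_of_real \<omega> - complex_of_real lam)))) < ereal r"
    using assms unfolding hinf_norm_def by simp
  then have "ereal (sigma_max (H (\<i> * complex_of_real \<omega> - complex_of_real lam))) < ereal r"
    by (rule le_less_trans[OF SUP_upper[OF UNIV_I]])
  then show ?thesis by simp
qed

section \<open>Frequency response of a state equation\<close>

lemma transfer_dims [simp]:
  "dim_row (transfer A B C s) = dim_row C" "dim_col (transfer A B C s) = dim_col B"
  unfolding transfer_def by simp_all

text \<open>Both entries contain the same \<open>?R\<close>, so equality of one row of C and one
  column of B suffices. \<open>?R\<close> is treated as an opaque matrix: where the inverse does not
  exist it is an unspecified value of unknown dimensions, and the argument covers that case as
  well.\<close>

lemma transfer_entry_cong: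
  assumes "i < dim_row C" "i' < dim_row C'" "j < dim_col B" "j' < dim_col B'"
    and "row C i = row C' i'" "col B j = col B' j'"
  shows "transfer A B C s $$ (i, j) = transfer A B' C' s $$ (i', j')"
proof -
  let ?R = "the (mat_inverse (s \<cdot>\<^sub>m 1\<^sub>m (dim_row A) - cmat A))"
  have "row (cmat X) k = map_vec complex_of_real (row X k)" if "k < dim_row X" for X k
    using that by (intro eq_vecI) auto
  then have r: "row (cmat C) i = row (cmat C') i'" using assms by simp
  have "col (cmat X) k = map_vec complex_of_real (col X k)" if "k < dim_col X" for X k
    using that by (intro eq_vecI) auto
  then have c: "col (cmat B) j = col (cmat B') j'" using assms by simp
  have "row (X * ?R) k = vec (dim_col ?R) (\<lambda>l. row X k \<bullet> col ?R l)" if "k < dim_row X" for X k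
    using that by (intro eq_vecI) auto
  then have "row (cmat C * ?R) i = row (cmat C' * ?R) i'" using assms r by simp
  then show ?thesis using assms c unfolding transfer_def by simp
qed

text \<open>Passes from the resolvent to solutions of the state equation, the form of the frequency
  hypothesis in \<open>strict_kyp\<close>. As s is not an eigenvalue, s I - A has nonzero
  determinant, \<open>mat_inverse\<close> returns an actual inverse, and x is that inverse applied
  to the input column times w.\<close>

lemma transfer_response:
  assumes A: "A \<in> carrier_mat n n" and B: "B \<in> carrier_mat n m" and C: "C \<in> carrier_mat l n"
    and s: "\<not> eigenvalue (cmat A) s" and ij: "i < l" "j < m" and x: "x \<in> carrier_vec n"
    and eq: "s \<cdot>\<^sub>v x = cmat A *\<^sub>v x + w \<cdot>\<^sub>v col (cmat B) j"
  shows "row (cmat C) i \<bullet> x = transfer A B C s $$ (i, j) * w"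
proof -
  define S where "S = s \<cdot>\<^sub>m 1\<^sub>m n - cmat A"
  have cA: "cmat A \<in> carrier_mat n n" and cB: "cmat B \<in> carrier_mat n m" and cC: "cmat C \<in> carrier_mat l n"
    using A B C by auto
  have S: "S \<in> carrier_mat n n" unfolding S_def using cA by (intro minus_carrier_mat) auto
  have Sv: "S *\<^sub>v v = s \<cdot>\<^sub>v v - cmat A *\<^sub>v v" if "v \<in> carrier_vec n" for v
  proof -
    have "(s \<cdot>\<^sub>m 1\<^sub>m n) *\<^sub>v v = s \<cdot>\<^sub>v v"
    proof
      fix i assume "i < dim_vec (s \<cdot>\<^sub>v v)"
      then have i: "i < n" using that by simp
      have "row (s \<cdot>\<^sub>m 1\<^sub>m n) i = s \<cdot>\<^sub>v unit_vec n i" using i by (intro eq_vecI) auto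
      then show "((s \<cdot>\<^sub>m 1\<^sub>m n) *\<^sub>v v) $ i = (s \<cdot>\<^sub>v v) $ i"
        using i that by (simp add: scalar_prod_left_unit)
    qed (use that in simp)
    then show ?thesis
      unfolding S_def using that cA by (simp add: minus_mult_distrib_mat_vec[of _ n n])
  qed
  have "Determinant.det S \<noteq> 0"
  proof
    assume "Determinant.det S = 0"
    then obtain v where v: "v \<in> carrier_vec n" "v \<noteq> 0\<^sub>v n" "S *\<^sub>v v = 0\<^sub>v n"
      using det_0_iff_vec_prod_zero[OF S] by blast
    have "cmat A *\<^sub>v v = s \<cdot>\<^sub>v v"
    proof
      show "dim_vec (cmat A *\<^sub>v v) = dim_vec (s \<cdot>\<^sub>v v)" using cA v by simp
      fix i assume i: "i < dim_vec (s \<cdot>\<^sub>v v)"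
      then have "(s \<cdot>\<^sub>v v - cmat A *\<^sub>v v) $ i = 0" using v Sv[OF v(1)] by simp
      then show "(cmat A *\<^sub>v v) $ i = (s \<cdot>\<^sub>v v) $ i" using i v cA by simp
    qed
    then show False using s v cA unfolding eigenvalue_def eigenvector_def by auto
  qed
  then have "S \<in> Units (ring_mat TYPE(complex) n ())" by (rule det_non_zero_imp_unit[OF S])
  then obtain R where R: "mat_inverse S = Some R"
    using mat_inverse(1)[OF S, of "()"] by (cases "mat_inverse S") auto
  note RS = mat_inverse(2)[OF S R]
  have b: "col (cmat B) j \<in> carrier_vec n" using col_dim[of "cmat B" j] B by simp
  have "S *\<^sub>v x = w \<cdot>\<^sub>v col (cmat B) j"
  proof -
    have "y + z - y = z" if "y \<in> carrier_vec n" "z \<in> carrier_vec n" for y z :: "complex Matrix.vec"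
      using that by (intro eq_vecI) auto
    then show ?thesis unfolding Sv[OF x] eq using cA x b by simp
  qed
  then have "R *\<^sub>v (S *\<^sub>v x) = w \<cdot>\<^sub>v (R *\<^sub>v col (cmat B) j)"
    using RS b by (simp add: mult_mat_vec[of _ n n])
  moreover have "R *\<^sub>v (S *\<^sub>v x) = x"
    using RS S x by (simp add: assoc_mult_mat_vec[symmetric, of _ n n _ n])
  ultimately have xR: "x = w \<cdot>\<^sub>v (R *\<^sub>v col (cmat B) j)" by simp
  have "transfer A B C s = cmat C * (R * cmat B)"
    unfolding transfer_def using A RS R cC cB unfolding S_def by (simp add: assoc_mult_mat[of _ l n _ n _ m])
  then have "transfer A B C s $$ (i, j) = row (cmat C) i \<bullet> (R *\<^sub>v col (cmat B) j)"
    using ij cC cB RS by (simp add: col_mult2[of _ n n _ m])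
  then show ?thesis
    unfolding xR using RS cC b ij
    by (subst scalar_prod_smult_distrib[of _ n]) auto
qed

section \<open>Lure systems\<close>

lemma scalar_prod_sum: "v \<in> carrier_vec n \<Longrightarrow> u \<bullet> v = (\<Sum>i<n. u $ i * v $ i)"
  unfolding scalar_prod_def by (auto simp: lessThan_atLeast0)

lemma euclid_norm_sum: "v \<in> carrier_vec n \<Longrightarrow> (euclid_norm v)\<^sup>2 = (\<Sum>i<n. (v $ i)\<^sup>2)"
  unfolding euclid_norm_def by (simp add: scalar_prod_sum power2_eq_square sum_nonneg)

lemma euclid_norm_nonneg: "0 \<le> euclid_norm v"
  unfolding euclid_norm_def scalar_prod_def by (simp add: sum_nonneg)

lemma euclid_norm_smult: "euclid_norm (a \<cdot>\<^sub>v v) = \<bar>a\<bar> * euclid_norm v"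
proof -
  have "(a \<cdot>\<^sub>v v) \<bullet> (a \<cdot>\<^sub>v v) = a\<^sup>2 * (v \<bullet> v)"
    unfolding scalar_prod_def by (simp add: sum_distrib_left power2_eq_square mult_ac)
  then show ?thesis unfolding euclid_norm_def by (simp add: real_sqrt_mult)
qed

lemma component_le_euclid_norm:
  assumes "v \<in> carrier_vec n" "i < n"
  shows "\<bar>v $ i\<bar> \<le> euclid_norm v"
proof -
  have "(v $ i)\<^sup>2 \<le> (\<Sum>i<n. (v $ i)\<^sup>2)" using assms(2) by (intro member_le_sum) auto
  then show ?thesis
    unfolding euclid_norm_sum[OF assms(1), symmetric]
    using euclid_norm_nonneg by (metis abs_le_square_iff abs_of_nonneg)
qed

lemma scalar_prod_le_euclid_norm:
  assumes h: "h \<in> carrier_vec n"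
  shows "\<bar>c \<bullet> h\<bar> \<le> (\<Sum>i<n. \<bar>c $ i\<bar>) * euclid_norm h"
proof -
  have "\<bar>c \<bullet> h\<bar> \<le> (\<Sum>i<n. \<bar>c $ i\<bar> * \<bar>h $ i\<bar>)"
    unfolding scalar_prod_sum[OF h] abs_mult[symmetric] by (rule sum_abs)
  also have "\<dots> \<le> (\<Sum>i<n. \<bar>c $ i\<bar> * euclid_norm h)"
    by (intro sum_mono mult_left_mono component_le_euclid_norm[OF h]) auto
  finally show ?thesis by (simp add: sum_distrib_right)
qed

definition lure_jacobian ::
  "nat \<Rightarrow> real mat \<Rightarrow> real Matrix.vec \<Rightarrow> real Matrix.vec \<Rightarrow> (real \<Rightarrow> real) \<Rightarrow> real Matrix.vec \<Rightarrow> real mat" where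
  "lure_jacobian n A b c \<phi>' x = mat n n (\<lambda>(i, j). A $$ (i, j) - \<phi>' (c \<bullet> x) * (b $ i * c $ j))"

lemma lure_jacobian_mult:
  assumes A: "A \<in> carrier_mat n n" and b: "b \<in> carrier_vec n" and h: "h \<in> carrier_vec n"
  shows "lure_jacobian n A b c \<phi>' x *\<^sub>v h = A *\<^sub>v h - (\<phi>' (c \<bullet> x) * (c \<bullet> h)) \<cdot>\<^sub>v b"
proof
  show "dim_vec (lure_jacobian n A b c \<phi>' x *\<^sub>v h) = dim_vec (A *\<^sub>v h - (\<phi>' (c \<bullet> x) * (c \<bullet> h)) \<cdot>\<^sub>v b)"
    using b unfolding lure_jacobian_def by simp
  fix i assume "i < dim_vec (A *\<^sub>v h - (\<phi>' (c \<bullet> x) * (c \<bullet> h)) \<cdot>\<^sub>v b)"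
  then have i: "i < n" using b by simp
  have "(lure_jacobian n A b c \<phi>' x *\<^sub>v h) $ i =
      (\<Sum>j<n. (A $$ (i, j) - \<phi>' (c \<bullet> x) * (b $ i * c $ j)) * h $ j)"
    using i h unfolding lure_jacobian_def by (simp add: scalar_prod_sum[OF h])
  also have "\<dots> = (\<Sum>j<n. A $$ (i, j) * h $ j) - \<phi>' (c \<bullet> x) * b $ i * (\<Sum>j<n. c $ j * h $ j)"
    by (simp add: left_diff_distrib sum_subtractf sum_distrib_left mult.assoc)
  also have "\<dots> = (A *\<^sub>v h - (\<phi>' (c \<bullet> x) * (c \<bullet> h)) \<cdot>\<^sub>v b) $ i"
    using i A b h by (simp add: scalar_prod_sum[OF h] mult.assoc mult.commute[of "b $ i"])
  finally show "(lure_jacobian n A b c \<phi>' x *\<^sub>v h) $ i = (A *\<^sub>v h - (\<phi>' (c \<bullet> x) * (c \<bullet> h)) \<cdot>\<^sub>v b) $ i" .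
qed

text \<open>The chain rule by hand: the remainder of the field is - r b, with r the remainder of
  \<open>\<phi>\<close> at c . x for the increment c . h. The constant \<open>K\<close>, the l1 norm
  of c, bounds |c . h| by K |h|; the summands 1 in the divisors keep them positive when b or c is
  zero.\<close>

lemma lure_field_C1:
  assumes A: "A \<in> carrier_mat n n" and b: "b \<in> carrier_vec n" and c: "c \<in> carrier_vec n"
    and der: "\<And>z. (\<phi> has_real_derivative \<phi>' z) (at z)" and cont: "continuous_on UNIV \<phi>'"
  shows "C1_with_jacobian n (lure_field A b c \<phi>) (lure_jacobian n A b c \<phi>')"
proof -
  define K where "K = (\<Sum>i<n. \<bar>c $ i\<bar>)"
  have K: "0 \<le> K" unfolding K_def by (intro sum_nonneg) auto
  have small: "\<bar>c \<bullet> h\<bar> < d" if "h \<in> carrier_vec n" "euclid_norm h < d / (K + 1)" "d > 0" for h d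
  proof -
    have "\<bar>c \<bullet> h\<bar> \<le> K * euclid_norm h" unfolding K_def by (rule scalar_prod_le_euclid_norm[OF that(1)])
    also have "\<dots> \<le> (K + 1) * euclid_norm h" using euclid_norm_nonneg[of h] by (simp add: algebra_simps)
    also have "\<dots> < d" using that K by (simp add: field_simps)
    finally show ?thesis .
  qed
  show ?thesis
    unfolding C1_with_jacobian_def
  proof (intro conjI ballI allI impI)
    show "lure_field A b c \<phi> \<in> carrier_vec n \<rightarrow> carrier_vec n"
      unfolding lure_field_def using A b by auto
    show "lure_jacobian n A b c \<phi>' \<in> carrier_vec n \<rightarrow> carrier_mat n n"
      unfolding lure_jacobian_def by auto
  next
    fix x :: "real Matrix.vec" and e :: real
    assume x: "x \<in> carrier_vec n" and e: "0 < e"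
    define B where "B = euclid_norm b"
    have B: "0 \<le> B" unfolding B_def by (rule euclid_norm_nonneg)
    define e' where "e' = e / ((K + 1) * (B + 1))"
    have e': "0 < e'" unfolding e'_def using e K B by simp
    obtain d where d: "d > 0" and
      bound: "\<And>t. \<bar>t\<bar> < d \<Longrightarrow> \<bar>\<phi> (c \<bullet> x + t) - \<phi> (c \<bullet> x) - \<phi>' (c \<bullet> x) * t\<bar> \<le> e' * \<bar>t\<bar>"
    proof -
      from der[of "c \<bullet> x"] obtain d where d: "d > 0"
        "\<And>y. norm (y - c \<bullet> x) < d \<Longrightarrow>
          norm (\<phi> y - \<phi> (c \<bullet> x) - \<phi>' (c \<bullet> x) * (y - c \<bullet> x)) \<le> e' * norm (y - c \<bullet> x)"
        unfolding has_field_derivative_def has_derivative_at_alt using e' by blast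
      then show thesis
        using that[of d] by (metis add_diff_cancel_left' real_norm_def)
    qed
    show "\<exists>d>0. \<forall>h\<in>carrier_vec n. euclid_norm h < d \<longrightarrow>
        euclid_norm (lure_field A b c \<phi> (x + h) - lure_field A b c \<phi> x - lure_jacobian n A b c \<phi>' x *\<^sub>v h)
          \<le> e * euclid_norm h"
    proof (intro exI[of _ "d / (K + 1)"] conjI ballI impI)
      show "d / (K + 1) > 0" using d K by simp
      fix h :: "real Matrix.vec"
      assume h: "h \<in> carrier_vec n" and hd: "euclid_norm h < d / (K + 1)"
      define t where "t = c \<bullet> h"
      define r where "r = \<phi> (c \<bullet> x + t) - \<phi> (c \<bullet> x) - \<phi>' (c \<bullet> x) * t"
      have "lure_field A b c \<phi> (x + h) - lure_field A b c \<phi> x - lure_jacobian n A b c \<phi>' x *\<^sub>v h = (- r) \<cdot>\<^sub>v b"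
        unfolding lure_jacobian_mult[OF A b h] lure_field_def mult_add_distrib_mat_vec[OF A x h]
          scalar_prod_add_distrib[OF c x h] r_def t_def
        using A b x h by (intro eq_vecI) (auto simp: algebra_simps)
      then have "euclid_norm (lure_field A b c \<phi> (x + h) - lure_field A b c \<phi> x - lure_jacobian n A b c \<phi>' x *\<^sub>v h) = \<bar>r\<bar> * B"
        unfolding B_def by (simp only: euclid_norm_smult abs_minus_cancel)
      also have "\<dots> \<le> (e' * \<bar>t\<bar>) * B"
        unfolding r_def using small[OF h hd d] B by (intro mult_right_mono bound) (auto simp: t_def)
      also have "\<dots> \<le> (e' * (K * euclid_norm h)) * (B + 1)"
        using e' B K euclid_norm_nonneg[of h] scalar_prod_le_euclid_norm[OF h, of c]
        unfolding t_def K_def[symmetric] by (intro mult_mono) auto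
      also have "\<dots> \<le> (e' * ((K + 1) * euclid_norm h)) * (B + 1)"
        using e' B K euclid_norm_nonneg[of h] by (intro mult_right_mono mult_left_mono) auto
      also have "\<dots> = e * euclid_norm h"
      proof -
        have "(K + 1) * (B + 1) \<noteq> 0" using K B by simp
        then have "e' * ((K + 1) * (B + 1)) = e" unfolding e'_def by simp
        then show ?thesis by (metis mult.assoc mult.commute)
      qed
      finally show "euclid_norm (lure_field A b c \<phi> (x + h) - lure_field A b c \<phi> x - lure_jacobian n A b c \<phi>' x *\<^sub>v h)
          \<le> e * euclid_norm h" .
    qed
  next
    fix x :: "real Matrix.vec" and e :: real
    assume x: "x \<in> carrier_vec n" and e: "0 < e"
    define S where "S = (\<Sum>i<n. \<bar>b $ i\<bar>) * K"
    have S: "0 \<le> S" unfolding S_def using K by (intro mult_nonneg_nonneg sum_nonneg) auto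
    have "continuous (at (c \<bullet> x)) \<phi>'" using cont by (simp add: continuous_on_eq_continuous_at)
    moreover have "e / (S + 1) > 0" using e S by simp
    ultimately obtain d where d: "d > 0" "\<And>z. \<bar>z - c \<bullet> x\<bar> < d \<Longrightarrow> \<bar>\<phi>' z - \<phi>' (c \<bullet> x)\<bar> < e / (S + 1)"
      unfolding continuous_at_eps_delta dist_real_def by blast
    show "\<exists>d>0. \<forall>y\<in>carrier_vec n. euclid_norm (y - x) < d \<longrightarrow>
        (\<forall>i<n. \<forall>j<n. \<bar>lure_jacobian n A b c \<phi>' y $$ (i, j) - lure_jacobian n A b c \<phi>' x $$ (i, j)\<bar> < e)"
    proof (intro exI[of _ "d / (K + 1)"] conjI ballI impI allI)
      show "d / (K + 1) > 0" using d K by simp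
      fix y :: "real Matrix.vec" and i j
      assume y: "y \<in> carrier_vec n" and yd: "euclid_norm (y - x) < d / (K + 1)" and ij: "i < n" "j < n"
      have "\<bar>c \<bullet> (y - x)\<bar> < d" using small[of "y - x" d] x y yd d(1) by auto
      then have "\<bar>c \<bullet> y - c \<bullet> x\<bar> < d" by (simp add: scalar_prod_minus_distrib[OF c y x])
      then have 1: "\<bar>\<phi>' (c \<bullet> y) - \<phi>' (c \<bullet> x)\<bar> < e / (S + 1)" by (rule d(2))
      have 2: "\<bar>b $ i * c $ j\<bar> \<le> S"
        unfolding S_def K_def abs_mult using ij
        by (intro mult_mono member_le_sum sum_nonneg) auto
      have "\<bar>lure_jacobian n A b c \<phi>' y $$ (i, j) - lure_jacobian n A b c \<phi>' x $$ (i, j)\<bar> =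
          \<bar>\<phi>' (c \<bullet> y) - \<phi>' (c \<bullet> x)\<bar> * \<bar>b $ i * c $ j\<bar>"
        using ij unfolding lure_jacobian_def
        by (simp add: abs_mult[symmetric] algebra_simps abs_minus_commute)
      also have "\<dots> \<le> e / (S + 1) * S" using 1 2 by (intro mult_mono) auto
      also have "\<dots> < e" using e S by (simp add: field_simps)
      finally show "\<bar>lure_jacobian n A b c \<phi>' y $$ (i, j) - lure_jacobian n A b c \<phi>' x $$ (i, j)\<bar> < e" .
    qed
  qed
qed

section \<open>Dominance form and spectrum of the linear part\<close>

text \<open>For y the velocity of the variation x, symmetry of P merges the two off-diagonal blocks
  and the rate is absorbed into y + lam x. This is the Lyapunov term of the KYP inequality.\<close>

lemma dominance_form:
  assumes P: "P \<in> carrier_mat n n" and sym: "transpose_mat P = P"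
    and y: "y \<in> carrier_vec n" and x: "x \<in> carrier_vec n"
  shows "(y @\<^sub>v x) \<bullet> (dominance_matrix n lam eps P *\<^sub>v (y @\<^sub>v x)) =
    2 * (x \<bullet> (P *\<^sub>v (y + lam \<cdot>\<^sub>v x))) + eps * (x \<bullet> x)"
proof -
  have yPx: "y \<bullet> (P *\<^sub>v x) = x \<bullet> (P *\<^sub>v y)"
    using transpose_vec_mult_scalar[OF P x y] P x y unfolding sym
    by (metis comm_scalar_prod mult_mat_vec_carrier)
  have "(eps \<cdot>\<^sub>m 1\<^sub>m n) *\<^sub>v x = eps \<cdot>\<^sub>v x"
    using x by (intro eq_vecI) (auto simp: scalar_prod_left_unit)
  moreover have "((2 * lam) \<cdot>\<^sub>m P) *\<^sub>v x = (2 * lam) \<cdot>\<^sub>v (P *\<^sub>v x)"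
    using P x by (intro eq_vecI) auto
  ultimately have D: "((2 * lam) \<cdot>\<^sub>m P + eps \<cdot>\<^sub>m 1\<^sub>m n) *\<^sub>v x = (2 * lam) \<cdot>\<^sub>v (P *\<^sub>v x) + eps \<cdot>\<^sub>v x"
    using P x by (simp add: add_mult_distrib_mat_vec[of _ n n])
  have Z: "0\<^sub>m n n *\<^sub>v y + P *\<^sub>v x = P *\<^sub>v x"
    using P x y by (intro eq_vecI) auto
  have "dominance_matrix n lam eps P *\<^sub>v (y @\<^sub>v x) =
      (0\<^sub>m n n *\<^sub>v y + P *\<^sub>v x) @\<^sub>v (P *\<^sub>v y + ((2 * lam) \<cdot>\<^sub>m P + eps \<cdot>\<^sub>m 1\<^sub>m n) *\<^sub>v x)"
    unfolding dominance_matrix_def using P x y by (intro four_block_mat_mult_vec[of _ n n _ n _ n]) auto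
  then have "(y @\<^sub>v x) \<bullet> (dominance_matrix n lam eps P *\<^sub>v (y @\<^sub>v x)) =
      y \<bullet> (P *\<^sub>v x) + x \<bullet> (P *\<^sub>v y + ((2 * lam) \<cdot>\<^sub>v (P *\<^sub>v x) + eps \<cdot>\<^sub>v x))"
    unfolding D Z using P x y by (simp only:) (subst scalar_prod_append[of _ n _ n], auto)
  also have "\<dots> = 2 * (x \<bullet> (P *\<^sub>v (y + lam \<cdot>\<^sub>v x))) + eps * (x \<bullet> x)"
    using P x y yPx
    by (simp add: mult_add_distrib_mat_vec[of _ n n] mult_mat_vec[of _ n n] scalar_prod_add_distrib[of _ n])
  finally show ?thesis .
qed

text \<open>Similarity preserves the characteristic polynomial, and the block form factors it.
  Listing the p roots of the dominant block first is what later fixes the number of negative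
  eigenvalues of P.\<close>

lemma splitting_reduction_spectrum:
  assumes A: "A \<in> carrier_mat n n" and pn: "p \<le> n"
    and red: "splitting_reduction lam p n \<nu> m l A B C Ah Bh Ch"
  obtains es1 es2 where "char_poly (cmat A) = (\<Prod>e\<leftarrow>es1 @ es2. [:- e, 1:])" "length es1 = p"
    "\<And>e. e \<in> set es1 \<Longrightarrow> - lam < Re e" "\<And>e. e \<in> set es2 \<Longrightarrow> Re e < - lam"
proof -
  from red obtain T Ti Ap Am where Ap: "Ap \<in> carrier_mat p p" and Am: "Am \<in> carrier_mat (n - p) (n - p)"
    and sim: "similar_mat_wit A (block_diag Ap Am) T Ti"
    and eAp: "\<And>s. eigenvalue (cmat Ap) s \<Longrightarrow> - lam < Re s"
    and eAm: "\<And>s. eigenvalue (cmat Am) s \<Longrightarrow> Re s < - lam"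
    unfolding splitting_reduction_def by blast
  have cAp: "cmat Ap \<in> carrier_mat p p" and cAm: "cmat Am \<in> carrier_mat (n - p) (n - p)"
    using Ap Am by auto
  obtain es1 where es1: "char_poly (cmat Ap) = (\<Prod>e\<leftarrow>es1. [:- e, 1:])" "length es1 = p"
    using char_poly_factorized[OF cAp] by blast
  obtain es2 where es2: "char_poly (cmat Am) = (\<Prod>e\<leftarrow>es2. [:- e, 1:])" "length es2 = n - p"
    using char_poly_factorized[OF cAm] by blast
  define D where "D = four_block_mat Ap (0\<^sub>m p (n - p)) (0\<^sub>m (n - p) p) Am"
  have D: "block_diag Ap Am = D" unfolding block_diag_def D_def using Ap Am by simp
  have Dc: "D \<in> carrier_mat n n" using similar_mat_witD2[OF A sim] unfolding D by simp
  have "char_poly A = char_poly D"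
    using sim unfolding D by (intro char_poly_similar) (auto simp: similar_mat_def)
  then have "char_poly (cmat A) = char_poly (cmat D)"
    by (simp add: of_real_hom.char_poly_hom[OF A] of_real_hom.char_poly_hom[OF Dc])
  also have "cmat D = four_block_mat (cmat Ap) (0\<^sub>m p (n - p)) (0\<^sub>m (n - p) p) (cmat Am)"
    unfolding D_def using Ap Am by (subst map_four_block_mat[of _ p p _ "n - p" _ "n - p"]) auto
  also have "char_poly \<dots> = char_poly (cmat Ap) * char_poly (cmat Am)"
    by (rule char_poly_0_block[OF refl]) (use es1 es2 cAp cAm in auto)
  finally have "char_poly (cmat A) = (\<Prod>e\<leftarrow>es1 @ es2. [:- e, 1:])"
    unfolding es1 es2 by simp
  moreover have "- lam < Re e" if "e \<in> set es1" for e
    using that by (intro eAp)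
      (auto simp: eigenvalue_root_char_poly[OF cAp] es1(1) poly_prod_list prod_list_zero_iff intro!: bexI[of _ e])
  moreover have "Re e < - lam" if "e \<in> set es2" for e
    using that by (intro eAm)
      (auto simp: eigenvalue_root_char_poly[OF cAm] es2(1) poly_prod_list prod_list_zero_iff intro!: bexI[of _ e])
  ultimately show thesis using that es1(2) by blast
qed

lemma C1_differentiable_real_derivative:
  assumes "\<phi> C1_differentiable_on UNIV"
  shows "(\<phi> has_real_derivative deriv \<phi> z) (at z)" and "continuous_on UNIV (deriv \<phi>)"
proof -
  obtain D where D: "\<And>z. (\<phi> has_vector_derivative D z) (at z)" "continuous_on UNIV D"
    using assms unfolding C1_differentiable_on_def by auto
  have der: "(\<phi> has_real_derivative D z) (at z)" for z
    using D(1) by (simp add: has_real_derivative_iff_has_vector_derivative)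
  then have "deriv \<phi> = D" by (intro ext DERIV_imp_deriv)
  then show "(\<phi> has_real_derivative deriv \<phi> z) (at z)" "continuous_on UNIV (deriv \<phi>)"
    using der D(2) by simp_all
qed

lemma Re_hform_real:
  fixes M P :: "nat \<Rightarrow> nat \<Rightarrow> real" and x :: "nat \<Rightarrow> complex"
  shows "Re (hform {..<n} (\<lambda>i j. complex_of_real (P i j)) x (\<lambda>j. \<Sum>l<n. complex_of_real (M j l) * x l)) =
    (\<Sum>i<n. \<Sum>j<n. P i j * Re (x i) * (\<Sum>l<n. M j l * Re (x l))) +
    (\<Sum>i<n. \<Sum>j<n. P i j * Im (x i) * (\<Sum>l<n. M j l * Im (x l)))"
  unfolding hform_def Re_sum sum.distrib[symmetric]
  by (intro sum.cong refl) (simp add: algebra_simps)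

text \<open>One matrix P serves twice: the KYP inequality at w = 0 determines its inertia, and at w
  equal to the differential feedback it is the dominance inequality. \<open>gain\<close> states
  \<mu> |G_zw| < 1 on the line Re s = - lam in terms of solutions.\<close>

lemma lure_strictly_dominant:
  fixes A :: "real mat" and b c :: "real Matrix.vec"
  assumes A: "A \<in> carrier_mat n n" and b: "b \<in> carrier_vec n" and c: "c \<in> carrier_vec n"
    and cp: "char_poly (cmat A) = (\<Prod>e\<leftarrow>es1 @ es2. [:- e, 1:])"
    and es1: "\<And>e. e \<in> set es1 \<Longrightarrow> - lam < Re e" and es2: "\<And>e. e \<in> set es2 \<Longrightarrow> Re e < - lam"
    and \<phi>: "\<phi> C1_differentiable_on UNIV" and \<mu>: "\<mu> > 0" "deriv_in_sector \<phi> (- \<mu>) \<mu>"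
    and gain: "\<And>(x :: nat \<Rightarrow> complex) w \<omega>. \<lbrakk>(\<exists>i<n. x i \<noteq> 0) \<or> w \<noteq> 0;
      \<And>i. i < n \<Longrightarrow> (\<i> * complex_of_real \<omega> - complex_of_real lam) * x i =
        (\<Sum>j<n. complex_of_real (A $$ (i, j)) * x j) + complex_of_real (b $ i) * w\<rbrakk>
      \<Longrightarrow> \<mu> * cmod (\<Sum>i<n. complex_of_real (c $ i) * x i) < cmod w"
  shows "strictly_dominant n (lure_field A b c \<phi>) (length es1) lam"
proof -
  \<comment> \<open>The shift by lam moves the line Re s = - lam to the imaginary axis.\<close>
  define M where "M i j = A $$ (i, j) + (if i = j then lam else 0)" for i j
  have Msum: "(\<Sum>l<n. complex_of_real (M j l) * x l) = (\<Sum>l<n. complex_of_real (A $$ (j, l)) * x l) + lam * x j"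
    if "j < n" for j and x :: "nat \<Rightarrow> complex"
  proof -
    have "(\<Sum>l<n. complex_of_real (M j l) * x l) =
        (\<Sum>l<n. complex_of_real (A $$ (j, l)) * x l + (if j = l then lam * x l else 0))"
      unfolding M_def by (intro sum.cong refl) (simp add: distrib_right)
    then show ?thesis using that by (simp add: sum.distrib)
  qed
  have MsumR: "(\<Sum>l<n. M j l * x l) = (\<Sum>l<n. A $$ (j, l) * x l) + lam * x j" if "j < n" for j x
  proof -
    have "(\<Sum>l<n. M j l * x l) = (\<Sum>l<n. A $$ (j, l) * x l + (if j = l then lam * x l else 0))"
      unfolding M_def by (intro sum.cong refl) (simp add: distrib_right)
    then show ?thesis using that by (simp add: sum.distrib)
  qed
  obtain P \<kappa> where \<kappa>: "\<kappa> > 0" and sym: "\<And>i j. P i j = P j i"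
    and lmi: "\<And>x w. 2 * (\<Sum>i<n. \<Sum>j<n. P i j * x i * ((\<Sum>l<n. M j l * x l) + b $ j * w)) +
        (\<Sum>i<n. (\<mu> * c $ i) * x i)\<^sup>2 - w\<^sup>2 \<le> - \<kappa> * ((\<Sum>i<n. (x i)\<^sup>2) + w\<^sup>2)"
  \<comment> \<open>Scaling the output row by \<mu> normalises the gain bound to 1.\<close>
  proof (rule strict_kyp[of n M "\<lambda>i. b $ i" "\<lambda>i. \<mu> * c $ i"])
    fix x :: "nat \<Rightarrow> complex" and w \<omega>
    assume nz: "(\<exists>i<n. x i \<noteq> 0) \<or> w \<noteq> 0"
      and eq: "\<And>i. i < n \<Longrightarrow> \<i> * complex_of_real \<omega> * x i =
        (\<Sum>j<n. complex_of_real (M i j) * x j) + complex_of_real (b $ i) * w"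
    have "\<mu> * cmod (\<Sum>i<n. complex_of_real (c $ i) * x i) < cmod w"
      by (rule gain[OF nz, of \<omega>]) (use eq Msum in \<open>simp add: left_diff_distrib\<close>)
    moreover have "(\<Sum>i<n. complex_of_real (\<mu> * c $ i) * x i) = complex_of_real \<mu> * (\<Sum>i<n. complex_of_real (c $ i) * x i)"
      by (simp add: sum_distrib_left mult.assoc)
    ultimately show "cmod (\<Sum>i<n. complex_of_real (\<mu> * c $ i) * x i) < cmod w"
      using \<mu>(1) by (simp add: norm_mult)
  qed (rule that)
  define Pm where "Pm = mat n n (\<lambda>(i, j). P i j)"
  have Pm: "Pm \<in> carrier_mat n n" unfolding Pm_def by simp
  have Pt: "transpose_mat Pm = Pm" unfolding Pm_def by (intro eq_matI) (auto simp: sym)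
  have "inertia Pm = (length es1, 0, n - length es1)"
    unfolding Pm_def
  proof (rule inertia_lyapunov[OF sym _ cp es1 es2])
    show "cmat A \<in> carrier_mat n n" using A by simp
    fix x :: "nat \<Rightarrow> complex"
    assume nz: "\<exists>i<n. x i \<noteq> 0"
    define S where "S y = (\<Sum>i<n. \<Sum>j<n. P i j * y i * (\<Sum>l<n. M j l * y l))" for y
    have lmi0: "2 * S y \<le> - \<kappa> * (\<Sum>i<n. (y i)\<^sup>2)" for y
    proof -
      have "2 * S y + (\<Sum>i<n. \<mu> * c $ i * y i)\<^sup>2 \<le> - \<kappa> * (\<Sum>i<n. (y i)\<^sup>2)"
        using lmi[of y 0] unfolding S_def by simp
      then show ?thesis by (rule order_trans[rotated]) simp
    qed
    have "hform {..<n} (\<lambda>i j. complex_of_real (P i j)) x (\<lambda>i. (\<Sum>k<n. cmat A $$ (i, k) * x k) + lam * x i) =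
        hform {..<n} (\<lambda>i j. complex_of_real (P i j)) x (\<lambda>j. \<Sum>l<n. complex_of_real (M j l) * x l)"
      using A by (intro hform_cong) (auto simp: Msum intro!: sum.cong)
    moreover have "Re (hform {..<n} (\<lambda>i j. complex_of_real (P i j)) x (\<lambda>j. \<Sum>l<n. complex_of_real (M j l) * x l)) < 0"
    proof -
      obtain k where k: "k < n" "x k \<noteq> 0" using nz by blast
      then have "0 < (cmod (x k))\<^sup>2" by simp
      also have "\<dots> \<le> (\<Sum>i<n. (cmod (x i))\<^sup>2)" using k by (intro member_le_sum) auto
      also have "\<dots> = (\<Sum>i<n. (Re (x i))\<^sup>2) + (\<Sum>i<n. (Im (x i))\<^sup>2)"
        by (simp add: cmod_power2 sum.distrib)
      finally have "0 < \<kappa> * ((\<Sum>i<n. (Re (x i))\<^sup>2) + (\<Sum>i<n. (Im (x i))\<^sup>2))"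
        using \<kappa> by simp
      then show ?thesis
        unfolding Re_hform_real S_def[symmetric]
        using lmi0[of "\<lambda>i. Re (x i)"] lmi0[of "\<lambda>i. Im (x i)"] by (simp add: distrib_left)
    qed
    ultimately show "Re (hform {..<n} (\<lambda>i j. complex_of_real (P i j)) x
        (\<lambda>i. (\<Sum>k<n. cmat A $$ (i, k) * x k) + lam * x i)) < 0" by simp
  qed
  moreover have "let v = (lure_jacobian n A b c (deriv \<phi>) x *\<^sub>v h) @\<^sub>v h in v \<bullet> (dominance_matrix n lam \<kappa> Pm *\<^sub>v v) \<le> 0"
    if x: "x \<in> carrier_vec n" and h: "h \<in> carrier_vec n" for x h
  proof -
    define \<delta> where "\<delta> = deriv \<phi> (c \<bullet> x)"
    \<comment> \<open>The input of the variational system: the Jacobian maps h to A h + w b.\<close>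
    define w where "w = - \<delta> * (c \<bullet> h)"
    let ?y = "lure_jacobian n A b c (deriv \<phi>) x *\<^sub>v h"
    have y: "?y \<in> carrier_vec n" using h unfolding lure_jacobian_def by (intro mult_mat_vec_carrier) auto
    have "\<delta>\<^sup>2 \<le> \<mu>\<^sup>2"
      \<comment> \<open>At increment 1 the sector condition reads (\<delta> + \<mu>)(\<delta> -
        \<mu>) \<le> 0.\<close>
      using \<mu>(2)[unfolded deriv_in_sector_def, rule_format, of "c \<bullet> x" 1]
      unfolding \<delta>_def by (simp add: power2_eq_square algebra_simps)
    then have "\<delta>\<^sup>2 * (c \<bullet> h)\<^sup>2 \<le> \<mu>\<^sup>2 * (c \<bullet> h)\<^sup>2" by (intro mult_right_mono) auto
    moreover have "(\<Sum>i<n. \<mu> * c $ i * h $ i) = \<mu> * (c \<bullet> h)"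
      by (simp add: scalar_prod_sum[OF h] sum_distrib_left mult.assoc)
    ultimately have w: "w\<^sup>2 \<le> (\<Sum>i<n. \<mu> * c $ i * h $ i)\<^sup>2"
      unfolding w_def by (simp add: power_mult_distrib)
    have yj: "(?y + lam \<cdot>\<^sub>v h) $ j = (\<Sum>l<n. M j l * h $ l) + b $ j * w" if "j < n" for j
      unfolding lure_jacobian_mult[OF A b h] MsumR[OF that] w_def \<delta>_def
      using that A b h by (simp add: scalar_prod_sum[OF h])
    have yl: "?y + lam \<cdot>\<^sub>v h \<in> carrier_vec n" using y h by auto
    have "h \<bullet> (Pm *\<^sub>v (?y + lam \<cdot>\<^sub>v h)) = (\<Sum>i<n. h $ i * (\<Sum>j<n. P i j * (?y + lam \<cdot>\<^sub>v h) $ j))"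
      using mult_mat_vec_carrier[OF Pm yl] Pm
      by (subst scalar_prod_sum[of _ n], simp, intro sum.cong refl)
        (simp add: scalar_prod_sum[OF yl] Pm_def del: index_add_vec index_smult_vec)
    also have "\<dots> = (\<Sum>i<n. \<Sum>j<n. P i j * h $ i * ((\<Sum>l<n. M j l * h $ l) + b $ j * w))"
      unfolding sum_distrib_left by (intro sum.cong refl) (simp add: yj del: index_add_vec)
    finally have "2 * (h \<bullet> (Pm *\<^sub>v (?y + lam \<cdot>\<^sub>v h))) + (\<Sum>i<n. \<mu> * c $ i * h $ i)\<^sup>2 - w\<^sup>2
        \<le> - \<kappa> * ((\<Sum>i<n. (h $ i)\<^sup>2) + w\<^sup>2)"
      using lmi[of "\<lambda>i. h $ i" w] by simp
    moreover have "0 \<le> \<kappa> * w\<^sup>2" using \<kappa> by simp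
    moreover have "h \<bullet> h = (\<Sum>i<n. (h $ i)\<^sup>2)" by (simp add: scalar_prod_sum[OF h] power2_eq_square)
    ultimately have "2 * (h \<bullet> (Pm *\<^sub>v (?y + lam \<cdot>\<^sub>v h))) + \<kappa> * (h \<bullet> h) \<le> 0"
      using w by (simp add: distrib_left)
    then show ?thesis unfolding Let_def dominance_form[OF Pm Pt y h] .
  qed
  moreover have "C1_with_jacobian n (lure_field A b c \<phi>) (lure_jacobian n A b c (deriv \<phi>))"
    using C1_differentiable_real_derivative[OF \<phi>] by (intro lure_field_C1[OF A b c])
  ultimately have "dominant_with n (lure_field A b c \<phi>) (length es1) lam \<kappa>"
    unfolding dominant_with_def using Pm Pt by blast
  then show ?thesis unfolding strictly_dominant_def using \<kappa> by blast
qed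

text \<open>Counting from 0, index 1 selects w among the inputs [u, w] and z among the outputs
  [y, z]. The bound \<epsilon> on the error entry and the bound inverse \<mu> - \<epsilon> on the
  reduced entry add up to inverse \<mu>; the second bound is strict, hence so is the sum.\<close>

theorem theorem5:
  fixes lam \<mu> \<epsilon> :: real and p \<nu> n :: nat
    and A Ah :: "real Matrix.mat"
    and Bu Bw Cy Cz Bhu Bhw Chy Chz :: "real Matrix.vec"
    and \<phi> :: "real \<Rightarrow> real"
    and G Gh :: "complex \<Rightarrow> complex Matrix.mat"
  assumes "lam \<ge> 0" and "p \<le> \<nu>" and "\<nu> < n"
    and "A \<in> carrier_mat n n"
    and "Bu \<in> carrier_vec n" and "Bw \<in> carrier_vec n"
    and "Cy \<in> carrier_vec n" and "Cz \<in> carrier_vec n"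
    and "Ah \<in> carrier_mat \<nu> \<nu>"
    and "Bhu \<in> carrier_vec \<nu>" and "Bhw \<in> carrier_vec \<nu>"
    and "Chy \<in> carrier_vec \<nu>" and "Chz \<in> carrier_vec \<nu>"
    and "\<phi> C1_differentiable_on UNIV" and "\<phi> 0 = 0"
    and reduction: "splitting_reduction lam p n \<nu> 2 2
          A (mat_of_cols n [Bu, Bw]) (mat_of_rows n [Cy, Cz])
          Ah (mat_of_cols \<nu> [Bhu, Bhw]) (mat_of_rows \<nu> [Chy, Chz])"
    and G_def: "G = transfer A (mat_of_cols n [Bu, Bw]) (mat_of_rows n [Cy, Cz])"
    and Gh_def: "Gh = transfer Ah (mat_of_cols \<nu> [Bhu, Bhw]) (mat_of_rows \<nu> [Chy, Chz])"
    and A1: "strictly_dominant n (linear_field A) p lam"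
    and A2: "\<mu> > 0" "deriv_in_sector \<phi> (- \<mu>) \<mu>"
    and A3: "0 < \<epsilon>" "\<epsilon> < inverse \<mu>" "hinf_norm lam 0 (\<lambda>s. G s - Gh s) \<le> ereal \<epsilon>"
    and A4: "hinf_norm lam p (transfer Ah (mat_of_cols \<nu> [Bhw]) (mat_of_rows \<nu> [Chz]))
               < ereal (inverse \<mu> - \<epsilon>)"
  shows "strictly_dominant n (lure_field A Bw Cz \<phi>) p lam"
proof -
  note A = assms(4) and Bw = assms(6) and Cz = assms(8)
  have "p \<le> n" using assms(2,3) by simp
  then obtain es1 es2 where cp: "char_poly (cmat A) = (\<Prod>e\<leftarrow>es1 @ es2. [:- e, 1:])" and p: "length es1 = p"
    and es1: "\<And>e. e \<in> set es1 \<Longrightarrow> - lam < Re e" and es2: "\<And>e. e \<in> set es2 \<Longrightarrow> Re e < - lam"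
    using splitting_reduction_spectrum[OF A _ reduction] by metis
  have cA: "cmat A \<in> carrier_mat n n" using A by simp
  let ?B = "mat_of_cols n [Bu, Bw]" and ?C = "mat_of_rows n [Cy, Cz]"
  let ?Gzw = "transfer Ah (mat_of_cols \<nu> [Bhw]) (mat_of_rows \<nu> [Chz])"
  have BC: "?B \<in> carrier_mat n 2" "?C \<in> carrier_mat 2 n" by auto
  have "strictly_dominant n (lure_field A Bw Cz \<phi>) (length es1) lam"
  proof (rule lure_strictly_dominant[OF A Bw Cz cp es1 es2 assms(14) A2])
    fix x :: "nat \<Rightarrow> complex" and w :: complex and \<omega> :: real
    let ?s = "\<i> * complex_of_real \<omega> - complex_of_real lam"
    assume nz: "(\<exists>i<n. x i \<noteq> 0) \<or> w \<noteq> 0"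
      and eq: "\<And>i. i < n \<Longrightarrow> ?s * x i = (\<Sum>j<n. complex_of_real (A $$ (i, j)) * x j) + complex_of_real (Bw $ i) * w"
    \<comment> \<open>Every eigenvalue of A lies strictly to one side of the line, so the resolvent
      exists on it.\<close>
    have ev: "\<not> eigenvalue (cmat A) ?s"
    proof
      assume "eigenvalue (cmat A) ?s"
      then have "?s \<in> set es1 \<union> set es2"
        unfolding eigenvalue_root_char_poly[OF cA] cp poly_prod_list by (auto simp: prod_list_zero_iff)
      then show False using es1 es2 by force
    qed
    define v where "v = vec n x"
    have v: "v \<in> carrier_vec n" unfolding v_def by simp
    have colB: "col (cmat ?B) 1 = map_vec complex_of_real Bw"
      using Bw by (intro eq_vecI) (auto simp: mat_of_cols_index)
    have rowC: "row (cmat ?C) 1 = map_vec complex_of_real Cz"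
      using Cz by (intro eq_vecI) (auto simp: mat_of_rows_index)
    have Av: "(cmat A *\<^sub>v v) $ i = (\<Sum>j<n. complex_of_real (A $$ (i, j)) * x j)" if "i < n" for i
      using that A by (simp add: scalar_prod_def v_def lessThan_atLeast0)
    have "?s \<cdot>\<^sub>v v = cmat A *\<^sub>v v + w \<cdot>\<^sub>v col (cmat ?B) 1"
    proof
      show "dim_vec (?s \<cdot>\<^sub>v v) = dim_vec (cmat A *\<^sub>v v + w \<cdot>\<^sub>v col (cmat ?B) 1)"
        unfolding colB using v Bw by simp
      fix i assume "i < dim_vec (cmat A *\<^sub>v v + w \<cdot>\<^sub>v col (cmat ?B) 1)"
      then have i: "i < n" unfolding colB using Bw by simp
      then show "(?s \<cdot>\<^sub>v v) $ i = (cmat A *\<^sub>v v + w \<cdot>\<^sub>v col (cmat ?B) 1) $ i"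
        unfolding colB using Av[OF i] eq[OF i] Bw cA by (simp add: v_def mult.commute)
    qed
    note vw = this
    have "row (cmat ?C) 1 \<bullet> v = transfer A ?B ?C ?s $$ (1, 1) * w"
      by (rule transfer_response[OF A BC ev _ _ v vw]) auto
    moreover have "row (cmat ?C) 1 \<bullet> v = (\<Sum>i<n. complex_of_real (Cz $ i) * x i)"
      unfolding rowC using Cz by (simp add: scalar_prod_def v_def lessThan_atLeast0)
    ultimately have out: "(\<Sum>i<n. complex_of_real (Cz $ i) * x i) = G ?s $$ (1, 1) * w"
      unfolding G_def by simp
    \<comment> \<open>With w = 0 the state would be an eigenvector of A for a point of the line. A
      nonzero w is what lets the strict bound on the transfer function survive multiplication by
      |w|.\<close>
    have "w \<noteq> 0"
    proof
      assume w: "w = 0"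
      then obtain i where i: "i < n" "x i \<noteq> 0" using nz by blast
      have "v \<noteq> 0\<^sub>v n" using i unfolding v_def by (metis index_vec index_zero_vec(1))
      moreover have "cmat A *\<^sub>v v = ?s \<cdot>\<^sub>v v"
        unfolding vw w colB using cA v Bw by (intro eq_vecI) auto
      ultimately show False using ev v cA unfolding eigenvalue_def eigenvector_def by auto
    qed
    have "cmod ((G ?s - Gh ?s) $$ (1, 1)) \<le> \<epsilon>"
    proof -
      have "G ?s - Gh ?s \<in> carrier_mat 2 2" unfolding G_def Gh_def by (intro carrier_matI) auto
      from sigma_max_2[OF this] show ?thesis
        using hinf_norm_le_sigma_max[OF A3(3), of \<omega>] by simp
    qed
    moreover have "cmod (Gh ?s $$ (1, 1)) < inverse \<mu> - \<epsilon>"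
    proof -
      have "?Gzw ?s \<in> carrier_mat 1 1" by (intro carrier_matI) auto
      from sigma_max_1[OF this] have "cmod (?Gzw ?s $$ (0, 0)) < inverse \<mu> - \<epsilon>"
        using hinf_norm_less_sigma_max[OF A4, of \<omega>] by simp
      \<comment> \<open>The gain of the reduced model is bounded for the scalar transfer function,
        which shares its resolvent with the 2 x 2 one.\<close>
      moreover have "Gh ?s $$ (1, 1) = ?Gzw ?s $$ (0, 0)"
        unfolding Gh_def using assms(11,13)
        by (intro transfer_entry_cong) (auto simp: col_mat_of_cols)
      ultimately show ?thesis by simp
    qed
    moreover have "(G ?s - Gh ?s) $$ (1, 1) = G ?s $$ (1, 1) - Gh ?s $$ (1, 1)"
      unfolding G_def Gh_def by simp
    ultimately have "cmod (G ?s $$ (1, 1)) < inverse \<mu>"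
      using norm_triangle_ineq[of "(G ?s - Gh ?s) $$ (1, 1)" "Gh ?s $$ (1, 1)"] by simp
    then have "\<mu> * cmod (G ?s $$ (1, 1)) < 1" using A2(1) by (simp add: field_simps)
    then show "\<mu> * cmod (\<Sum>i<n. complex_of_real (Cz $ i) * x i) < cmod w"
      unfolding out norm_mult using \<open>w \<noteq> 0\<close> by (simp add: mult.assoc[symmetric])
  qed
  then show ?thesis unfolding p .
qed

end
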